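(* Let $U$ be a filtered algebra over $\Bbbk$ and let $g_1,\dots,g_t\in U$ be mutually commuting elements such that $\{\overline g_1,\dots,\overline g_t\}$ is a complete intersection for $\overline U=\operatorname{gr}U$. Let $\Gamma=\Bbbk[g_1,\dots,g_t]\subset U$. Let $\mu_1,\dots,\mu_t\in U$ satisfy $\deg g_i>\deg\mu_i$ for $i=1,\dots,t$, put $I_\mu=U(g_1-\mu_1)+\dots+U(g_t-\mu_t)$, and assume that the elements $g_1-\mu_1,\dots,g_t-\mu_t$ mutually commute. Then: 1. For every $m\ge 0$, $I_\mu\cap U_m=\sum_{i=1}^tU_{m-d_i}(g_i-\mu_i)$, where $d_i=\deg g_i$. 2. $\overline{I_\mu}=\overline U\,\overline g_1+\dots+\overline U\,\overline g_t$; in particular $I_\mu\neq U$. 3. There exists a simple left $U$-module $M$ generated by an element $v\in M$ such that $g_iv=\mu_iv$ for all $i=1,\dots,t$. 4. For any $\nu\in\operatorname{Specm}\Gamma$ there exists a simple left $U$-module $M$ generated by an element $v\in M$ such that $\gamma v=\nu(\gamma)v$ for every $\gamma\in\Gamma$.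
   Context: $\Bbbk$ is an algebraically closed field of characteristic $0$. A filtered algebra is an associative (unital, not necessarily commutative) $\Bbbk$-algebra $U$ with an increasing filtration $\{U_i\}_{i\ge 0}$, $U_0=\Bbbk$, $U_iU_j\subset U_{i+j}$, $U=\bigcup_i U_i$; put $U_i=0$ for $i<0$. Its associated graded algebra is $\overline U=\operatorname{gr}U=\bigoplus_{i\ge0}U_i/U_{i-1}$. If $u\in U_i\setminus U_{i-1}$, then $\deg u=i$ and $\overline u\in U_i/U_{i-1}$ is the class of $u$; $\deg 0=-\infty$. For a left ideal $I\subset U$, $\overline I=\bigoplus_i (I\cap U_i+U_{i-1})/U_{i-1}\subset\overline U$ is the graded left ideal spanned by all $\overline s$, $s\in I$. Complete intersection sequence: for an associative algebra $R$ and a sequence $\mathsf g=\{g_1,\dots,g_t\}$ of mutually commuting elements of $R$, the Koszul complex $\mathbf K_\bullet(\mathsf g,R)$ is the complex of left $R$-modules with $\mathbf K_i=R\otimes_\Bbbk\bigwedge^i\Bbbk^t$ for $i\ge0$, $\mathbf K_i=0$ for $i<0$, and $d_i(a\otimes e_{j_1}\wedge\dots\wedge e_{j_i})=\sum_{k=1}^i(-1)^{k-1}ag_{j_k}\otimes e_{j_1}\wedge\dots\widehat{e_{j_k}}\dots\wedge e_{j_i}$. The sequence $\mathsf g$ is a complete intersection for $R$ if $H_i(\mathbf K_\bullet(\mathsf g,R))=0$ for $i\neq0$ and $H_0\ne0$ (here $H_0\simeq R/(Rg_1+\dots+Rg_t)$). $\operatorname{Specm}\Gamma$ is the set of maximal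 ideals of the affine commutative algebra $\Gamma$; a maximal ideal $\nu$ is identified with the character $\Gamma\to\Gamma/\nu=\Bbbk$, $\gamma\mapsto\nu(\gamma)$. *)

theory Defs
  imports "HOL-Algebra.Algebra" "HOL-Library.Extended"
begin

section \<open>Filtered algebras\<close>

(* HOL-Algebra's locale algebra requires a commutative multiplication on the algebra. *)
locale assoc_algebra = module K U + K?: field K + U?: ring U
  for K :: "('k, 'm) ring_scheme" (structure) and U :: "('k, 'u, 'n) module_scheme" (structure) +
  assumes smult_mult_left: "\<lbrakk> c \<in> carrier K; x \<in> carrier U; y \<in> carrier U \<rbrakk> \<Longrightarrow>
      (c \<odot>\<^bsub>U\<^esub> x) \<otimes>\<^bsub>U\<^esub> y = c \<odot>\<^bsub>U\<^esub> (x \<otimes>\<^bsub>U\<^esub> y)"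
    and smult_mult_right: "\<lbrakk> c \<in> carrier K; x \<in> carrier U; y \<in> carrier U \<rbrakk> \<Longrightarrow>
      x \<otimes>\<^bsub>U\<^esub> (c \<odot>\<^bsub>U\<^esub> y) = c \<odot>\<^bsub>U\<^esub> (x \<otimes>\<^bsub>U\<^esub> y)"

(* The equality of the degree-zero part with the ground field is read as: the structure map
   is a bijection from the field onto it; in particular one is different from zero in U. *)
locale filtered_algebra = assoc_algebra K U
  for K :: "('k, 'm) ring_scheme" (structure) and U :: "('k, 'u, 'n) module_scheme" (structure) +
  fixes F :: "nat \<Rightarrow> 'u set"
  assumes F_submodule: "submodule (F i) K U"
    and F_mono: "mono F"
    and F_zero: "bij_betw (\<lambda>c. c \<odot>\<^bsub>U\<^esub> \<one>\<^bsub>U\<^esub>) (carrier K) (F 0)"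
    and F_mult: "\<lbrakk> x \<in> F i; y \<in> F j \<rbrakk> \<Longrightarrow> x \<otimes>\<^bsub>U\<^esub> y \<in> F (i + j)"
    and F_exhaustive: "carrier U = (\<Union>i. F i)"

definition filt :: "('u, 'm) ring_scheme \<Rightarrow> (nat \<Rightarrow> 'u set) \<Rightarrow> int \<Rightarrow> 'u set" where
  "filt U F i = (if i < 0 then {\<zero>\<^bsub>U\<^esub>} else F (nat i))"

definition filt_deg :: "('u, 'm) ring_scheme \<Rightarrow> (nat \<Rightarrow> 'u set) \<Rightarrow> 'u \<Rightarrow> nat extended" where
  "filt_deg U F u = (if u = \<zero>\<^bsub>U\<^esub> then Minf else Fin (LEAST i. u \<in> F i))"


section \<open>The associated graded algebra\<close>

text \<open>
  An element of the associated graded algebra is a finitely supported family of cosets, the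
  \<open>n\<close>-th one being a coset of \<open>filt U F (int n - 1)\<close> contained in \<open>F n\<close>.
\<close>

definition gr_comp :: "('u, 'm) ring_scheme \<Rightarrow> (nat \<Rightarrow> 'u set) \<Rightarrow> nat \<Rightarrow> 'u set monoid" where
  "gr_comp U F n = (add_monoid U)\<lparr>carrier := F n\<rparr> Mod filt U F (int n - 1)"

definition gr_symbol :: "('u, 'm) ring_scheme \<Rightarrow> (nat \<Rightarrow> 'u set) \<Rightarrow> 'u \<Rightarrow> nat \<Rightarrow> 'u set" where
  "gr_symbol U F u = (\<lambda>n. if filt_deg U F u = Fin n
     then filt U F (int n - 1) +>\<^bsub>U\<^esub> u else filt U F (int n - 1))"

definition gr_mult :: "('u, 'm) ring_scheme \<Rightarrow> (nat \<Rightarrow> 'u set) \<Rightarrow>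
    (nat \<Rightarrow> 'u set) \<Rightarrow> (nat \<Rightarrow> 'u set) \<Rightarrow> nat \<Rightarrow> 'u set" where
  "gr_mult U F x y = (\<lambda>n. finprod (gr_comp U F n)
     (\<lambda>i. rcoset_mult U (filt U F (int n - 1)) (x i) (y (n - i))) {..n})"

definition gr :: "('k, 'u, 'm) module_scheme \<Rightarrow> (nat \<Rightarrow> 'u set) \<Rightarrow> ('k, nat \<Rightarrow> 'u set) module" where
  "gr U F =
    \<lparr>carrier = carrier (sum_group UNIV (gr_comp U F)),
     monoid.mult = gr_mult U F,
     one = gr_symbol U F \<one>\<^bsub>U\<^esub>,
     ring.zero = \<one>\<^bsub>sum_group UNIV (gr_comp U F)\<^esub>,
     add = (\<otimes>\<^bsub>sum_group UNIV (gr_comp U F)\<^esub>),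
     smult = (\<lambda>c x n. \<Union>a\<in>x n. filt U F (int n - 1) +>\<^bsub>U\<^esub> (c \<odot>\<^bsub>U\<^esub> a))\<rparr>"

definition gr_ideal :: "('u, 'm) ring_scheme \<Rightarrow> (nat \<Rightarrow> 'u set) \<Rightarrow> 'u set \<Rightarrow> (nat \<Rightarrow> 'u set) set" where
  "gr_ideal U F I = carrier (sum_group UNIV (\<lambda>n.
     (add_monoid U)\<lparr>carrier := (I \<inter> F n) <+>\<^bsub>U\<^esub> filt U F (int n - 1)\<rparr>
       Mod filt U F (int n - 1)))"


section \<open>The Koszul complex and complete intersections\<close>

(* left_sum R A x t is A_1 x_1 + ... + A_t x_t. *)
definition left_sum :: "('r, 'm) ring_scheme \<Rightarrow> (nat \<Rightarrow> 'r set) \<Rightarrow> (nat \<Rightarrow> 'r) \<Rightarrow> nat \<Rightarrow> 'r set" where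
  "left_sum R A x t = {\<Oplus>\<^bsub>R\<^esub>i\<in>{1..t}. a i \<otimes>\<^bsub>R\<^esub> x i | a. a \<in> Pi {1..t} A}"

definition mutually_commuting :: "('r, 'm) ring_scheme \<Rightarrow> (nat \<Rightarrow> 'r) \<Rightarrow> nat \<Rightarrow> bool" where
  "mutually_commuting R x t \<longleftrightarrow>
     (\<forall>i\<in>{1..t}. \<forall>j\<in>{1..t}. x i \<otimes>\<^bsub>R\<^esub> x j = x j \<otimes>\<^bsub>R\<^esub> x i)"

text \<open>
  \<open>R \<otimes> \<And>\<^sup>i k\<^sup>t\<close> is the free left \<open>R\<close>-module on the vectors \<open>e\<^sub>J = e\<^bsub>j\<^sub>1\<^esub> \<and> \<dots> \<and> e\<^bsub>j\<^sub>i\<^esub>\<close>, where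
  \<open>J = {j\<^sub>1 < \<dots> < j\<^sub>i}\<close> ranges over the \<open>i\<close>-subsets of \<open>{1..t}\<close>; an element is represented by its
  family of coefficients. Only the underlying additive groups are recorded, which is all that
  the vanishing of homology depends on. For negative \<open>i\<close> there are no such \<open>J\<close> and the group is
  trivial.
\<close>

definition koszul_index :: "nat \<Rightarrow> int \<Rightarrow> nat set set" where
  "koszul_index t i = {J. J \<subseteq> {1..t} \<and> int (card J) = i}"

definition koszul :: "('r, 'm) ring_scheme \<Rightarrow> nat \<Rightarrow> int \<Rightarrow> (nat set \<Rightarrow> 'r) monoid" where
  "koszul R t i = product_group (koszul_index t i) (\<lambda>_. add_monoid R)"

text \<open>
  The coefficient at \<open>e\<^sub>J\<close> of the differential of \<open>c\<close> collects the terms of \<open>e\<^bsub>insert j J\<^esub>\<close> in which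
  \<open>e\<^sub>j\<close> is omitted. If \<open>j\<close> is the \<open>k\<close>-th smallest element of \<open>insert j J\<close>, then \<open>k - 1\<close> is the
  number of \<open>l \<in> J\<close> with \<open>l < j\<close>.
\<close>

definition koszul_diff :: "('r, 'm) ring_scheme \<Rightarrow> (nat \<Rightarrow> 'r) \<Rightarrow> nat \<Rightarrow> int \<Rightarrow>
    (nat set \<Rightarrow> 'r) \<Rightarrow> nat set \<Rightarrow> 'r" where
  "koszul_diff R g t i c = (\<lambda>J\<in>koszul_index t (i - 1).
     \<Oplus>\<^bsub>R\<^esub>j\<in>{1..t} - J. add_pow R ((-1::int) ^ card {l \<in> J. l < j}) (c (insert j J) \<otimes>\<^bsub>R\<^esub> g j))"

definition koszul_homology :: "('r, 'm) ring_scheme \<Rightarrow> (nat \<Rightarrow> 'r) \<Rightarrow> nat \<Rightarrow> int \<Rightarrow>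
    (nat set \<Rightarrow> 'r) set monoid" where
  "koszul_homology R g t i =
     (koszul R t i)\<lparr>carrier := kernel (koszul R t i) (koszul R t (i - 1)) (koszul_diff R g t i)\<rparr>
       Mod (koszul_diff R g t (i + 1) ` carrier (koszul R t (i + 1)))"

definition complete_intersection :: "('r, 'm) ring_scheme \<Rightarrow> (nat \<Rightarrow> 'r) \<Rightarrow> nat \<Rightarrow> bool" where
  "complete_intersection R g t \<longleftrightarrow>
     g \<in> {1..t} \<rightarrow> carrier R \<and> mutually_commuting R g t \<and>
     (\<forall>i. i \<noteq> 0 \<longrightarrow> trivial_group (koszul_homology R g t i)) \<and>
     \<not> trivial_group (koszul_homology R g t 0)"


section \<open>Left modules\<close>

(* HOL-Algebra's locale module requires a commutative ring of scalars. *)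
locale left_module = R?: ring R + M?: abelian_group M
  for R :: "('r, 'm) ring_scheme" (structure) and M :: "('r, 'v, 'n) module_scheme" (structure) +
  assumes lsmult_closed: "\<lbrakk> a \<in> carrier R; x \<in> carrier M \<rbrakk> \<Longrightarrow> a \<odot>\<^bsub>M\<^esub> x \<in> carrier M"
    and lsmult_l_distr: "\<lbrakk> a \<in> carrier R; b \<in> carrier R; x \<in> carrier M \<rbrakk> \<Longrightarrow>
      (a \<oplus>\<^bsub>R\<^esub> b) \<odot>\<^bsub>M\<^esub> x = a \<odot>\<^bsub>M\<^esub> x \<oplus>\<^bsub>M\<^esub> b \<odot>\<^bsub>M\<^esub> x"
    and lsmult_r_distr: "\<lbrakk> a \<in> carrier R; x \<in> carrier M; y \<in> carrier M \<rbrakk> \<Longrightarrow>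
      a \<odot>\<^bsub>M\<^esub> (x \<oplus>\<^bsub>M\<^esub> y) = a \<odot>\<^bsub>M\<^esub> x \<oplus>\<^bsub>M\<^esub> a \<odot>\<^bsub>M\<^esub> y"
    and lsmult_assoc: "\<lbrakk> a \<in> carrier R; b \<in> carrier R; x \<in> carrier M \<rbrakk> \<Longrightarrow>
      (a \<otimes>\<^bsub>R\<^esub> b) \<odot>\<^bsub>M\<^esub> x = a \<odot>\<^bsub>M\<^esub> (b \<odot>\<^bsub>M\<^esub> x)"
    and lsmult_one: "x \<in> carrier M \<Longrightarrow> \<one>\<^bsub>R\<^esub> \<odot>\<^bsub>M\<^esub> x = x"

locale simple_left_module = left_module R M
  for R :: "('r, 'm) ring_scheme" (structure) and M :: "('r, 'v, 'n) module_scheme" (structure) +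
  assumes nonzero: "carrier M \<noteq> {\<zero>\<^bsub>M\<^esub>}"
    and simple: "submodule N R M \<Longrightarrow> N = {\<zero>\<^bsub>M\<^esub>} \<or> N = carrier M"

definition module_generated_by :: "('r, 'm) ring_scheme \<Rightarrow> ('r, 'v, 'n) module_scheme \<Rightarrow> 'v \<Rightarrow> bool" where
  "module_generated_by R M v \<longleftrightarrow>
     v \<in> carrier M \<and> carrier M = (\<lambda>u. u \<odot>\<^bsub>M\<^esub> v) ` carrier R"


section \<open>Generated subalgebras and their maximal spectrum\<close>

definition gen_subalgebra :: "('k, 'm) ring_scheme \<Rightarrow> ('k, 'u, 'n) module_scheme \<Rightarrow> 'u set \<Rightarrow> 'u set" where
  "gen_subalgebra K U S = generate_ring U ((\<lambda>c. c \<odot>\<^bsub>U\<^esub> \<one>\<^bsub>U\<^esub>) ` carrier K \<union> S)"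

definition Specm :: "('u, 'n) ring_scheme \<Rightarrow> 'u set \<Rightarrow> 'u set set" where
  "Specm U \<Gamma> = {\<nu>. maximalideal \<nu> (U\<lparr>carrier := \<Gamma>\<rparr>)}"

(* The value at \<gamma> of the character \<Gamma> \<rightarrow> \<Gamma>/\<nu> = K: the scalar having the same residue class
   as \<gamma>. For \<Gamma> finitely generated commutative over an algebraically closed K and \<nu> maximal it
   exists uniquely by the Nullstellensatz. *)
definition Specm_val :: "('k, 'm) ring_scheme \<Rightarrow> ('k, 'u, 'n) module_scheme \<Rightarrow> 'u set \<Rightarrow> 'u \<Rightarrow> 'k" where
  "Specm_val K U \<nu> \<gamma> =
     (THE c. c \<in> carrier K \<and> \<nu> +>\<^bsub>U\<^esub> \<gamma> = \<nu> +>\<^bsub>U\<^esub> (c \<odot>\<^bsub>U\<^esub> \<one>\<^bsub>U\<^esub>))"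

end

theory Submission
  imports Defs
begin

text \<open>
  Put \<open>h\<^sub>i = g\<^sub>i - \<mu>\<^sub>i\<close>, which has the same symbol as \<open>g\<^sub>i\<close>. If \<open>u = \<Sum>a\<^sub>i h\<^sub>i\<close> has lower degree than
  its summands, then the symbols of the \<open>a\<^sub>i\<close> form a relation between the symbols of the \<open>g\<^sub>i\<close>. As
  the first Koszul homology vanishes, this relation comes from an antisymmetric matrix, and because
  the \<open>h\<^sub>i\<close> commute, subtracting the corresponding trivial relation lowers the degree of the \<open>a\<^sub>i\<close>.
  This gives the first two claims; a maximal left ideal containing all \<open>h\<^sub>i\<close> gives the third one.
  For the fourth claim take \<open>\<mu>\<^sub>i = \<nu>(g\<^sub>i)\<close>, where \<open>\<nu>\<close> is a character by the Nullstellensatz. The latter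
  is proved by extending homomorphisms into the algebraically closed field from a subring \<open>A\<close> of a
  domain to \<open>A[x]\<close>, after making one element of \<open>A\<close> invertible.
\<close>

section \<open>The Nullstellensatz\<close>

text \<open>The lowering of coefficients ends because finitely many coefficients have a common
  degree bound, and a further step is possible as long as this bound exceeds the degree of the sum.
  Vanishing of the first Koszul homology controls degrees in this way; nonvanishing in degree 0
  gives properness, since for \<open>I = U\<close> the symbols of the \<open>g i\<close> would
  generate the whole graded algebra. The obstacle is that elements of the graded algebra are
  families of cosets. They are replaced by finitely supported sequences of representatives in
  \<open>U\<close>, and the products computed there have a symbol on the right and act by a shift of
  degrees. The facts on the Koszul complex are accordingly proved for an abelian group with right
  multiplications by the \<open>g j\<close>. In the fourth claim the scalars have degree at most 0,
  so \<open>d i > 0\<close> must be known. This again comes from properness, now for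
  \<open>\<mu> = 0\<close>: a \<open>g i\<close> of degree 0 would be an invertible scalar in a
  proper left ideal. The eigenvector property then passes from the generators to all of
  \<open>\<Gamma>\<close>, although only a left ideal is factored out, because scalars are
  central.\<close>

lemma (in ring) eval_map_rev_upt:
  assumes "c \<in> {..<n} \<rightarrow> carrier R" "x \<in> carrier R"
  shows "eval (map c (rev [0..<n])) x = (\<Oplus>i\<in>{..<n}. c i \<otimes> x [^] i)"
  using assms(1)
proof (induction n)
  case 0
  then show ?case by simp
next
  case (Suc n)
  have "(\<Oplus>i\<in>insert n {..<n}. c i \<otimes> x [^] i) = c n \<otimes> x [^] n \<oplus> (\<Oplus>i\<in>{..<n}. c i \<otimes> x [^] i)"
    by (intro finsum_insert) (use Suc.prems assms(2) in \<open>auto simp: Pi_def\<close>)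
  moreover have "eval (map c (rev [0..<n])) x = (\<Oplus>i\<in>{..<n}. c i \<otimes> x [^] i)"
    using Suc by (auto simp: Pi_def)
  ultimately show ?case
    by (simp add: lessThan_Suc)
qed

text \<open>The coefficient function is the shape in which evaluation of a \<open>UP\<close>
  polynomial along a homomorphism appears once it is written as a sum.\<close>

lemma (in algebraically_closed) exists_root:
  fixes n :: nat
  assumes "n > 0" "c \<in> {..n} \<rightarrow> carrier L" "c n \<noteq> \<zero>"
  shows "\<exists>x\<in>carrier L. (\<Oplus>i\<in>{..n}. c i \<otimes> x [^] i) = \<zero>"
proof -
  \<comment> \<open>Elements of \<open>poly_ring L\<close> are coefficient lists with the highest
    degree first and a nonzero head, whence the reversed range.\<close>
  let ?p = "map c (rev [0..<Suc n])"
  have p: "?p \<in> carrier (poly_ring L)"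
    unfolding univ_poly_carrier[symmetric] polynomial_def using assms by auto
  have "degree ?p = n"
    by simp
  then have "roots ?p \<noteq> {#}"
    using roots_over_carrier[OF p] assms(1) unfolding splitted_def by auto
  then obtain x where "x \<in># roots ?p"
    by blast
  then have "x \<in> carrier L" "eval ?p x = \<zero>"
    using roots_mem_iff_is_root[OF p] unfolding is_root_def by auto
  then show ?thesis
    using eval_map_rev_upt[of c "Suc n" x] assms(2) by (auto simp: lessThan_Suc_atMost Pi_def)
qed

text \<open>A root of the polynomial minus 1 is a point where the polynomial takes the value 1.
  Degree 0 is separate: there the subtraction could destroy the leading coefficient.\<close>

lemma (in algebraically_closed) exists_nonroot:
  fixes n :: nat
  assumes "c \<in> {..n} \<rightarrow> carrier L" "c n \<noteq> \<zero>"
  shows "\<exists>x\<in>carrier L. (\<Oplus>i\<in>{..n}. c i \<otimes> x [^] i) \<noteq> \<zero>"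
proof (cases "n = 0")
  case True
  then show ?thesis
    using assms by (intro bexI[of _ \<one>]) (auto simp: Pi_def simp flip: finsum_Suc)
next
  case False
  define c' where "c' = c(0 := c 0 \<ominus> \<one>)"
  have c': "c' \<in> {..n} \<rightarrow> carrier L" "c' n \<noteq> \<zero>"
    using assms False by (auto simp: c'_def Pi_def)
  obtain x where x: "x \<in> carrier L" "(\<Oplus>i\<in>{..n}. c' i \<otimes> x [^] i) = \<zero>"
    using exists_root[OF _ c'] False by auto
  have split: "(\<Oplus>i\<in>{..n}. b i \<otimes> x [^] i) = b 0 \<oplus> (\<Oplus>i\<in>{1..n}. b i \<otimes> x [^] i)"
    if "b \<in> {..n} \<rightarrow> carrier L" for b
  proof -
    have "{..n} = insert 0 {1..n}"
      by auto
    then have "(\<Oplus>i\<in>{..n}. b i \<otimes> x [^] i) = b 0 \<otimes> x [^] (0::nat) \<oplus> (\<Oplus>i\<in>{1..n}. b i \<otimes> x [^] i)"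
      using that x(1) by (auto simp: Pi_def intro!: finsum_insert)
    then show ?thesis
      using that by (auto simp: Pi_def)
  qed
  have tail: "(\<Oplus>i\<in>{1..n}. c' i \<otimes> x [^] i) = (\<Oplus>i\<in>{1..n}. c i \<otimes> x [^] i)"
    using assms(1) x(1) by (intro finsum_cong') (auto simp: c'_def Pi_def)
  have cl: "c 0 \<in> carrier L" "(\<Oplus>i\<in>{1..n}. c i \<otimes> x [^] i) \<in> carrier L"
    using assms(1) x(1) by (auto simp: Pi_def)
  have "c 0 \<ominus> \<one> \<oplus> (\<Oplus>i\<in>{1..n}. c i \<otimes> x [^] i) = \<zero>"
    using split[OF c'(1)] x(2) unfolding tail by (simp add: c'_def)
  then have "c 0 \<oplus> (\<Oplus>i\<in>{1..n}. c i \<otimes> x [^] i) \<ominus> \<one> = \<zero>"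
    using cl by (simp add: a_minus_def a_ac)
  then have "c 0 \<oplus> (\<Oplus>i\<in>{1..n}. c i \<otimes> x [^] i) = \<one>"
    using cl by simp
  then show ?thesis
    using split[OF assms(1)] x(1) by (intro bexI[of _ x]) auto
qed

text \<open>A homomorphism with the larger kernel factors through the image of the other. In the
  application \<open>P\<close> is a polynomial ring, \<open>h1\<close> is evaluation in
  \<open>L\<close> and \<open>h2\<close> evaluation in \<open>K\<close>; \<open>B\<close> is a
  generated subring, of which only the inclusion in the image of \<open>h1\<close> then has to be
  shown.\<close>

lemma ring_hom_factor:
  assumes "ring P" "ring L" "ring K" "h1 \<in> ring_hom P L" "h2 \<in> ring_hom P K"
    and ker: "\<And>f. f \<in> carrier P \<Longrightarrow> h1 f = \<zero>\<^bsub>L\<^esub> \<Longrightarrow> h2 f = \<zero>\<^bsub>K\<^esub>"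
    and B: "subring B L" "B \<subseteq> h1 ` carrier P"
  shows "\<exists>\<psi>\<in>ring_hom (L\<lparr>carrier := B\<rparr>) K. \<forall>f\<in>carrier P. h1 f \<in> B \<longrightarrow> \<psi> (h1 f) = h2 f"
proof -
  interpret P: ring P by fact
  interpret L: ring L by fact
  interpret K: ring K by fact
  interpret h1: ring_hom_ring P L h1
    by (intro ring_hom_ringI2) fact+
  interpret h2: ring_hom_ring P K h2
    by (intro ring_hom_ringI2) fact+
  have eq: "h2 f = h2 f'" if "f \<in> carrier P" "f' \<in> carrier P" "h1 f = h1 f'" for f f'
  proof -
    have "h1 (f \<ominus>\<^bsub>P\<^esub> f') = \<zero>\<^bsub>L\<^esub>"
      using that by (simp add: a_minus_def L.r_neg)
    then have "h2 f \<ominus>\<^bsub>K\<^esub> h2 f' = \<zero>\<^bsub>K\<^esub>"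
      using ker[of "f \<ominus>\<^bsub>P\<^esub> f'"] that by (simp add: a_minus_def)
    then show ?thesis
      using that by simp
  qed
  \<comment> \<open>An arbitrary preimage is taken; by \<open>eq\<close> the value does not depend
    on it.\<close>
  define \<psi> where "\<psi> y = h2 (SOME f. f \<in> carrier P \<and> h1 f = y)" for y
  have \<psi>: "\<psi> (h1 f) = h2 f" if "f \<in> carrier P" for f
    unfolding \<psi>_def
  proof (rule someI2)
    show "f \<in> carrier P \<and> h1 f = h1 f"
      using that by blast
    show "h2 f' = h2 f" if "f' \<in> carrier P \<and> h1 f' = h1 f" for f'
      using that \<open>f \<in> carrier P\<close> by (intro eq) simp_all
  qed
  have rep: "\<exists>f\<in>carrier P. y = h1 f" if "y \<in> B" for y
    using that B(2) by blast
  have "\<psi> \<in> ring_hom (L\<lparr>carrier := B\<rparr>) K"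
  proof (rule ring_hom_memI)
    fix x assume "x \<in> carrier (L\<lparr>carrier := B\<rparr>)"
    then obtain f where f: "f \<in> carrier P" "x = h1 f"
      using rep by auto
    then show "\<psi> x \<in> carrier K"
      using \<psi>[of f] by simp
    fix y assume "y \<in> carrier (L\<lparr>carrier := B\<rparr>)"
    then obtain f' where f': "f' \<in> carrier P" "y = h1 f'"
      using rep by auto
    show "\<psi> (x \<otimes>\<^bsub>L\<lparr>carrier := B\<rparr>\<^esub> y) = \<psi> x \<otimes>\<^bsub>K\<^esub> \<psi> y"
      using f f' \<psi>[of "f \<otimes>\<^bsub>P\<^esub> f'"] \<psi>[of f] \<psi>[of f'] by simp
    show "\<psi> (x \<oplus>\<^bsub>L\<lparr>carrier := B\<rparr>\<^esub> y) = \<psi> x \<oplus>\<^bsub>K\<^esub> \<psi> y"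
      using f f' \<psi>[of "f \<oplus>\<^bsub>P\<^esub> f'"] \<psi>[of f] \<psi>[of f'] by simp
  next
    show "\<psi> \<one>\<^bsub>L\<lparr>carrier := B\<rparr>\<^esub> = \<one>\<^bsub>K\<^esub>"
      using \<psi>[of "\<one>\<^bsub>P\<^esub>"] by simp
  qed
  then show ?thesis
    using \<psi> by blast
qed

lemma (in domain) nat_pow_nonzero:
  assumes "a \<in> carrier R" "a \<noteq> \<zero>"
  shows "a [^] (n::nat) \<noteq> \<zero>"
  using assms by (induction n) (auto simp: integral_iff)

text \<open>
  Let \<open>b = q(x)\<close>. For transcendental \<open>x\<close> the leading coefficient of \<open>q\<close> works as \<open>a\<close>. Otherwise let
  \<open>p\<close> be a polynomial of least degree with \<open>p(x) = 0\<close>; the ideal \<open>(p, q)\<close> of \<open>A[X]\<close> contains a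
  constant \<open>r \<noteq> 0\<close>, and \<open>a\<close> is \<open>r\<close> times the leading coefficient of \<open>p\<close>: then \<open>x\<close> can be sent to
  any root of the image of \<open>p\<close>. Pseudo-division replaces division throughout.
\<close>

lemma hom_extension_step:
  assumes "algebraically_closed K" "domain L" and A: "subring A L" and x: "x \<in> carrier L"
    and b: "b \<in> generate_ring L (insert x A)" "b \<noteq> \<zero>\<^bsub>L\<^esub>"
  shows "\<exists>a\<in>A. a \<noteq> \<zero>\<^bsub>L\<^esub> \<and> (\<forall>\<phi>\<in>ring_hom (L\<lparr>carrier := A\<rparr>) K. \<phi> a \<noteq> \<zero>\<^bsub>K\<^esub> \<longrightarrow>
    (\<exists>\<psi>\<in>ring_hom (L\<lparr>carrier := generate_ring L (insert x A)\<rparr>) K.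
      (\<forall>y\<in>A. \<psi> y = \<phi> y) \<and> \<psi> b \<noteq> \<zero>\<^bsub>K\<^esub>))"
proof -
  interpret K: algebraically_closed K by fact
  interpret L: domain L by fact
  define RA where "RA = L\<lparr>carrier := A\<rparr>"
  \<comment> \<open>The first equation is oriented so that the simplifier turns \<open>A\<close>
    into \<open>carrier RA\<close>, the form in which the rules for polynomials over
    \<open>RA\<close> are stated.\<close>
  have RA [simp]: "A = carrier RA" "\<zero>\<^bsub>RA\<^esub> = \<zero>\<^bsub>L\<^esub>" "\<one>\<^bsub>RA\<^esub> = \<one>\<^bsub>L\<^esub>"
    "a \<otimes>\<^bsub>RA\<^esub> a' = a \<otimes>\<^bsub>L\<^esub> a'" "a \<oplus>\<^bsub>RA\<^esub> a' = a \<oplus>\<^bsub>L\<^esub> a'" for a a'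
    by (auto simp: RA_def)
  define P where "P = UP RA"
  have A_sub: "A \<subseteq> carrier L"
    using A by (rule subringE)
  interpret RA: domain RA
    unfolding RA_def using A by (rule L.subring_is_domain)
  interpret P: UP_domain RA P
    by unfold_locales (simp add: P_def)
  have id_hom: "id \<in> ring_hom RA L"
    using A_sub by (auto simp: ring_hom_def)
  define h1 where "h1 = UnivPoly.eval RA L id x"
  interpret ev: UP_univ_prop RA L id P x h1
    by unfold_locales (use id_hom x in \<open>auto simp: h1_def P_def\<close>)
  let ?B = "generate_ring L (insert x A)"
  have xA: "insert x A \<subseteq> carrier L"
    using x A_sub by auto
  have h1_ring: "h1 \<in> ring_hom P L"
    unfolding h1_def by (rule ev.eval_ring_hom[OF x])
  have h1_const: "h1 (monom P y 0) = y" if "y \<in> A" for y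
    using that ev.eval_const[OF x, folded h1_def] by simp
  interpret h1: ring_hom_cring P L h1
    by unfold_locales (rule h1_ring)
  have B_sub: "?B \<subseteq> h1 ` carrier P"
  proof (rule L.generate_ring_min_subring1[OF xA])
    show "subring (h1 ` carrier P) L"
      by (rule ring_hom_ring.img_is_subring[OF ring_hom_ringI2[OF P.P.ring_axioms L.ring_axioms h1_ring] P.P.carrier_is_subring])
    have "x = h1 (monom P \<one>\<^bsub>RA\<^esub> 1)"
      using ev.eval_monom1[OF x, folded h1_def] by simp
    moreover have "y = h1 (monom P y 0)" "monom P y 0 \<in> carrier P" if "y \<in> A" for y
      using h1_const that by auto
    moreover have "monom P \<one>\<^bsub>RA\<^esub> 1 \<in> carrier P"
      by (rule P.monom_closed) (rule RA.one_closed)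
    ultimately show "insert x A \<subseteq> h1 ` carrier P"
      by blast
  qed
  obtain q where q: "q \<in> carrier P" "h1 q = b"
    using b(1) B_sub by blast
  then have q_nz: "q \<noteq> \<zero>\<^bsub>P\<^esub>"
    using b(2) by auto
  \<comment> \<open>What remains after this is the choice of \<open>\<xi>\<close>, the image of
    \<open>x\<close>: evaluation at \<open>\<xi>\<close> must kill all relations satisfied by
    \<open>x\<close> but must not kill \<open>q\<close>.\<close>
  have ext: "\<exists>\<psi>\<in>ring_hom (L\<lparr>carrier := ?B\<rparr>) K. (\<forall>y\<in>A. \<psi> y = \<phi> y) \<and> \<psi> b \<noteq> \<zero>\<^bsub>K\<^esub>"
    if \<phi>: "\<phi> \<in> ring_hom RA K" and \<xi>: "\<xi> \<in> carrier K"
      and ker: "\<And>f. f \<in> carrier P \<Longrightarrow> h1 f = \<zero>\<^bsub>L\<^esub> \<Longrightarrow> UnivPoly.eval RA K \<phi> \<xi> f = \<zero>\<^bsub>K\<^esub>"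
      and nz: "UnivPoly.eval RA K \<phi> \<xi> q \<noteq> \<zero>\<^bsub>K\<^esub>" for \<phi> \<xi>
  proof -
    interpret ev': UP_univ_prop RA K \<phi> P \<xi> "UnivPoly.eval RA K \<phi> \<xi>"
      by unfold_locales (use \<phi> \<xi> in \<open>auto simp: P_def\<close>)
    obtain \<psi> where \<psi>: "\<psi> \<in> ring_hom (L\<lparr>carrier := ?B\<rparr>) K"
      "\<And>f. f \<in> carrier P \<Longrightarrow> h1 f \<in> ?B \<Longrightarrow> \<psi> (h1 f) = UnivPoly.eval RA K \<phi> \<xi> f"
      using ring_hom_factor[OF P.P.ring_axioms L.ring_axioms K.ring_axioms h1_ring ev'.eval_ring_hom[OF \<xi>] ker
          L.generate_ring_is_subring[OF xA] B_sub] by blast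
    have "\<psi> y = \<phi> y" if "y \<in> A" for y
      using \<psi>(2)[of "monom P y 0"] that ev'.eval_const[OF \<xi>, of y] h1_const[of y]
      by (simp add: generate_ring.incl)
    moreover have "\<psi> b \<noteq> \<zero>\<^bsub>K\<^esub>"
      using \<psi>(2)[of q] q b(1) nz by simp
    ultimately show ?thesis
      using \<psi>(1) by blast
  qed
  show ?thesis
  proof (cases "\<forall>f\<in>carrier P. h1 f = \<zero>\<^bsub>L\<^esub> \<longrightarrow> f = \<zero>\<^bsub>P\<^esub>")
    case True
    let ?a = "coeff P q (deg RA q)"
    have a: "?a \<in> A" "?a \<noteq> \<zero>\<^bsub>L\<^esub>"
      using P.lcoeff_nonzero[OF q_nz q(1)] P.coeff_closed[OF q(1)] by auto
    have "\<exists>\<psi>\<in>ring_hom (L\<lparr>carrier := ?B\<rparr>) K. (\<forall>y\<in>A. \<psi> y = \<phi> y) \<and> \<psi> b \<noteq> \<zero>\<^bsub>K\<^esub>"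
      if \<phi>: "\<phi> \<in> ring_hom RA K" and nz: "\<phi> ?a \<noteq> \<zero>\<^bsub>K\<^esub>" for \<phi>
    proof -
      have "(\<lambda>i. \<phi> (coeff P q i)) \<in> {..deg RA q} \<rightarrow> carrier K"
        using ring_hom_closed[OF \<phi>] P.coeff_closed[OF q(1)] by auto
      \<comment> \<open>A transcendental \<open>x\<close> satisfies no relation, so
        \<open>\<xi>\<close> has only to avoid the roots of the image of \<open>q\<close>, whose
        leading coefficient \<open>\<phi> ?a\<close> is nonzero.\<close>
      then obtain \<xi> where \<xi>: "\<xi> \<in> carrier K"
        "(\<Oplus>\<^bsub>K\<^esub>i\<in>{..deg RA q}. \<phi> (coeff P q i) \<otimes>\<^bsub>K\<^esub> \<xi> [^]\<^bsub>K\<^esub> i) \<noteq> \<zero>\<^bsub>K\<^esub>"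
        using K.exists_nonroot nz by meson
      interpret ev': UP_univ_prop RA K \<phi> P \<xi> "UnivPoly.eval RA K \<phi> \<xi>"
        by unfold_locales (use \<phi> \<xi>(1) in \<open>auto simp: P_def\<close>)
      interpret h2: ring_hom_cring P K "UnivPoly.eval RA K \<phi> \<xi>"
        by unfold_locales (rule ev'.eval_ring_hom[OF \<xi>(1)])
      show ?thesis
        by (rule ext[OF \<phi> \<xi>(1)])
          (use True \<xi>(2) P.eval_on_carrier[OF q(1), of K \<phi> \<xi>] in auto)
    qed
    with a show ?thesis
      unfolding RA_def by blast
  next
    case False
    let ?ker = "\<lambda>f. f \<in> carrier P \<and> h1 f = \<zero>\<^bsub>L\<^esub> \<and> f \<noteq> \<zero>\<^bsub>P\<^esub>"
    obtain p where p: "?ker p" and p_min: "\<And>f. ?ker f \<Longrightarrow> deg RA p \<le> deg RA f"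
      using False ex_has_least_nat[of ?ker _ "deg RA"] by blast
    have p_cl: "p \<in> carrier P"
      using p by blast
    define J where "J = {u \<otimes>\<^bsub>P\<^esub> p \<oplus>\<^bsub>P\<^esub> v \<otimes>\<^bsub>P\<^esub> q | u v. u \<in> carrier P \<and> v \<in> carrier P}"
    have "p = \<one>\<^bsub>P\<^esub> \<otimes>\<^bsub>P\<^esub> p \<oplus>\<^bsub>P\<^esub> \<zero>\<^bsub>P\<^esub> \<otimes>\<^bsub>P\<^esub> q" "q = \<zero>\<^bsub>P\<^esub> \<otimes>\<^bsub>P\<^esub> p \<oplus>\<^bsub>P\<^esub> \<one>\<^bsub>P\<^esub> \<otimes>\<^bsub>P\<^esub> q"
      using p_cl q(1) by simp_all
    then have pJ: "p \<in> J" and qJ: "q \<in> J"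
      unfolding J_def by blast+
    have J_sub: "J \<subseteq> carrier P"
      using p_cl q(1) by (auto simp: J_def)
    \<comment> \<open>This combination has exactly the shape of a pseudo-division remainder: a
      constant times the dividend, minus divisor times quotient.\<close>
    have J_lin: "w \<otimes>\<^bsub>P\<^esub> f \<ominus>\<^bsub>P\<^esub> f' \<otimes>\<^bsub>P\<^esub> w' \<in> J"
      if ff: "f \<in> J" "f' \<in> J" and "w \<in> carrier P" "w' \<in> carrier P" for f f' w w'
    proof -
      obtain u v u' v' where uv: "f = u \<otimes>\<^bsub>P\<^esub> p \<oplus>\<^bsub>P\<^esub> v \<otimes>\<^bsub>P\<^esub> q" "f' = u' \<otimes>\<^bsub>P\<^esub> p \<oplus>\<^bsub>P\<^esub> v' \<otimes>\<^bsub>P\<^esub> q"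
        "u \<in> carrier P" "v \<in> carrier P" "u' \<in> carrier P" "v' \<in> carrier P"
        using ff unfolding J_def by blast
      have "w \<otimes>\<^bsub>P\<^esub> f \<ominus>\<^bsub>P\<^esub> f' \<otimes>\<^bsub>P\<^esub> w' =
        (w \<otimes>\<^bsub>P\<^esub> u \<ominus>\<^bsub>P\<^esub> u' \<otimes>\<^bsub>P\<^esub> w') \<otimes>\<^bsub>P\<^esub> p \<oplus>\<^bsub>P\<^esub> (w \<otimes>\<^bsub>P\<^esub> v \<ominus>\<^bsub>P\<^esub> v' \<otimes>\<^bsub>P\<^esub> w') \<otimes>\<^bsub>P\<^esub> q"
        using that(3,4) uv(3-) p_cl q(1) unfolding uv(1,2) by algebra
      then show ?thesis
        using that(3,4) uv(3-) unfolding J_def by blast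
    qed
    let ?J = "\<lambda>f. f \<in> J \<and> f \<noteq> \<zero>\<^bsub>P\<^esub>"
    obtain r where r: "?J r" and r_min: "\<And>f. ?J f \<Longrightarrow> deg RA r \<le> deg RA f"
      using pJ p ex_has_least_nat[of ?J p "deg RA"] by blast
    have r_cl: "r \<in> carrier P"
      using r J_sub by blast
    let ?l = "coeff P r (deg RA r)"
    have l: "?l \<in> carrier RA" "?l \<noteq> \<zero>\<^bsub>RA\<^esub>"
      using r P.lcoeff_nonzero[of r] P.coeff_closed[OF r_cl] r_cl by auto
    have l_pow: "?l [^]\<^bsub>RA\<^esub> k \<in> carrier RA" "?l [^]\<^bsub>RA\<^esub> k \<noteq> \<zero>\<^bsub>RA\<^esub>" for k :: nat
      using l RA.nat_pow_nonzero[of ?l k] by simp_all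
    \<comment> \<open>The remainder of pseudo-division by \<open>r\<close> stays in \<open>J\<close>
      and has smaller degree, so minimality of \<open>r\<close> makes it zero. Thus \<open>r\<close>
      divides every element of \<open>J\<close> up to a power of its leading coefficient.\<close>
    have r_dvd: "\<exists>w k. w \<in> carrier P \<and> (?l [^]\<^bsub>RA\<^esub> (k::nat)) \<odot>\<^bsub>P\<^esub> f = r \<otimes>\<^bsub>P\<^esub> w" if f: "f \<in> J" for f
    proof -
      have f_cl: "f \<in> carrier P"
        using f J_sub by blast
      obtain w s k where w: "w \<in> carrier P" "s \<in> carrier P"
        "(?l [^]\<^bsub>RA\<^esub> (k::nat)) \<odot>\<^bsub>P\<^esub> f = r \<otimes>\<^bsub>P\<^esub> w \<oplus>\<^bsub>P\<^esub> s" "s = \<zero>\<^bsub>P\<^esub> \<or> deg RA s < deg RA r"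
        using P.long_div_theorem[OF r_cl f_cl] r by blast
      let ?m = "monom P (?l [^]\<^bsub>RA\<^esub> k) 0"
      have m: "?m \<in> carrier P"
        using l_pow(1) by (rule P.monom_closed)
      have "?m \<otimes>\<^bsub>P\<^esub> f = r \<otimes>\<^bsub>P\<^esub> w \<oplus>\<^bsub>P\<^esub> s"
        using w(3) P.monom_mult_is_smult[OF l_pow(1) f_cl] by simp
      then have "s = ?m \<otimes>\<^bsub>P\<^esub> f \<ominus>\<^bsub>P\<^esub> r \<otimes>\<^bsub>P\<^esub> w"
        using w(1,2) r_cl m f_cl by algebra
      then have "s \<in> J"
        using J_lin[OF f _ m w(1)] r by simp
      then have "s = \<zero>\<^bsub>P\<^esub>"
        using w(4) r_min[of s] leD by blast
      then have "(?l [^]\<^bsub>RA\<^esub> k) \<odot>\<^bsub>P\<^esub> f = r \<otimes>\<^bsub>P\<^esub> w"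
        using w(1,3) r_cl by simp
      then show ?thesis
        using w(1) by blast
    qed
    \<comment> \<open>The factors introduced by pseudo-division are nonzero constants and
      \<open>L\<close> is a domain, so they do not affect vanishing under \<open>h1\<close>.\<close>
    have smult: "h1 ((?l [^]\<^bsub>RA\<^esub> k) \<odot>\<^bsub>P\<^esub> f) = \<zero>\<^bsub>L\<^esub> \<longleftrightarrow> h1 f = \<zero>\<^bsub>L\<^esub>" if "f \<in> carrier P" for f and k :: nat
    proof -
      have "?l [^]\<^bsub>RA\<^esub> k \<in> carrier L"
        using l_pow(1)[of k] A_sub by auto
      moreover have "?l [^]\<^bsub>RA\<^esub> k \<noteq> \<zero>\<^bsub>L\<^esub>"
        using l_pow(2)[of k] by simp
      moreover have "h1 f \<in> carrier L"
        using that by simp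
      ultimately show ?thesis
        using ev.Eval_smult[OF l_pow(1)[of k] that] by (simp only: id_apply L.integral_iff) blast
    qed
    obtain w k where w: "w \<in> carrier P" "(?l [^]\<^bsub>RA\<^esub> (k::nat)) \<odot>\<^bsub>P\<^esub> p = r \<otimes>\<^bsub>P\<^esub> w"
      using r_dvd[OF pJ] by blast
    obtain w' k' where w': "w' \<in> carrier P" "(?l [^]\<^bsub>RA\<^esub> (k'::nat)) \<odot>\<^bsub>P\<^esub> q = r \<otimes>\<^bsub>P\<^esub> w'"
      using r_dvd[OF qJ] by blast
    \<comment> \<open>\<open>r\<close> divides a nonzero constant multiple of \<open>q\<close>, and
      \<open>h1 q = b\<close> is nonzero.\<close>
    have "h1 r \<noteq> \<zero>\<^bsub>L\<^esub>"
      using smult[OF q(1), of k'] q(2) b(2) r_cl w'(1) unfolding w'(2) by auto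
    then have "h1 w = \<zero>\<^bsub>L\<^esub>"
      using smult[OF p_cl, of k] p r_cl w(1) L.integral unfolding w(2) by auto
    moreover have deg_eq: "deg RA (r \<otimes>\<^bsub>P\<^esub> w) = deg RA p"
      using P.deg_smult[OF l_pow(1) p_cl, of k] l_pow(2)[of k] unfolding w(2) by simp
    moreover have "r \<otimes>\<^bsub>P\<^esub> w \<noteq> \<zero>\<^bsub>P\<^esub>"
    proof -
      have "coeff P ((?l [^]\<^bsub>RA\<^esub> k) \<odot>\<^bsub>P\<^esub> p) (deg RA p) \<noteq> \<zero>\<^bsub>RA\<^esub>"
        using P.coeff_smult[OF l_pow(1) p_cl] l_pow[of k] P.lcoeff_nonzero[of p] p RA.integral
          P.coeff_closed[OF p_cl] by metis
      then show ?thesis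
        unfolding w(2) by auto
    qed
    \<comment> \<open>\<open>w\<close> is a nonzero element of the kernel, so its degree is at least
      that of \<open>p\<close>, whereas the degrees of \<open>r\<close> and \<open>w\<close> add up
      to that of \<open>p\<close>.\<close>
    ultimately have "deg RA r = 0"
      using p_min[of w] P.deg_mult[of r w] r r_cl w(1) by fastforce
    define r0 where "r0 = coeff P r 0"
    have r_eq: "r = monom P r0 0" and r0: "r0 \<in> A" "r0 \<noteq> \<zero>\<^bsub>L\<^esub>"
      using P.deg_zero_impl_monom[OF r_cl \<open>deg RA r = 0\<close>] l \<open>deg RA r = 0\<close> by (simp_all add: r0_def)
    obtain u v where uv: "u \<in> carrier P" "v \<in> carrier P" "r = u \<otimes>\<^bsub>P\<^esub> p \<oplus>\<^bsub>P\<^esub> v \<otimes>\<^bsub>P\<^esub> q"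
      using r by (auto simp: J_def)
    let ?c = "coeff P p (deg RA p)"
    have c: "?c \<in> A" "?c \<noteq> \<zero>\<^bsub>L\<^esub>"
      using P.lcoeff_nonzero[of p] P.coeff_closed[OF p_cl] p by auto
    \<comment> \<open>Needed for the existence of a root \<open>\<xi>\<close>. A nonzero constant is
      fixed by \<open>h1\<close> and cannot lie in the kernel.\<close>
    have deg_p: "deg RA p > 0"
    proof (rule ccontr)
      assume "\<not> deg RA p > 0"
      then have "deg RA p = 0"
        by simp
      then have "p = monom P ?c 0"
        using P.deg_zero_impl_monom[OF p_cl] by simp
      then show False
        using h1_const[OF c(1)] p c(2) by simp
    qed
    have "\<exists>\<psi>\<in>ring_hom (L\<lparr>carrier := ?B\<rparr>) K. (\<forall>y\<in>A. \<psi> y = \<phi> y) \<and> \<psi> b \<noteq> \<zero>\<^bsub>K\<^esub>"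
      if \<phi>: "\<phi> \<in> ring_hom RA K" and nz: "\<phi> (?c \<otimes>\<^bsub>L\<^esub> r0) \<noteq> \<zero>\<^bsub>K\<^esub>" for \<phi>
    proof -
      have \<phi>_cl: "\<phi> y \<in> carrier K" if "y \<in> A" for y
        using ring_hom_closed[OF \<phi>] that by simp
      have "\<phi> (?c \<otimes>\<^bsub>RA\<^esub> r0) = \<phi> ?c \<otimes>\<^bsub>K\<^esub> \<phi> r0"
        using ring_hom_mult[OF \<phi>] c(1) r0(1) by simp
      then have nz': "\<phi> ?c \<noteq> \<zero>\<^bsub>K\<^esub>" "\<phi> r0 \<noteq> \<zero>\<^bsub>K\<^esub>"
        using nz \<phi>_cl c(1) r0(1) by auto
      have "(\<lambda>i. \<phi> (coeff P p i)) \<in> {..deg RA p} \<rightarrow> carrier K"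
        using \<phi>_cl P.coeff_closed[OF p_cl] by auto
      then obtain \<xi> where \<xi>: "\<xi> \<in> carrier K"
        "(\<Oplus>\<^bsub>K\<^esub>i\<in>{..deg RA p}. \<phi> (coeff P p i) \<otimes>\<^bsub>K\<^esub> \<xi> [^]\<^bsub>K\<^esub> i) = \<zero>\<^bsub>K\<^esub>"
        using K.exists_root[OF deg_p] nz'(1) by meson
      define h2 where "h2 = UnivPoly.eval RA K \<phi> \<xi>"
      interpret ev': UP_univ_prop RA K \<phi> P \<xi> h2
        by unfold_locales (use \<phi> \<xi>(1) in \<open>auto simp: P_def h2_def\<close>)
      interpret h2: ring_hom_cring P K h2
        unfolding h2_def by unfold_locales (rule ev'.eval_ring_hom[OF \<xi>(1)])
      have h2p: "h2 p = \<zero>\<^bsub>K\<^esub>"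
        using \<xi>(2) P.eval_on_carrier[OF p_cl, of K \<phi> \<xi>] by (simp add: h2_def)
      \<comment> \<open>Pseudo-division of \<open>f\<close> by \<open>p\<close> leaves a remainder
        in the kernel of \<open>h1\<close> of degree below \<open>p\<close>, hence zero. So a power
        of \<open>?c\<close> times \<open>f\<close> is a multiple of \<open>p\<close>, and
        \<open>h2\<close> kills \<open>p\<close> but not \<open>?c\<close>.\<close>
      have ker: "h2 f = \<zero>\<^bsub>K\<^esub>" if f: "f \<in> carrier P" "h1 f = \<zero>\<^bsub>L\<^esub>" for f
      proof -
        obtain w s k where w: "w \<in> carrier P" "s \<in> carrier P"
          "(?c [^]\<^bsub>RA\<^esub> (k::nat)) \<odot>\<^bsub>P\<^esub> f = p \<otimes>\<^bsub>P\<^esub> w \<oplus>\<^bsub>P\<^esub> s" "s = \<zero>\<^bsub>P\<^esub> \<or> deg RA s < deg RA p"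
          using P.long_div_theorem[OF p_cl f(1)] p by blast
        have ck: "?c [^]\<^bsub>RA\<^esub> k \<in> carrier RA"
          using c(1) by simp
        have "h1 s = h1 ((?c [^]\<^bsub>RA\<^esub> k) \<odot>\<^bsub>P\<^esub> f)"
          unfolding w(3) using w(1,2) p p_cl by simp
        also have "\<dots> = \<zero>\<^bsub>L\<^esub>"
          using ev.Eval_smult[OF ck f(1)] f(2) ck A_sub by auto
        finally have "s = \<zero>\<^bsub>P\<^esub>"
          using p_min[of s] w(2,4) leD by blast
        then have "h2 ((?c [^]\<^bsub>RA\<^esub> k) \<odot>\<^bsub>P\<^esub> f) = \<zero>\<^bsub>K\<^esub>"
          unfolding w(3) using w(1) p_cl h2p by simp
        moreover have "\<phi> (?c [^]\<^bsub>RA\<^esub> k) = \<phi> ?c [^]\<^bsub>K\<^esub> k"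
          using c(1) by simp
        ultimately have "\<phi> ?c [^]\<^bsub>K\<^esub> k \<otimes>\<^bsub>K\<^esub> h2 f = \<zero>\<^bsub>K\<^esub>"
          using ev'.Eval_smult[OF ck f(1)] by simp
        moreover have "\<phi> ?c [^]\<^bsub>K\<^esub> k \<noteq> \<zero>\<^bsub>K\<^esub>"
          using K.nat_pow_nonzero \<phi>_cl[OF c(1)] nz'(1) by simp
        moreover have "h2 f \<in> carrier K" "\<phi> ?c [^]\<^bsub>K\<^esub> k \<in> carrier K"
          using f(1) \<phi>_cl[OF c(1)] by simp_all
        ultimately show ?thesis
          using K.integral by blast
      qed
      \<comment> \<open>The Bezout identity \<open>uv(3)\<close> loses its first term under
        \<open>h2\<close>, so \<open>h2 q\<close> is a factor of the nonzero
        \<open>\<phi> r0\<close>.\<close>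
      have "\<phi> r0 = h2 v \<otimes>\<^bsub>K\<^esub> h2 q"
      proof -
        have "\<phi> r0 = h2 r"
          using ev'.eval_const[OF \<xi>(1), of r0, folded h2_def] r0(1) unfolding r_eq by simp
        also have "\<dots> = h2 v \<otimes>\<^bsub>K\<^esub> h2 q"
          unfolding uv(3) using uv(1,2) p_cl q(1) h2p by simp
        finally show ?thesis .
      qed
      then have "h2 q \<noteq> \<zero>\<^bsub>K\<^esub>"
        using nz'(2) uv(2) by auto
      then show ?thesis
        using ext[OF \<phi> \<xi>(1)] ker by (simp add: h2_def)
    qed
    moreover have "?c \<otimes>\<^bsub>L\<^esub> r0 \<in> A" "?c \<otimes>\<^bsub>L\<^esub> r0 \<noteq> \<zero>\<^bsub>L\<^esub>"
      using c r0 A A_sub L.integral by (auto intro: subringE(6))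
    ultimately show ?thesis
      unfolding RA_def by blast
  qed
qed

lemma (in ring) generate_ring_insert_generate_ring:
  assumes "insert x H \<subseteq> carrier R"
  shows "generate_ring R (insert x (generate_ring R H)) = generate_ring R (insert x H)"
proof
  have H: "H \<subseteq> carrier R"
    using assms by blast
  show "generate_ring R (insert x (generate_ring R H)) \<subseteq> generate_ring R (insert x H)"
  proof (rule generate_ring_min_subring1)
    show "insert x (generate_ring R H) \<subseteq> generate_ring R (insert x H)"
      using mono_generate_ring[OF subset_insertI assms] by (auto intro: generate_ring.incl)
  qed (use assms generate_ring_incl[OF H] generate_ring_is_subring[OF assms] in auto)
  show "generate_ring R (insert x H) \<subseteq> generate_ring R (insert x (generate_ring R H))"
  proof (rule mono_generate_ring)
    show "insert x H \<subseteq> insert x (generate_ring R H)"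
      by (auto intro: generate_ring.incl)
  qed (use assms generate_ring_incl[OF H] in auto)
qed

text \<open>Generators are adjoined one at a time and the nonvanishing condition travels downwards:
  the last adjunction trades \<open>b\<close> for a nonzero \<open>b'\<close> in the smaller ring,
  and the induction hypothesis trades \<open>b'\<close> for \<open>a\<close>. Hence \<open>b\<close>
  must be arbitrary in the induction.\<close>

lemma hom_extension:
  assumes "algebraically_closed K" "domain L" "subring A L"
    and "finite S" "S \<subseteq> carrier L" "b \<in> generate_ring L (S \<union> A)" "b \<noteq> \<zero>\<^bsub>L\<^esub>"
  shows "\<exists>a\<in>A. a \<noteq> \<zero>\<^bsub>L\<^esub> \<and> (\<forall>\<phi>\<in>ring_hom (L\<lparr>carrier := A\<rparr>) K. \<phi> a \<noteq> \<zero>\<^bsub>K\<^esub> \<longrightarrow>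
    (\<exists>\<psi>\<in>ring_hom (L\<lparr>carrier := generate_ring L (S \<union> A)\<rparr>) K.
      (\<forall>y\<in>A. \<psi> y = \<phi> y) \<and> \<psi> b \<noteq> \<zero>\<^bsub>K\<^esub>))"
  using assms(4-)
proof (induction S arbitrary: b rule: finite_induct)
  case empty
  interpret L: domain L by fact
  have "generate_ring L A \<subseteq> A"
    using assms(3) by (intro L.generate_ring_min_subring1) (auto dest: subringE)
  then have "generate_ring L A = A"
    by (auto intro: generate_ring.incl)
  then show ?case
    using empty by auto
next
  case (insert x S)
  interpret L: domain L by fact
  have sub: "insert x (S \<union> A) \<subseteq> carrier L"
    using insert.prems assms(3) subringE(1) by auto
  let ?B = "generate_ring L (S \<union> A)"
  have eq: "generate_ring L (insert x ?B) = generate_ring L (insert x S \<union> A)"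
    using L.generate_ring_insert_generate_ring[OF sub] by simp
  have B: "subring ?B L"
    using sub by (intro L.generate_ring_is_subring) auto
  obtain b' where b': "b' \<in> ?B" "b' \<noteq> \<zero>\<^bsub>L\<^esub>" and ext: "\<And>\<phi>. \<phi> \<in> ring_hom (L\<lparr>carrier := ?B\<rparr>) K \<Longrightarrow>
      \<phi> b' \<noteq> \<zero>\<^bsub>K\<^esub> \<Longrightarrow> \<exists>\<psi>\<in>ring_hom (L\<lparr>carrier := generate_ring L (insert x S \<union> A)\<rparr>) K.
        (\<forall>y\<in>?B. \<psi> y = \<phi> y) \<and> \<psi> b \<noteq> \<zero>\<^bsub>K\<^esub>"
    using hom_extension_step[OF assms(1,2) B, of x b] insert.prems sub unfolding eq by blast
  obtain a where a: "a \<in> A" "a \<noteq> \<zero>\<^bsub>L\<^esub>" and ext': "\<And>\<phi>. \<phi> \<in> ring_hom (L\<lparr>carrier := A\<rparr>) K \<Longrightarrow>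
      \<phi> a \<noteq> \<zero>\<^bsub>K\<^esub> \<Longrightarrow> \<exists>\<psi>\<in>ring_hom (L\<lparr>carrier := ?B\<rparr>) K. (\<forall>y\<in>A. \<psi> y = \<phi> y) \<and> \<psi> b' \<noteq> \<zero>\<^bsub>K\<^esub>"
    using insert.IH[OF _ b'] insert.prems(1) by blast
  have AB: "A \<subseteq> ?B"
    by (auto intro: generate_ring.incl)
  have "\<exists>\<psi>\<in>ring_hom (L\<lparr>carrier := generate_ring L (insert x S \<union> A)\<rparr>) K.
      (\<forall>y\<in>A. \<psi> y = \<phi> y) \<and> \<psi> b \<noteq> \<zero>\<^bsub>K\<^esub>"
    if \<phi>: "\<phi> \<in> ring_hom (L\<lparr>carrier := A\<rparr>) K" "\<phi> a \<noteq> \<zero>\<^bsub>K\<^esub>" for \<phi>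
  proof -
    obtain \<psi>1 where 1: "\<psi>1 \<in> ring_hom (L\<lparr>carrier := ?B\<rparr>) K" "\<forall>y\<in>A. \<psi>1 y = \<phi> y" "\<psi>1 b' \<noteq> \<zero>\<^bsub>K\<^esub>"
      using ext'[OF \<phi>] by blast
    obtain \<psi> where "\<psi> \<in> ring_hom (L\<lparr>carrier := generate_ring L (insert x S \<union> A)\<rparr>) K"
      "\<forall>y\<in>?B. \<psi> y = \<psi>1 y" "\<psi> b \<noteq> \<zero>\<^bsub>K\<^esub>"
      using ext[OF 1(1,3)] by blast
    then show ?thesis
      using 1(2) AB by (intro bexI[of _ \<psi>]) auto
  qed
  then show ?case
    using a by blast
qed

text \<open>The inverse of \<open>h\<close> on its image extends to a homomorphism
  \<open>\<psi>\<close> from \<open>L\<close> to \<open>K\<close>. As \<open>L\<close> is a field,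
  \<open>\<psi>\<close> is injective, and \<open>\<psi> (h (\<psi> y)) = \<psi> y\<close> yields
  \<open>y = h (\<psi> y)\<close>, so \<open>h\<close> is onto. This is Zariski's lemma.\<close>

lemma nullstellensatz:
  assumes "algebraically_closed K" "field L" and h: "h \<in> ring_hom K L"
    and S: "finite S" "S \<subseteq> carrier L" "carrier L = generate_ring L (S \<union> h ` carrier K)"
  shows "bij_betw h (carrier K) (carrier L)"
proof -
  interpret K: algebraically_closed K by fact
  interpret L: field L by fact
  interpret h: ring_hom_ring K L h
    by (rule ring_hom_ringI2[OF K.ring_axioms L.ring_axioms h])
  let ?A = "h ` carrier K"
  have A: "subring ?A L"
    by (rule h.img_is_subring[OF K.carrier_is_subring])
  have "\<one>\<^bsub>L\<^esub> \<in> ?A"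
    by (metis K.one_closed h.hom_one image_eqI)
  then have inj: "inj_on h (carrier K)"
    using h.non_trivial_field_hom_imp_inj[OF K.field_axioms] L.one_not_zero by blast
  define \<phi> where "\<phi> = inv_into (carrier K) h"
  have \<phi>: "\<phi> (h c) = c" if "c \<in> carrier K" for c
    using that inj by (simp add: \<phi>_def)
  have "\<phi> \<in> ring_hom (L\<lparr>carrier := ?A\<rparr>) K"
  proof (rule ring_hom_memI)
    fix x assume "x \<in> carrier (L\<lparr>carrier := ?A\<rparr>)"
    then obtain c where c: "c \<in> carrier K" "x = h c"
      by auto
    then show "\<phi> x \<in> carrier K"
      by (simp add: \<phi>)
    fix y assume "y \<in> carrier (L\<lparr>carrier := ?A\<rparr>)"
    then obtain c' where c': "c' \<in> carrier K" "y = h c'"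
      by auto
    show "\<phi> (x \<otimes>\<^bsub>L\<lparr>carrier := ?A\<rparr>\<^esub> y) = \<phi> x \<otimes>\<^bsub>K\<^esub> \<phi> y"
      using c c' \<phi>[of "c \<otimes>\<^bsub>K\<^esub> c'"] by (simp add: \<phi>)
    show "\<phi> (x \<oplus>\<^bsub>L\<lparr>carrier := ?A\<rparr>\<^esub> y) = \<phi> x \<oplus>\<^bsub>K\<^esub> \<phi> y"
      using c c' \<phi>[of "c \<oplus>\<^bsub>K\<^esub> c'"] by (simp add: \<phi>)
  next
    show "\<phi> \<one>\<^bsub>L\<lparr>carrier := ?A\<rparr>\<^esub> = \<one>\<^bsub>K\<^esub>"
      using \<phi>[of "\<one>\<^bsub>K\<^esub>"] by simp
  qed
  \<comment> \<open>The extension result is applied with \<open>b = 1\<close>. Its condition on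
    \<open>a\<close> is automatic: \<open>a = h c\<close> with \<open>c\<close> nonzero, and
    \<open>\<phi> a = c\<close>.\<close>
  moreover have "\<one>\<^bsub>L\<^esub> \<in> generate_ring L (S \<union> ?A)"
    by (rule generate_ring.one)
  then obtain a where a: "a \<in> ?A" "a \<noteq> \<zero>\<^bsub>L\<^esub>" and ext: "\<And>\<phi>. \<phi> \<in> ring_hom (L\<lparr>carrier := ?A\<rparr>) K \<Longrightarrow>
      \<phi> a \<noteq> \<zero>\<^bsub>K\<^esub> \<Longrightarrow> \<exists>\<psi>\<in>ring_hom (L\<lparr>carrier := generate_ring L (S \<union> ?A)\<rparr>) K. \<forall>y\<in>?A. \<psi> y = \<phi> y"
    using hom_extension[OF assms(1) L.domain_axioms A S(1,2), of "\<one>\<^bsub>L\<^esub>"] L.one_not_zero by blast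
  moreover have "\<phi> a \<noteq> \<zero>\<^bsub>K\<^esub>"
    using a \<phi> by auto
  ultimately obtain \<psi> where "\<psi> \<in> ring_hom (L\<lparr>carrier := carrier L\<rparr>) K" and \<psi>_\<phi>: "\<And>y. y \<in> ?A \<Longrightarrow> \<psi> y = \<phi> y"
    unfolding S(3)[symmetric] by blast
  then have \<psi>: "\<psi> \<in> ring_hom L K"
    by simp
  interpret \<psi>: ring_hom_ring L K \<psi>
    by (rule ring_hom_ringI2[OF L.ring_axioms K.ring_axioms \<psi>])
  have "\<one>\<^bsub>K\<^esub> \<in> \<psi> ` carrier L"
    by (metis L.one_closed \<psi>.hom_one image_eqI)
  then have inj_\<psi>: "inj_on \<psi> (carrier L)"
    using \<psi>.non_trivial_field_hom_imp_inj[OF L.field_axioms] K.one_not_zero by blast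
  have "y \<in> ?A" if y: "y \<in> carrier L" for y
  proof -
    have "\<psi> (h (\<psi> y)) = \<psi> y"
      using \<psi>_\<phi>[of "h (\<psi> y)"] \<phi>[of "\<psi> y"] y by simp
    then have "h (\<psi> y) = y"
      using inj_\<psi> y by (auto dest: inj_onD)
    then show ?thesis
      using y by (metis \<psi>.hom_closed image_eqI)
  qed
  then show ?thesis
    using inj by (auto simp: bij_betw_def)
qed

section \<open>Maximal ideals of finitely generated commutative subalgebras as characters\<close>

lemma (in assoc_algebra) one_hom: "(\<lambda>c. c \<odot>\<^bsub>U\<^esub> \<one>\<^bsub>U\<^esub>) \<in> ring_hom K U"
proof (rule ring_hom_memI)
  fix x y assume "x \<in> carrier K" "y \<in> carrier K"
  then show "(x \<otimes>\<^bsub>K\<^esub> y) \<odot>\<^bsub>U\<^esub> \<one>\<^bsub>U\<^esub> = (x \<odot>\<^bsub>U\<^esub> \<one>\<^bsub>U\<^esub>) \<otimes>\<^bsub>U\<^esub> (y \<odot>\<^bsub>U\<^esub> \<one>\<^bsub>U\<^esub>)"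
    "(x \<oplus>\<^bsub>K\<^esub> y) \<odot>\<^bsub>U\<^esub> \<one>\<^bsub>U\<^esub> = x \<odot>\<^bsub>U\<^esub> \<one>\<^bsub>U\<^esub> \<oplus>\<^bsub>U\<^esub> y \<odot>\<^bsub>U\<^esub> \<one>\<^bsub>U\<^esub>"
    by (simp_all add: smult_mult_left smult_assoc1 smult_l_distr)
qed simp_all

lemma (in assoc_algebra) scalar_commutes:
  assumes "c \<in> carrier K" "x \<in> carrier U"
  shows "x \<otimes>\<^bsub>U\<^esub> (c \<odot>\<^bsub>U\<^esub> \<one>\<^bsub>U\<^esub>) = (c \<odot>\<^bsub>U\<^esub> \<one>\<^bsub>U\<^esub>) \<otimes>\<^bsub>U\<^esub> x"
  using assms by (simp add: smult_mult_left smult_mult_right)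

lemma (in ring) generate_ring_centralizes:
  assumes "H \<subseteq> carrier R" "x \<in> carrier R" "\<And>y. y \<in> H \<Longrightarrow> x \<otimes> y = y \<otimes> x"
    and "y \<in> generate_ring R H"
  shows "x \<otimes> y = y \<otimes> x"
  using assms(4)
proof (induction rule: generate_ring.induct)
  case (eng_mult h1 h2)
  then show ?case
    using generate_ring_in_carrier[OF assms(1)] assms(2) by (metis m_assoc)
qed (use generate_ring_in_carrier[OF assms(1)] assms in \<open>auto simp: l_minus r_minus l_distr r_distr\<close>)

text \<open>Centralizing is applied twice: generators commute with everything generated, hence a
  generated element commutes with the generators and so with everything generated.\<close>

lemma (in ring) generate_ring_cring:
  assumes "H \<subseteq> carrier R" "\<And>x y. x \<in> H \<Longrightarrow> y \<in> H \<Longrightarrow> x \<otimes> y = y \<otimes> x"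
  shows "cring (R\<lparr>carrier := generate_ring R H\<rparr>)"
proof -
  have "x \<otimes> y = y \<otimes> x" if "x \<in> H" "y \<in> generate_ring R H" for x y
    using generate_ring_centralizes[OF assms(1) _ assms(2)] that assms(1) by blast
  then have "x \<otimes> y = y \<otimes> x" if "x \<in> generate_ring R H" "y \<in> generate_ring R H" for x y
    using generate_ring_centralizes[OF assms(1), of x y] generate_ring_in_carrier[OF assms(1)] that by metis
  then have "subcring (generate_ring R H) R"
    by (intro subcringI generate_ring_is_subring[OF assms(1)])
  then show ?thesis
    using subcring_iff[OF generate_ring_incl[OF assms(1)]] by blast
qed

lemma (in ring) a_inv_subring:
  assumes "subring H R" "x \<in> H"
  shows "\<ominus>\<^bsub>R\<lparr>carrier := H\<rparr>\<^esub> x = \<ominus> x"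
  using add.m_inv_consistent[OF subring.axioms(1)[OF assms(1)] assms(2)] by (simp add: a_inv_def)

text \<open>The residue field of \<open>\<nu>\<close> is generated as a ring by the images of
  \<open>S\<close> and of the scalars, so by the Nullstellensatz the scalars map bijectively onto
  it. This gives existence and uniqueness for the definite description in \<open>Specm_val\<close>;
  uniqueness then yields the homomorphism rules.\<close>

lemma (in assoc_algebra) Specm_val_hom:
  assumes "algebraically_closed K" and S: "finite S" "S \<subseteq> carrier U"
    and comm: "\<And>x y. x \<in> S \<Longrightarrow> y \<in> S \<Longrightarrow> x \<otimes>\<^bsub>U\<^esub> y = y \<otimes>\<^bsub>U\<^esub> x"
    and \<nu>: "\<nu> \<in> Specm U (gen_subalgebra K U S)"
  shows "Specm_val K U \<nu> \<in> ring_hom (U\<lparr>carrier := gen_subalgebra K U S\<rparr>) K"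
    and "c \<in> carrier K \<Longrightarrow> Specm_val K U \<nu> (c \<odot>\<^bsub>U\<^esub> \<one>\<^bsub>U\<^esub>) = c"
proof -
  let ?G = "(\<lambda>c. c \<odot>\<^bsub>U\<^esub> \<one>\<^bsub>U\<^esub>) ` carrier K \<union> S"
  define \<Gamma> where "\<Gamma> = gen_subalgebra K U S"
  have \<Gamma>: "\<Gamma> = generate_ring U ?G"
    by (simp add: \<Gamma>_def gen_subalgebra_def)
  have G_sub: "?G \<subseteq> carrier U"
    using S by auto
  define Q where "Q = U\<lparr>carrier := \<Gamma>\<rparr>"
  have "x \<otimes>\<^bsub>U\<^esub> y = y \<otimes>\<^bsub>U\<^esub> x" if "x \<in> ?G" "y \<in> ?G" for x y
  proof (cases "x \<in> S \<and> y \<in> S")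
    case True
    then show ?thesis
      using comm by blast
  next
    case False
    moreover have "x \<in> carrier U" "y \<in> carrier U"
      using that G_sub by blast+
    ultimately show ?thesis
      using that scalar_commutes by (metis (no_types, lifting) UnE imageE)
  qed
  then have "cring Q"
    unfolding Q_def \<Gamma> by (intro generate_ring_cring[OF G_sub])
  then interpret Q: cring Q .
  have "maximalideal \<nu> Q"
    using \<nu> by (simp add: Specm_def Q_def \<Gamma>_def)
  then interpret \<nu>: maximalideal \<nu> Q .
  let ?L = "Q Quot \<nu>"
  interpret L: field ?L
    by (rule \<nu>.quotient_is_field[OF \<open>cring Q\<close>])
  have Q_simps: "carrier Q = \<Gamma>" "\<zero>\<^bsub>Q\<^esub> = \<zero>\<^bsub>U\<^esub>" "\<one>\<^bsub>Q\<^esub> = \<one>\<^bsub>U\<^esub>" "x \<otimes>\<^bsub>Q\<^esub> y = x \<otimes>\<^bsub>U\<^esub> y" "x \<oplus>\<^bsub>Q\<^esub> y = x \<oplus>\<^bsub>U\<^esub> y" for x y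
    by (auto simp: Q_def)
  \<comment> \<open>\<open>Specm_val\<close> is phrased with cosets in \<open>U\<close>, the
    quotient ring with cosets in \<open>Q\<close>; \<open>p_Q\<close> identifies the two.\<close>
  define p where "p x = \<nu> +>\<^bsub>U\<^esub> x" for x
  have p_Q: "p = (+>\<^bsub>Q\<^esub>) \<nu>"
    by (simp add: p_def fun_eq_iff Q_def a_r_coset_def r_coset_def)
  have p: "p \<in> ring_hom Q ?L"
    unfolding p_Q by (rule \<nu>.rcos_ring_hom)
  interpret p: ring_hom_ring Q ?L p
    by (rule ring_hom_ringI2[OF Q.ring_axioms L.ring_axioms p])
  have scalar_in: "c \<odot>\<^bsub>U\<^esub> \<one>\<^bsub>U\<^esub> \<in> carrier Q" if "c \<in> carrier K" for c
    using that by (auto simp: Q_simps \<Gamma> intro: generate_ring.incl)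
  have "(\<lambda>c. c \<odot>\<^bsub>U\<^esub> \<one>\<^bsub>U\<^esub>) \<in> ring_hom K Q"
    using one_hom scalar_in by (auto simp: ring_hom_def Q_simps)
  then have h: "(\<lambda>c. p (c \<odot>\<^bsub>U\<^esub> \<one>\<^bsub>U\<^esub>)) \<in> ring_hom K ?L" (is "?h \<in> _")
    using ring_hom_trans[OF _ p] by (simp add: comp_def)
  have S_in: "S \<subseteq> carrier Q"
    by (auto simp: Q_simps \<Gamma> intro: generate_ring.incl)
  have gen: "p x \<in> generate_ring ?L (p ` S \<union> ?h ` carrier K)" if "x \<in> generate_ring U ?G" for x
    using that
  proof (induction rule: generate_ring.induct)
    case one
    then show ?case
      using p.hom_one generate_ring.one[of ?L] by (simp add: Q_simps)
  next
    case (incl x)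
    then show ?case
      by (intro generate_ring.incl) auto
  next
    case (a_inv x)
    have "\<ominus>\<^bsub>U\<^esub> x = \<ominus>\<^bsub>Q\<^esub> x"
      unfolding Q_def using a_inv.hyps generate_ring_is_subring[OF G_sub] by (simp add: a_inv_subring \<Gamma>)
    moreover have "p (\<ominus>\<^bsub>Q\<^esub> x) = \<ominus>\<^bsub>?L\<^esub> (p x)"
      using a_inv.hyps by (intro p.hom_a_inv) (simp add: Q_simps \<Gamma>)
    ultimately show ?case
      using generate_ring.a_inv[OF a_inv.IH] by simp
  next
    case (eng_add x y)
    then show ?case
      using generate_ring.eng_add[OF eng_add.IH] p.hom_add[of x y] by (simp add: Q_simps \<Gamma>)
  next
    case (eng_mult x y)
    then show ?case
      using generate_ring.eng_mult[OF eng_mult.IH] p.hom_mult[of x y] by (simp add: Q_simps \<Gamma>)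
  qed
  have "carrier ?L \<subseteq> p ` carrier Q"
    by (auto simp: FactRing_def A_RCOSETS_def RCOSETS_def a_r_coset_def p_Q)
  then have "carrier ?L \<subseteq> generate_ring ?L (p ` S \<union> ?h ` carrier K)"
    using gen by (auto simp: Q_simps \<Gamma>)
  moreover have sub: "p ` S \<union> ?h ` carrier K \<subseteq> carrier ?L"
    using S_in scalar_in p.hom_closed by blast
  then have "generate_ring ?L (p ` S \<union> ?h ` carrier K) \<subseteq> carrier ?L"
    by (rule L.generate_ring_incl)
  ultimately have "bij_betw ?h (carrier K) (carrier ?L)"
    using S(1) sub by (intro nullstellensatz[OF assms(1) L.field_axioms h, of "p ` S"]) auto
  then have inj: "inj_on ?h (carrier K)" and surj: "?h ` carrier K = carrier ?L"
    by (auto simp: bij_betw_def)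
  interpret h: ring_hom_ring K ?L ?h
    by (rule ring_hom_ringI2[OF R.ring_axioms L.ring_axioms h])
  have uniq: "Specm_val K U \<nu> x = c" if "c \<in> carrier K" "p x = ?h c" for x c
    unfolding Specm_val_def p_def[symmetric]
    by (rule the_equality) (use that inj in \<open>auto dest: inj_onD\<close>)
  then show "c \<in> carrier K \<Longrightarrow> Specm_val K U \<nu> (c \<odot>\<^bsub>U\<^esub> \<one>\<^bsub>U\<^esub>) = c"
    using uniq[of c "c \<odot>\<^bsub>U\<^esub> \<one>\<^bsub>U\<^esub>"] by blast
  have ex: "\<exists>c\<in>carrier K. p x = ?h c" if "x \<in> carrier Q" for x
    using p.hom_closed[OF that] unfolding surj[symmetric] by (rule imageE) blast
  have "Specm_val K U \<nu> \<in> ring_hom Q K"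
  proof (rule ring_hom_memI)
    fix x assume x: "x \<in> carrier Q"
    then obtain c where c: "c \<in> carrier K" "p x = ?h c"
      using ex by blast
    then show "Specm_val K U \<nu> x \<in> carrier K"
      using uniq[OF c] by simp
    fix y assume y: "y \<in> carrier Q"
    then obtain c' where c': "c' \<in> carrier K" "p y = ?h c'"
      using ex by blast
    have "p (x \<otimes>\<^bsub>Q\<^esub> y) = ?h (c \<otimes>\<^bsub>K\<^esub> c')"
      using p.hom_mult[OF x y] h.hom_mult[OF c(1) c'(1)] c(2) c'(2) by simp
    then show "Specm_val K U \<nu> (x \<otimes>\<^bsub>Q\<^esub> y) = Specm_val K U \<nu> x \<otimes>\<^bsub>K\<^esub> Specm_val K U \<nu> y"
      using uniq[OF c] uniq[OF c'] uniq[of "c \<otimes>\<^bsub>K\<^esub> c'"] c(1) c'(1) by simp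
    have "p (x \<oplus>\<^bsub>Q\<^esub> y) = ?h (c \<oplus>\<^bsub>K\<^esub> c')"
      using p.hom_add[OF x y] h.hom_add[OF c(1) c'(1)] c(2) c'(2) by simp
    then show "Specm_val K U \<nu> (x \<oplus>\<^bsub>Q\<^esub> y) = Specm_val K U \<nu> x \<oplus>\<^bsub>K\<^esub> Specm_val K U \<nu> y"
      using uniq[OF c] uniq[OF c'] uniq[of "c \<oplus>\<^bsub>K\<^esub> c'"] c(1) c'(1) by simp
  next
    have "p \<one>\<^bsub>Q\<^esub> = ?h \<one>\<^bsub>K\<^esub>"
      by (simp add: Q_simps)
    then show "Specm_val K U \<nu> \<one>\<^bsub>Q\<^esub> = \<one>\<^bsub>K\<^esub>"
      by (rule uniq[OF R.one_closed])
  qed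
  then show "Specm_val K U \<nu> \<in> ring_hom (U\<lparr>carrier := gen_subalgebra K U S\<rparr>) K"
    by (simp add: Q_def \<Gamma>_def)
qed

section \<open>Quotients by left ideals\<close>

lemma (in abelian_subgroup) a_rcos_eq_iff:
  assumes "x \<in> carrier G" "y \<in> carrier G"
  shows "H +> x = H +> y \<longleftrightarrow> x \<ominus> y \<in> H"
proof -
  have "x \<ominus> y \<in> H \<longleftrightarrow> x \<in> H +> y"
    using a_rcos_module[OF assms(2,1)] by (simp only: a_minus_def)
  also have "\<dots> \<longleftrightarrow> H +> x = H +> y"
    using a_repr_independence'[OF _ assms(2), of x] a_rcos_self[OF assms(1)] by metis
  finally show ?thesis
    by (rule sym)
qed

definition left_ideal :: "('a, 'm) ring_scheme \<Rightarrow> 'a set \<Rightarrow> bool" where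
  "left_ideal R J \<longleftrightarrow> subgroup J (add_monoid R) \<and> (\<forall>a\<in>carrier R. \<forall>x\<in>J. a \<otimes>\<^bsub>R\<^esub> x \<in> J)"

lemma (in ring) left_idealI:
  assumes "J \<subseteq> carrier R" "\<zero> \<in> J" "\<And>x y. x \<in> J \<Longrightarrow> y \<in> J \<Longrightarrow> x \<oplus> y \<in> J"
    and "\<And>a x. a \<in> carrier R \<Longrightarrow> x \<in> J \<Longrightarrow> a \<otimes> x \<in> J"
  shows "left_ideal R J"
proof -
  have "\<ominus> x \<in> J" if "x \<in> J" for x
    using assms(4)[of "\<ominus> \<one>" x] that assms(1) by (auto simp: l_minus)
  then show ?thesis
    using assms by (auto simp: left_ideal_def a_inv_def[symmetric] intro!: add.subgroupI)
qed

lemma (in ring) left_idealE: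
  assumes "left_ideal R J"
  shows "J \<subseteq> carrier R" "\<zero> \<in> J" "\<And>x y. x \<in> J \<Longrightarrow> y \<in> J \<Longrightarrow> x \<oplus> y \<in> J"
    "\<And>a x. a \<in> carrier R \<Longrightarrow> x \<in> J \<Longrightarrow> a \<otimes> x \<in> J" "\<And>x. x \<in> J \<Longrightarrow> \<ominus> x \<in> J"
  using assms subgroup.subset[of J "add_monoid R"] subgroup.one_closed[of J "add_monoid R"]
    subgroup.m_closed[of J "add_monoid R"] subgroup.m_inv_closed[of J "add_monoid R"]
  by (auto simp: left_ideal_def a_inv_def)

text \<open>Zorn's lemma applies because properness, expressed as not containing
  \<open>\<one>\<close>, is inherited by unions of chains.\<close>

lemma (in ring) exists_maximal_left_ideal:
  assumes I: "left_ideal R I" "\<one> \<notin> I"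
  shows "\<exists>J. left_ideal R J \<and> I \<subseteq> J \<and> \<one> \<notin> J \<and>
    (\<forall>J'. left_ideal R J' \<longrightarrow> J \<subseteq> J' \<longrightarrow> \<one> \<notin> J' \<longrightarrow> J' = J)"
proof -
  let ?A = "{J. left_ideal R J \<and> I \<subseteq> J \<and> \<one> \<notin> J}"
  have "\<exists>J\<in>?A. \<forall>J'\<in>?A. J \<subseteq> J' \<longrightarrow> J' = J"
  proof (rule subset_Zorn_nonempty)
    show "?A \<noteq> {}"
      using I by blast
    fix C assume C: "C \<noteq> {}" "subset.chain ?A C"
    then have C_A: "J \<in> ?A" if "J \<in> C" for J
      using that by (auto simp: subset.chain_def)
    have "left_ideal R (\<Union>C)"
    proof (rule left_idealI)
      fix x y assume "x \<in> \<Union>C" "y \<in> \<Union>C"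
      then obtain J1 J2 where J: "J1 \<in> C" "x \<in> J1" "J2 \<in> C" "y \<in> J2"
        by blast
      then have "J1 \<subseteq> J2 \<or> J2 \<subseteq> J1"
        using C(2) by (auto simp: subset.chain_def)
      then show "x \<oplus> y \<in> \<Union>C"
        using J C_A left_idealE(3) by blast
    qed (use C(1) C_A left_idealE(1,2,4) in blast)+
    then show "\<Union>C \<in> ?A"
      using C(1) C_A by auto
  qed
  then show ?thesis
    by (metis (no_types, lifting) mem_Collect_eq order_trans)
qed

(* The multiplication and unit fields of the record are not used by modules. *)
definition left_quotient :: "('a, 'm) ring_scheme \<Rightarrow> 'a set \<Rightarrow> ('a, 'a set) module" where
  "left_quotient R J = \<lparr>carrier = a_rcosets\<^bsub>R\<^esub> J, monoid.mult = \<lambda>_ _. J, one = J, ring.zero = J, add = set_add R,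
     smult = \<lambda>a C. \<Union>x\<in>C. J +>\<^bsub>R\<^esub> (a \<otimes>\<^bsub>R\<^esub> x)\<rparr>"

lemma (in ring) abelian_subgroup_left_ideal:
  assumes "left_ideal R J"
  shows "abelian_subgroup J R"
  using assms abelian_group_axioms
  by (intro abelian_subgroupI3 additive_subgroup.intro) (auto simp: left_ideal_def)

text \<open>Well-definedness of the action: representatives \<open>x\<close> and
  \<open>j \<oplus> x\<close> give products differing by \<open>a \<otimes> j\<close>, which lies in
  the left ideal. So the union in \<open>left_quotient\<close> runs over equal cosets.\<close>

lemma (in ring) left_quotient_smult:
  assumes J: "left_ideal R J" and "a \<in> carrier R" "x \<in> carrier R"
  shows "a \<odot>\<^bsub>left_quotient R J\<^esub> (J +> x) = J +> (a \<otimes> x)"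
proof -
  interpret J: abelian_subgroup J R
    using J by (rule abelian_subgroup_left_ideal)
  have "J +> (a \<otimes> y) = J +> (a \<otimes> x)" if y: "y \<in> J +> x" for y
  proof -
    obtain j where j: "j \<in> J" "y = j \<oplus> x"
      using y by (auto simp: a_r_coset_def' )
    then have "j \<in> carrier R"
      using left_idealE(1)[OF J] by blast
    then have "a \<otimes> y \<ominus> a \<otimes> x = a \<otimes> j"
      using assms(2,3) unfolding j(2) by algebra
    then have "a \<otimes> y \<ominus> a \<otimes> x \<in> J"
      using left_idealE(4)[OF J assms(2) j(1)] by (simp only:)
    moreover have "a \<otimes> y \<in> carrier R" "a \<otimes> x \<in> carrier R"
      using assms(2,3) j(2) \<open>j \<in> carrier R\<close> by simp_all
    ultimately show ?thesis
      using J.a_rcos_eq_iff by blast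
  qed
  moreover have "x \<in> J +> x"
    by (rule J.a_rcos_self[OF assms(3)])
  ultimately have "(\<Union>y\<in>J +> x. J +> (a \<otimes> y)) = J +> (a \<otimes> x)"
    by (intro SUP_eq_const) blast+
  then show ?thesis
    by (simp add: left_quotient_def)
qed

lemma (in ring) left_module_left_quotient:
  assumes J: "left_ideal R J"
  shows "left_module R (left_quotient R J)"
proof -
  interpret J: abelian_subgroup J R
    using J by (rule abelian_subgroup_left_ideal)
  let ?M = "left_quotient R J"
  interpret Q: comm_group "R A_Mod J"
    by (rule J.a_factorgroup_is_comm_group)
  have Q: "carrier ?M = carrier (R A_Mod J)" "C \<oplus>\<^bsub>?M\<^esub> D = C \<otimes>\<^bsub>R A_Mod J\<^esub> D" "\<zero>\<^bsub>?M\<^esub> = \<one>\<^bsub>R A_Mod J\<^esub>"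
    for C D
    by (simp_all add: left_quotient_def A_FactGroup_def')
  interpret M: abelian_group ?M
    by (rule abelian_groupI, unfold Q)
      (rule Q.m_closed Q.one_closed Q.m_assoc Q.m_comm Q.l_one Q.l_inv_ex; assumption)+
  have coset: "\<exists>x\<in>carrier R. C = J +> x" if "C \<in> carrier ?M" for C
    using that by (auto simp: left_quotient_def A_RCOSETS_def')
  have coset_in: "J +> x \<in> carrier ?M" if "x \<in> carrier R" for x
    using that by (auto simp: left_quotient_def A_RCOSETS_def')
  have add: "(J +> x) \<oplus>\<^bsub>?M\<^esub> (J +> y) = J +> (x \<oplus> y)" if "x \<in> carrier R" "y \<in> carrier R" for x y
    using J.a_rcos_sum[OF that] by (simp add: left_quotient_def)
  show ?thesis
  proof
    fix a C assume a: "a \<in> carrier R" and "C \<in> carrier ?M"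
    then obtain x where x: "x \<in> carrier R" "C = J +> x"
      using coset by blast
    show "a \<odot>\<^bsub>?M\<^esub> C \<in> carrier ?M"
      using a x by (simp add: left_quotient_smult[OF J] coset_in)
    fix b assume b: "b \<in> carrier R"
    show "(a \<oplus> b) \<odot>\<^bsub>?M\<^esub> C = a \<odot>\<^bsub>?M\<^esub> C \<oplus>\<^bsub>?M\<^esub> b \<odot>\<^bsub>?M\<^esub> C"
      using a b x by (simp add: left_quotient_smult[OF J] add l_distr)
    show "(a \<otimes> b) \<odot>\<^bsub>?M\<^esub> C = a \<odot>\<^bsub>?M\<^esub> (b \<odot>\<^bsub>?M\<^esub> C)"
      using a b x by (simp add: left_quotient_smult[OF J] m_assoc)
  next
    fix a C D assume a: "a \<in> carrier R" and "C \<in> carrier ?M" "D \<in> carrier ?M"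
    then obtain x y where "x \<in> carrier R" "C = J +> x" "y \<in> carrier R" "D = J +> y"
      using coset by blast
    then show "a \<odot>\<^bsub>?M\<^esub> (C \<oplus>\<^bsub>?M\<^esub> D) = a \<odot>\<^bsub>?M\<^esub> C \<oplus>\<^bsub>?M\<^esub> a \<odot>\<^bsub>?M\<^esub> D"
      using a by (simp add: left_quotient_smult[OF J] add r_distr)
  next
    fix C assume "C \<in> carrier ?M"
    then obtain x where "x \<in> carrier R" "C = J +> x"
      using coset by blast
    then show "\<one> \<odot>\<^bsub>?M\<^esub> C = C"
      by (simp add: left_quotient_smult[OF J])
  qed
qed

text \<open>For a maximal left ideal \<open>J\<close>, a submodule of the quotient pulls back to a
  left ideal \<open>J'\<close> containing \<open>J\<close>. Either \<open>\<one>\<close> lies in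
  \<open>J'\<close> and the submodule is everything, or \<open>J' = J\<close> and it is
  zero.\<close>

lemma (in ring) exists_simple_left_module:
  assumes I: "left_ideal R I" "\<one> \<notin> I"
  shows "\<exists>J. left_ideal R J \<and> I \<subseteq> J \<and> simple_left_module R (left_quotient R J) \<and>
    module_generated_by R (left_quotient R J) (J +> \<one>)"
proof -
  obtain J where J: "left_ideal R J" "I \<subseteq> J" "\<one> \<notin> J"
    and max: "\<And>J'. left_ideal R J' \<Longrightarrow> J \<subseteq> J' \<Longrightarrow> \<one> \<notin> J' \<Longrightarrow> J' = J"
    using exists_maximal_left_ideal[OF I] by blast
  interpret J: abelian_subgroup J R
    using J(1) by (rule abelian_subgroup_left_ideal)
  let ?M = "left_quotient R J"
  interpret M: left_module R ?M
    by (rule left_module_left_quotient[OF J(1)])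
  have carrier: "carrier ?M = (\<lambda>x. J +> x) ` carrier R"
    by (auto simp: left_quotient_def A_RCOSETS_def')
  have zero: "\<zero>\<^bsub>?M\<^esub> = J"
    by (simp add: left_quotient_def)
  have in_J: "J +> x = J \<longleftrightarrow> x \<in> J" if "x \<in> carrier R" for x
    using J.a_rcos_eq_iff[OF that zero_closed] that a_coset_add_zero[OF left_idealE(1)[OF J(1)]]
    by (simp add: a_minus_def)
  have "simple_left_module R ?M"
  proof
    show "carrier ?M \<noteq> {\<zero>\<^bsub>?M\<^esub>}"
      using in_J[OF one_closed] J(3) by (auto simp: carrier zero)
    fix N assume N: "submodule N R ?M"
    then interpret N: submodule N R ?M .
    have N_sub: "N \<subseteq> carrier ?M"
      using N.subset by simp
    define J' where "J' = {x \<in> carrier R. J +> x \<in> N}"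
    have "left_ideal R J'"
    proof (rule left_idealI)
      show "\<zero> \<in> J'"
        using N.one_closed in_J[OF zero_closed] left_idealE(2)[OF J(1)] by (simp add: J'_def zero)
      show "x \<oplus> y \<in> J'" if "x \<in> J'" "y \<in> J'" for x y
        using N.m_closed[of "J +> x" "J +> y"] that J.a_rcos_sum[of x y]
        by (auto simp: J'_def left_quotient_def)
      show "a \<otimes> x \<in> J'" if "a \<in> carrier R" "x \<in> J'" for a x
      proof -
        have "x \<in> carrier R" "a \<odot>\<^bsub>?M\<^esub> (J +> x) \<in> N"
          using that N.smult_closed by (auto simp: J'_def)
        then show ?thesis
          using that(1) unfolding left_quotient_smult[OF J(1) that(1) \<open>x \<in> carrier R\<close>] by (simp add: J'_def)
      qed
    qed (auto simp: J'_def)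
    moreover have "J \<subseteq> J'"
    proof
      fix x assume x: "x \<in> J"
      then have "J +> x = J"
        using in_J left_idealE(1)[OF J(1)] by blast
      then show "x \<in> J'"
        using N.one_closed x left_idealE(1)[OF J(1)] by (auto simp: J'_def zero)
    qed
    ultimately consider "\<one> \<in> J'" | "J' = J"
      using max by blast
    then show "N = {\<zero>\<^bsub>?M\<^esub>} \<or> N = carrier ?M"
    proof cases
      case 1
      have "x \<in> J'" if "x \<in> carrier R" for x
        using left_idealE(4)[OF \<open>left_ideal R J'\<close> that 1] that by simp
      then show ?thesis
        using N_sub by (auto simp: carrier J'_def)
    next
      case 2
      have "C \<in> {J}" if C: "C \<in> N" for C
      proof -
        obtain x where x: "x \<in> carrier R" "C = J +> x"
          using C N_sub carrier by blast
        then have "x \<in> J'"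
          using C by (simp add: J'_def)
        then have "x \<in> J"
          by (simp only: 2)
        then show ?thesis
          unfolding x(2) singleton_iff by (rule in_J[OF x(1), THEN iffD2])
      qed
      moreover have "J \<in> N"
        using N.one_closed by (simp add: zero)
      ultimately have "N = {J}"
        by blast
      then show ?thesis
        by (simp add: zero)
    qed
  qed
  moreover have "module_generated_by R ?M (J +> \<one>)"
  proof -
    have "(\<lambda>u. u \<odot>\<^bsub>?M\<^esub> (J +> \<one>)) ` carrier R = (\<lambda>u. J +> u) ` carrier R"
      by (rule image_cong) (simp_all add: left_quotient_smult[OF J(1)])
    then show ?thesis
      unfolding module_generated_by_def carrier by blast
  qed
  ultimately show ?thesis
    using J(1,2) by blast
qed

section \<open>The associated graded algebra\<close>

text \<open>The additive and multiplicative part of a filtered algebra, from which classes, symbols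
  and graded products are computed.\<close>

locale filtered_ring = ring U for U :: "('k, 'u, 'm) module_scheme" (structure) +
  fixes F :: "nat \<Rightarrow> 'u set"
  assumes F_subgroup: "additive_subgroup (F i) U"
    and F_mono: "i \<le> j \<Longrightarrow> F i \<subseteq> F j"
    and F_mult: "x \<in> F i \<Longrightarrow> y \<in> F j \<Longrightarrow> x \<otimes> y \<in> F (i + j)"
    and F_exhaustive: "carrier U = (\<Union>i. F i)"
begin

lemma F_closed: "x \<in> F i \<Longrightarrow> x \<in> carrier U"
  using F_exhaustive by blast

lemma filt_subgroup: "additive_subgroup (filt U F i) U"
proof (cases "i < 0")
  case True
  have "subgroup {\<zero>} (add_monoid U)"
    by (rule add.subgroupI) (auto simp: a_inv_def[symmetric])
  with True show ?thesis
    by (simp add: filt_def additive_subgroup_def)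
qed (simp add: filt_def F_subgroup)

lemma filt_abelian_subgroup: "abelian_subgroup (filt U F i) U"
  by (rule abelian_subgroupI3[OF filt_subgroup abelian_group_axioms])

lemma filt_nat: "filt U F (int n) = F n"
  by (simp add: filt_def)

lemma filt_closed: "x \<in> filt U F i \<Longrightarrow> x \<in> carrier U"
  using additive_subgroup.a_subset[OF filt_subgroup] by blast

lemma filt_zero: "\<zero> \<in> filt U F i"
  by (rule additive_subgroup.zero_closed[OF filt_subgroup])

lemma filt_add: "x \<in> filt U F i \<Longrightarrow> y \<in> filt U F i \<Longrightarrow> x \<oplus> y \<in> filt U F i"
  by (rule additive_subgroup.a_closed[OF filt_subgroup])

lemma filt_neg: "x \<in> filt U F i \<Longrightarrow> \<ominus> x \<in> filt U F i"
  by (rule additive_subgroup.a_inv_closed[OF filt_subgroup])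

lemma filt_diff: "x \<in> filt U F i \<Longrightarrow> y \<in> filt U F i \<Longrightarrow> x \<ominus> y \<in> filt U F i"
  by (simp add: a_minus_def filt_add filt_neg)

lemma filt_finsum: "(\<And>j. j \<in> A \<Longrightarrow> f j \<in> filt U F i) \<Longrightarrow> (\<Oplus>j\<in>A. f j) \<in> filt U F i"
proof (induction A rule: infinite_finite_induct)
  case (insert j A)
  then have "(\<Oplus>i\<in>insert j A. f i) = f j \<oplus> (\<Oplus>i\<in>A. f i)"
    by (intro finsum_insert) (auto intro: filt_closed)
  then show ?case
    using insert by (simp add: filt_add)
qed (simp_all add: filt_zero)

lemma filt_mono: "i \<le> j \<Longrightarrow> filt U F i \<subseteq> filt U F j"
proof (cases "i < 0")
  case True
  then show ?thesis
    using filt_zero by (auto simp: filt_def)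
next
  case False
  assume "i \<le> j"
  with False show ?thesis
    using F_mono[of "nat i" "nat j"] by (auto simp: filt_def)
qed

text \<open>For a negative index one factor is zero. Admitting all integers lets a bound such as
  \<open>N - d j\<close> become negative, where it says that the coefficient vanishes.\<close>

lemma filt_mult: "x \<in> filt U F i \<Longrightarrow> y \<in> filt U F j \<Longrightarrow> x \<otimes> y \<in> filt U F (i + j)"
proof (cases "i < 0 \<or> j < 0")
  case True
  assume x: "x \<in> filt U F i" and y: "y \<in> filt U F j"
  have "x \<otimes> y = \<zero>"
    using True x y filt_closed[OF x] filt_closed[OF y] by (auto simp: filt_def)
  then show ?thesis
    by (simp add: filt_zero)
next
  case False
  assume "x \<in> filt U F i" "y \<in> filt U F j"
  with False show ?thesis
    using F_mult[of x "nat i" y "nat j"] by (simp add: filt_def nat_add_distrib)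
qed

lemma filt_deg_mem:
  assumes "u \<in> carrier U" "filt_deg U F u = Fin d"
  shows "u \<in> F d"
proof -
  obtain i where "u \<in> F i"
    using assms(1) F_exhaustive by blast
  then have "u \<in> F (LEAST i. u \<in> F i)"
    by (rule LeastI)
  then show ?thesis
    using assms(2) by (simp add: filt_deg_def split: if_splits)
qed

lemma filt_deg_less_mem:
  assumes "u \<in> carrier U" "filt_deg U F u < Fin d"
  shows "u \<in> filt U F (int d - 1)"
proof (cases "u = \<zero>")
  case True
  then show ?thesis
    by (simp add: filt_zero)
next
  case False
  then obtain e where e: "filt_deg U F u = Fin e" "e < d"
    using assms(2) by (simp add: filt_deg_def)
  then have "u \<in> filt U F (int e)"
    using filt_deg_mem[OF assms(1)] by (simp add: filt_nat)
  then show ?thesis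
    using filt_mono[of "int e" "int d - 1"] e(2) by auto
qed

text \<open>The class in degree \<open>n\<close>, taken for every element of \<open>U\<close> and
  not only for those of \<open>F n\<close>. The coset arithmetic is thus free of degree conditions,
  which are tracked by \<open>fseq\<close>.\<close>

definition cls :: "nat \<Rightarrow> 'u \<Rightarrow> 'u set" where
  "cls n u = filt U F (int n - 1) +> u"

lemma cls_eq_iff:
  assumes "u \<in> carrier U" "v \<in> carrier U"
  shows "cls n u = cls n v \<longleftrightarrow> u \<ominus> v \<in> filt U F (int n - 1)"
  unfolding cls_def by (rule abelian_subgroup.a_rcos_eq_iff[OF filt_abelian_subgroup assms])

lemma cls_zero: "cls n \<zero> = filt U F (int n - 1)"
  unfolding cls_def by (rule a_coset_add_zero) (auto intro: filt_closed)

lemma mem_cls_iff: "u \<in> carrier U \<Longrightarrow> v \<in> carrier U \<Longrightarrow> v \<in> cls n u \<longleftrightarrow> v \<ominus> u \<in> filt U F (int n - 1)"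
  unfolding cls_def a_minus_def by (rule abelian_subgroup.a_rcos_module[OF filt_abelian_subgroup])

text \<open>The set \<open>D\<close> is kept general so that the components of the graded algebra
  (\<open>D = F n\<close>) and those of a graded ideal are treated together.\<close>

definition cosets :: "nat \<Rightarrow> 'u set \<Rightarrow> 'u set monoid" where
  "cosets n D = (add_monoid U)\<lparr>carrier := D\<rparr> Mod filt U F (int n - 1)"

lemma cosets_simps:
  "carrier (cosets n D) = cls n ` D"
  "\<one>\<^bsub>cosets n D\<^esub> = cls n \<zero>"
  "u \<in> carrier U \<Longrightarrow> v \<in> carrier U \<Longrightarrow> cls n u \<otimes>\<^bsub>cosets n D\<^esub> cls n v = cls n (u \<oplus> v)"
proof -
  show "carrier (cosets n D) = cls n ` D"
    by (auto simp: cosets_def FactGroup_def RCOSETS_def cls_def a_r_coset_def r_coset_def)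
  show "\<one>\<^bsub>cosets n D\<^esub> = cls n \<zero>"
    by (simp add: cosets_def FactGroup_def cls_zero)
  show "cls n u \<otimes>\<^bsub>cosets n D\<^esub> cls n v = cls n (u \<oplus> v)" if "u \<in> carrier U" "v \<in> carrier U"
    using abelian_subgroup.a_rcos_sum[OF filt_abelian_subgroup that]
    by (simp add: cosets_def FactGroup_def cls_def set_add_def set_mult_def)
qed

lemma cosets_comm_group:
  assumes D: "additive_subgroup D U"
  shows "comm_group (cosets n D)"
proof (rule comm_groupI)
  have D_sub: "D \<subseteq> carrier U"
    by (rule additive_subgroup.a_subset[OF D])
  show "\<one>\<^bsub>cosets n D\<^esub> \<in> carrier (cosets n D)"
    using additive_subgroup.zero_closed[OF D] by (auto simp: cosets_simps)
  fix x assume "x \<in> carrier (cosets n D)"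
  then obtain u where u: "u \<in> D" "u \<in> carrier U" "x = cls n u"
    using D_sub by (auto simp: cosets_simps)
  show "\<one>\<^bsub>cosets n D\<^esub> \<otimes>\<^bsub>cosets n D\<^esub> x = x"
    using u by (simp add: cosets_simps)
  have "cls n (\<ominus> u) \<otimes>\<^bsub>cosets n D\<^esub> x = \<one>\<^bsub>cosets n D\<^esub>"
    using u by (simp add: cosets_simps l_neg)
  then show "\<exists>y\<in>carrier (cosets n D). y \<otimes>\<^bsub>cosets n D\<^esub> x = \<one>\<^bsub>cosets n D\<^esub>"
    using additive_subgroup.a_inv_closed[OF D u(1)] by (auto simp: cosets_simps(1))
  fix y assume "y \<in> carrier (cosets n D)"
  then obtain v where v: "v \<in> D" "v \<in> carrier U" "y = cls n v"
    using D_sub by (auto simp: cosets_simps)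
  show "x \<otimes>\<^bsub>cosets n D\<^esub> y \<in> carrier (cosets n D)"
    using u v additive_subgroup.a_closed[OF D u(1) v(1)] by (simp add: cosets_simps)
  show "x \<otimes>\<^bsub>cosets n D\<^esub> y = y \<otimes>\<^bsub>cosets n D\<^esub> x"
    using u v by (simp add: cosets_simps a_comm)
  fix z assume "z \<in> carrier (cosets n D)"
  then obtain w where w: "w \<in> carrier U" "z = cls n w"
    using D_sub by (auto simp: cosets_simps)
  show "x \<otimes>\<^bsub>cosets n D\<^esub> y \<otimes>\<^bsub>cosets n D\<^esub> z = x \<otimes>\<^bsub>cosets n D\<^esub> (y \<otimes>\<^bsub>cosets n D\<^esub> z)"
    using u v w by (simp add: cosets_simps a_assoc)
qed

lemma gr_comp_eq: "gr_comp U F n = cosets n (F n)"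
  by (simp add: gr_comp_def cosets_def)

text \<open>Elements of \<open>gr U F\<close> are handled through sequences of representatives:
  \<open>hcls\<close> forms the family of their classes and \<open>fseq\<close> below imposes finite
  support. Additive operations then become termwise operations in \<open>U\<close>.\<close>

definition hcls :: "(nat \<Rightarrow> 'u) \<Rightarrow> nat \<Rightarrow> 'u set" where
  "hcls u = (\<lambda>n. cls n (u n))"

definition fseq :: "(nat \<Rightarrow> 'u set) \<Rightarrow> (nat \<Rightarrow> 'u) set" where
  "fseq S = {u. (\<forall>n. u n \<in> S n) \<and> finite {n. u n \<noteq> \<zero>}}"

text \<open>Finitely many nontrivial cosets do not make an arbitrary choice of representatives
  finitely supported; \<open>\<zero>\<close> has to be chosen for every trivial coset. The sets
  \<open>S n\<close> may be smaller than \<open>D n\<close> as long as they meet the same cosets,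
  which is used for graded ideals.\<close>

lemma carrier_sum_cosets:
  assumes D: "\<And>n. additive_subgroup (D n) U" and S: "\<And>n. cls n ` S n = cls n ` D n" "\<And>n. \<zero> \<in> S n"
  shows "carrier (sum_group UNIV (\<lambda>n. cosets n (D n))) = hcls ` fseq S"
proof -
  have gr: "group (cosets n (D n))" for n
    using cosets_comm_group[OF D] by (simp add: comm_group_def)
  have eq: "carrier (sum_group UNIV (\<lambda>n. cosets n (D n))) =
      {x. (\<forall>n. x n \<in> cls n ` S n) \<and> finite {n. x n \<noteq> cls n \<zero>}}"
    by (subst carrier_sum_group) (auto simp: gr cosets_simps S(1) PiE_iff)
  show ?thesis
    unfolding eq
  proof (intro equalityI subsetI)
    fix x assume x: "x \<in> {x. (\<forall>n. x n \<in> cls n ` S n) \<and> finite {n. x n \<noteq> cls n \<zero>}}"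
    then have "\<forall>n. \<exists>u. u \<in> S n \<and> x n = cls n u \<and> (x n = cls n \<zero> \<longrightarrow> u = \<zero>)"
      using S(2) by (metis (mono_tags, lifting) imageE mem_Collect_eq)
    then obtain u where u: "\<And>n. u n \<in> S n" "\<And>n. x n = cls n (u n)" "\<And>n. x n = cls n \<zero> \<Longrightarrow> u n = \<zero>"
      by metis
    have "finite {n. u n \<noteq> \<zero>}"
      by (rule finite_subset[of _ "{n. x n \<noteq> cls n \<zero>}"]) (use x u(3) in auto)
    then have "u \<in> fseq S"
      using u(1) by (simp add: fseq_def)
    moreover have "x = hcls u"
      using u(2) by (simp add: hcls_def fun_eq_iff)
    ultimately show "x \<in> hcls ` fseq S"
      by blast
  next
    fix x assume "x \<in> hcls ` fseq S"
    then obtain u where u: "u \<in> fseq S" "x = hcls u"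
      by blast
    have "finite {n. cls n (u n) \<noteq> cls n \<zero>}"
      by (rule finite_subset[of _ "{n. u n \<noteq> \<zero>}"]) (use u(1) in \<open>auto simp: fseq_def\<close>)
    then show "x \<in> {x. (\<forall>n. x n \<in> cls n ` S n) \<and> finite {n. x n \<noteq> cls n \<zero>}}"
      using u by (auto simp: hcls_def fseq_def)
  qed
qed

lemma carrier_gr: "carrier (gr U F) = hcls ` fseq F"
proof -
  have "gr_comp U F = (\<lambda>n. cosets n (F n))"
    by (simp add: fun_eq_iff gr_comp_eq)
  then show ?thesis
    using carrier_sum_cosets[of F F] F_subgroup additive_subgroup.zero_closed[OF F_subgroup]
    by (simp add: gr_def)
qed

lemma fseq_F_closed: "u \<in> fseq F \<Longrightarrow> u n \<in> carrier U"
  by (auto simp: fseq_def intro: F_closed)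

lemma fseq_F_filt: "u \<in> fseq F \<Longrightarrow> u n \<in> filt U F (int n)"
  by (simp add: fseq_def filt_nat)

lemma fseqI: "(\<And>n. u n \<in> S n) \<Longrightarrow> finite A \<Longrightarrow> (\<And>n. n \<notin> A \<Longrightarrow> u n = \<zero>) \<Longrightarrow> u \<in> fseq S"
  unfolding fseq_def by (auto intro: finite_subset[of _ A])

lemma fseq_pointwise:
  assumes u: "u \<in> fseq F" and v: "v \<in> fseq F"
    and op: "\<And>n. op (u n) (v n) \<in> F n" "op \<zero> \<zero> = \<zero>"
  shows "(\<lambda>n. op (u n) (v n)) \<in> fseq F"
  by (rule fseqI[where A = "{n. u n \<noteq> \<zero>} \<union> {n. v n \<noteq> \<zero>}"]) (use assms in \<open>auto simp: fseq_def\<close>)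

lemma fseq_add: "u \<in> fseq F \<Longrightarrow> v \<in> fseq F \<Longrightarrow> (\<lambda>n. u n \<oplus> v n) \<in> fseq F"
  by (rule fseq_pointwise) (auto simp: filt_nat[symmetric] fseq_F_filt filt_add)

lemma fseq_neg: "u \<in> fseq F \<Longrightarrow> (\<lambda>n. \<ominus> u n) \<in> fseq F"
  using fseq_pointwise[of u u "\<lambda>x _. \<ominus> x"] by (simp add: filt_nat[symmetric] fseq_F_filt filt_neg)

lemma fseq_zero: "(\<lambda>n. \<zero>) \<in> fseq F"
  by (rule fseqI[of _ _ "{}"]) (auto simp: filt_nat[symmetric] filt_zero)

section \<open>The additive group of the associated graded algebra\<close>

lemma hcls_eq_iff:
  assumes "u \<in> fseq F" "v \<in> fseq F"
  shows "hcls u = hcls v \<longleftrightarrow> (\<forall>n. u n \<ominus> v n \<in> filt U F (int n - 1))"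
  using cls_eq_iff[OF fseq_F_closed[OF assms(1)] fseq_F_closed[OF assms(2)]]
  by (simp add: hcls_def fun_eq_iff)

lemma gr_add: "u \<in> fseq F \<Longrightarrow> v \<in> fseq F \<Longrightarrow> hcls u \<oplus>\<^bsub>gr U F\<^esub> hcls v = hcls (\<lambda>n. u n \<oplus> v n)"
  by (simp add: gr_def hcls_def gr_comp_eq cosets_simps fseq_F_closed fun_eq_iff)

lemma gr_zero: "\<zero>\<^bsub>gr U F\<^esub> = hcls (\<lambda>n. \<zero>)"
  by (simp add: gr_def hcls_def gr_comp_eq cosets_simps fun_eq_iff)

lemma gr_abelian_group: "abelian_group (gr U F)"
proof (rule abelian_groupI)
  show "\<zero>\<^bsub>gr U F\<^esub> \<in> carrier (gr U F)"
    unfolding gr_zero carrier_gr using fseq_zero by blast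
  fix x assume "x \<in> carrier (gr U F)"
  then obtain u where u: "u \<in> fseq F" "x = hcls u"
    unfolding carrier_gr by blast
  show "\<zero>\<^bsub>gr U F\<^esub> \<oplus>\<^bsub>gr U F\<^esub> x = x"
    using u fseq_F_closed[OF u(1)] by (simp add: gr_zero gr_add fseq_zero)
  have "hcls (\<lambda>n. \<ominus> u n) \<oplus>\<^bsub>gr U F\<^esub> x = \<zero>\<^bsub>gr U F\<^esub>"
    using u fseq_F_closed[OF u(1)] by (simp add: gr_zero gr_add fseq_neg l_neg)
  then show "\<exists>y\<in>carrier (gr U F). y \<oplus>\<^bsub>gr U F\<^esub> x = \<zero>\<^bsub>gr U F\<^esub>"
    unfolding carrier_gr using fseq_neg[OF u(1)] by blast
  fix y assume "y \<in> carrier (gr U F)"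
  then obtain v where v: "v \<in> fseq F" "y = hcls v"
    unfolding carrier_gr by blast
  show "x \<oplus>\<^bsub>gr U F\<^esub> y \<in> carrier (gr U F)"
    unfolding u(2) v(2) gr_add[OF u(1) v(1)] carrier_gr using fseq_add[OF u(1) v(1)] by blast
  show "x \<oplus>\<^bsub>gr U F\<^esub> y = y \<oplus>\<^bsub>gr U F\<^esub> x"
    using u v fseq_F_closed[OF u(1)] fseq_F_closed[OF v(1)] by (simp add: gr_add a_comm)
  fix z assume "z \<in> carrier (gr U F)"
  then obtain w where w: "w \<in> fseq F" "z = hcls w"
    unfolding carrier_gr by blast
  show "(x \<oplus>\<^bsub>gr U F\<^esub> y) \<oplus>\<^bsub>gr U F\<^esub> z = x \<oplus>\<^bsub>gr U F\<^esub> (y \<oplus>\<^bsub>gr U F\<^esub> z)"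
    using u v w fseq_F_closed[OF u(1)] fseq_F_closed[OF v(1)] fseq_F_closed[OF w(1)]
    by (simp add: gr_add fseq_add a_assoc)
qed

lemma gr_neg:
  assumes u: "u \<in> fseq F"
  shows "\<ominus>\<^bsub>gr U F\<^esub> hcls u = hcls (\<lambda>n. \<ominus> u n)"
proof -
  interpret G: abelian_group "gr U F"
    by (rule gr_abelian_group)
  have "hcls (\<lambda>n. \<ominus> u n) \<oplus>\<^bsub>gr U F\<^esub> hcls u = \<zero>\<^bsub>gr U F\<^esub>"
    using u fseq_F_closed[OF u] by (simp add: gr_zero gr_add fseq_neg l_neg)
  moreover have "hcls u \<in> carrier (gr U F)" "hcls (\<lambda>n. \<ominus> u n) \<in> carrier (gr U F)"
    unfolding carrier_gr using u fseq_neg[OF u] by blast+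
  ultimately show ?thesis
    by (rule G.minus_equality)
qed

lemma gr_finsum:
  assumes "finite A" "\<And>j. j \<in> A \<Longrightarrow> u j \<in> fseq F"
  shows "(\<lambda>n. \<Oplus>j\<in>A. u j n) \<in> fseq F"
    and "(\<Oplus>\<^bsub>gr U F\<^esub>j\<in>A. hcls (u j)) = hcls (\<lambda>n. \<Oplus>j\<in>A. u j n)"
proof -
  interpret G: abelian_group "gr U F"
    by (rule gr_abelian_group)
  have "(\<lambda>n. \<Oplus>j\<in>A. u j n) \<in> fseq F \<and> (\<Oplus>\<^bsub>gr U F\<^esub>j\<in>A. hcls (u j)) = hcls (\<lambda>n. \<Oplus>j\<in>A. u j n)"
    using assms
  proof (induction A rule: finite_induct)
    case empty
    then show ?case
      by (simp add: fseq_zero gr_zero)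
  next
    case (insert i A)
    have cl: "u j n \<in> carrier U" if "j \<in> insert i A" for j n
      using fseq_F_closed insert.prems that by blast
    then have eq: "(\<Oplus>j\<in>insert i A. u j n) = u i n \<oplus> (\<Oplus>j\<in>A. u j n)" for n
      using insert.hyps by (intro finsum_insert) auto
    have "hcls (u j) \<in> carrier (gr U F)" if "j \<in> insert i A" for j
      unfolding carrier_gr using insert.prems that by blast
    then have "(\<Oplus>\<^bsub>gr U F\<^esub>j\<in>insert i A. hcls (u j)) = hcls (u i) \<oplus>\<^bsub>gr U F\<^esub> (\<Oplus>\<^bsub>gr U F\<^esub>j\<in>A. hcls (u j))"
      using insert.hyps by (intro G.finsum_insert) auto
    then show ?case
      using insert unfolding eq by (simp add: gr_add fseq_add)
  qed
  then show "(\<lambda>n. \<Oplus>j\<in>A. u j n) \<in> fseq F"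
    and "(\<Oplus>\<^bsub>gr U F\<^esub>j\<in>A. hcls (u j)) = hcls (\<lambda>n. \<Oplus>j\<in>A. u j n)"
    by blast+
qed

text \<open>For other representatives, \<open>a' b' - a b = (a' - a) b' + a (b' - b)\<close>, and
  both terms lie in the filtration step \<open>n - 1\<close>; for the first one, \<open>b'\<close>
  still lies in \<open>F j\<close>.\<close>

lemma rcoset_mult_cls:
  assumes "a \<in> F i" "b \<in> F j" "i + j = n"
  shows "rcoset_mult U (filt U F (int n - 1)) (cls i a) (cls j b) = cls n (a \<otimes> b)"
proof -
  have ab: "a \<in> carrier U" "b \<in> carrier U"
    using assms F_closed by blast+
  have *: "cls n (a' \<otimes> b') = cls n (a \<otimes> b)" if a': "a' \<in> cls i a" and b': "b' \<in> cls j b" for a' b'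
  proof -
    have cl: "a' \<in> carrier U" "b' \<in> carrier U"
      using a' b' a_r_coset_subset_G[OF additive_subgroup.a_subset[OF filt_subgroup]] ab
      unfolding cls_def by blast+
    have "(a' \<ominus> a) \<otimes> b' \<in> filt U F (int i - 1 + int j)"
    proof (rule filt_mult)
      show "a' \<ominus> a \<in> filt U F (int i - 1)"
        using a' mem_cls_iff ab cl by blast
      have "b' \<ominus> b \<in> filt U F (int j)"
        using b' mem_cls_iff[OF ab(2) cl(2)] filt_mono[of "int j - 1" "int j"] by auto
      moreover have "b' = (b' \<ominus> b) \<oplus> b"
        using ab cl by algebra
      ultimately show "b' \<in> filt U F (int j)"
        using filt_add[of "b' \<ominus> b" "int j" b] assms(2) by (simp add: filt_nat)
    qed
    moreover have "a \<otimes> (b' \<ominus> b) \<in> filt U F (int i + (int j - 1))"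
    proof (rule filt_mult)
      show "a \<in> filt U F (int i)"
        using assms(1) by (simp add: filt_nat)
      show "b' \<ominus> b \<in> filt U F (int j - 1)"
        using b' mem_cls_iff ab cl by blast
    qed
    moreover have "int i - 1 + int j = int n - 1" "int i + (int j - 1) = int n - 1"
      using assms(3) by simp_all
    ultimately have "(a' \<ominus> a) \<otimes> b' \<oplus> a \<otimes> (b' \<ominus> b) \<in> filt U F (int n - 1)"
      by (metis filt_add)
    moreover have "(a' \<ominus> a) \<otimes> b' \<oplus> a \<otimes> (b' \<ominus> b) = a' \<otimes> b' \<ominus> a \<otimes> b"
      using ab cl by algebra
    ultimately show ?thesis
      using cls_eq_iff[of "a' \<otimes> b'" "a \<otimes> b" n] ab cl by simp
  qed
  have "a \<in> cls i a" "b \<in> cls j b"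
    using mem_cls_iff ab filt_zero by (simp_all add: a_minus_def r_neg)
  then have "(\<Union>a'\<in>cls i a. \<Union>b'\<in>cls j b. cls n (a' \<otimes> b')) = cls n (a \<otimes> b)"
    using * by (intro SUP_eq_const) blast+
  then show ?thesis
    by (simp add: rcoset_mult_def cls_def)
qed

text \<open>The product, on representatives, with a homogeneous right factor of degree
  \<open>d\<close>: degree \<open>n - d\<close> moves to degree \<open>n\<close>, and degrees below
  \<open>d\<close> receive nothing. It is used with the \<open>h j\<close> as well as with the
  \<open>g j\<close>.\<close>

definition shift_mult :: "nat \<Rightarrow> 'u \<Rightarrow> (nat \<Rightarrow> 'u) \<Rightarrow> nat \<Rightarrow> 'u" where
  "shift_mult d y u n = (if d \<le> n then u (n - d) \<otimes> y else \<zero>)"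

lemma shift_mult_fseq:
  assumes u: "u \<in> fseq F" and y: "y \<in> F d"
  shows "shift_mult d y u \<in> fseq F"
proof (rule fseqI[where A = "(+) d ` {n. u n \<noteq> \<zero>}"])
  show "shift_mult d y u n \<in> F n" for n
    using F_mult[of "u (n - d)" "n - d" y d] u y filt_zero[of "int n"]
    by (auto simp: shift_mult_def fseq_def filt_nat)
  show "finite ((+) d ` {n. u n \<noteq> \<zero>})"
    using u by (simp add: fseq_def)
  show "shift_mult d y u n = \<zero>" if n: "n \<notin> (+) d ` {n. u n \<noteq> \<zero>}" for n
  proof (cases "d \<le> n")
    case True
    then have "n = d + (n - d)"
      by simp
    then have "u (n - d) = \<zero>"
      using n by blast
    then show ?thesis
      using F_closed[OF y] by (simp add: shift_mult_def)
  qed (simp add: shift_mult_def)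
qed

lemma gr_symbol_eq:
  assumes "filt_deg U F y = Fin d"
  shows "gr_symbol U F y = hcls (\<lambda>n. if n = d then y else \<zero>)"
  using assms by (auto simp: gr_symbol_def hcls_def cls_def cls_zero[unfolded cls_def] fun_eq_iff)

text \<open>The symbol is concentrated in degree \<open>d\<close>, so at most one term of the
  convolution defining the product is nontrivial, the one with \<open>i = n - d\<close>.\<close>

lemma gr_mult_symbol:
  assumes u: "u \<in> fseq F" and y: "y \<in> carrier U" "filt_deg U F y = Fin d"
  shows "hcls u \<otimes>\<^bsub>gr U F\<^esub> gr_symbol U F y = hcls (shift_mult d y u)"
proof -
  have yd: "y \<in> F d"
    using y by (rule filt_deg_mem)
  define s where "s n = (if n = d then y else \<zero>)" for n
  have s: "s n \<in> F n" for n
    using yd filt_zero[of "int n"] by (simp add: s_def filt_nat)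
  have "gr_mult U F (hcls u) (hcls s) n = cls n (shift_mult d y u n)" for n
  proof -
    interpret C: comm_group "cosets n (F n)"
      by (rule cosets_comm_group[OF F_subgroup])
    have us: "u i \<in> F i" "u i \<in> carrier U" "s i \<in> carrier U" for i
      using u s[of i] F_closed fseq_F_closed[OF u] by (auto simp: fseq_def)
    have in_F: "u i \<otimes> s (n - i) \<in> F n" if "i \<le> n" for i
      using F_mult[OF us(1) s, of i "n - i"] that by simp
    then have prods: "(\<lambda>i. cls n (u i \<otimes> s (n - i))) \<in> {..n} \<rightarrow> carrier (cosets n (F n))"
      by (auto simp: cosets_simps(1))
    have "gr_mult U F (hcls u) (hcls s) n = finprod (cosets n (F n))
        (\<lambda>i. rcoset_mult U (filt U F (int n - 1)) (cls i (u i)) (cls (n - i) (s (n - i)))) {..n}"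
      by (simp add: gr_mult_def gr_comp_eq hcls_def)
    also have "\<dots> = finprod (cosets n (F n)) (\<lambda>i. cls n (u i \<otimes> s (n - i))) {..n}"
    proof (rule C.finprod_cong')
      show "rcoset_mult U (filt U F (int n - 1)) (cls i (u i)) (cls (n - i) (s (n - i))) =
          cls n (u i \<otimes> s (n - i))" if "i \<in> {..n}" for i
        using rcoset_mult_cls[OF us(1) s, of i "n - i" n] that by simp
    qed (use prods in auto)
    also have "\<dots> = cls n (shift_mult d y u n)"
    proof (cases "d \<le> n")
      case True
      have "finprod (cosets n (F n)) (\<lambda>i. cls n (u i \<otimes> s (n - i))) {..n} =
        finprod (cosets n (F n))
          (\<lambda>i. if n - d = i then cls n (u i \<otimes> s (n - i)) else \<one>\<^bsub>cosets n (F n)\<^esub>) {..n}"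
      proof (rule C.finprod_cong')
        show "cls n (u i \<otimes> s (n - i)) =
            (if n - d = i then cls n (u i \<otimes> s (n - i)) else \<one>\<^bsub>cosets n (F n)\<^esub>)" if "i \<in> {..n}" for i
          using that True us(2)[of i] by (auto simp: s_def cosets_simps(2))
      qed (use prods in auto)
      also have "\<dots> = cls n (u (n - d) \<otimes> s (n - (n - d)))"
        using prods by (intro C.finprod_singleton) auto
      finally show ?thesis
        using True by (simp add: shift_mult_def s_def)
    next
      case False
      have "finprod (cosets n (F n)) (\<lambda>i. cls n (u i \<otimes> s (n - i))) {..n} = \<one>\<^bsub>cosets n (F n)\<^esub>"
        using False us(2) by (intro C.finprod_one_eqI) (auto simp: s_def cosets_simps(2))
      then show ?thesis
        using False by (simp add: shift_mult_def cosets_simps(2))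
    qed
    finally show ?thesis .
  qed
  then show ?thesis
    unfolding gr_symbol_eq[OF y(2)] s_def[abs_def, symmetric]
    by (simp add: gr_def hcls_def[of "shift_mult d y u"] fun_eq_iff)
qed

text \<open>Adding the lower filtration step to \<open>I \<inter> F n\<close> creates no new cosets,
  so each component has a representative in \<open>I\<close> itself.\<close>

lemma gr_ideal_eq:
  assumes I: "additive_subgroup I U"
  shows "gr_ideal U F I = hcls ` fseq (\<lambda>n. I \<inter> F n)"
proof -
  let ?D = "\<lambda>n. (I \<inter> F n) <+>\<^bsub>U\<^esub> filt U F (int n - 1)"
  have IF: "additive_subgroup (I \<inter> F n) U" for n
    using I F_subgroup[of n] subgroup_Int unfolding additive_subgroup_def by blast
  have "cls n ` (I \<inter> F n) = cls n ` ?D n" for n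
  proof -
    have "x \<oplus> \<zero> = x" if "x \<in> I \<inter> F n" for x
      using that F_closed by auto
    then have "x \<in> ?D n" if "x \<in> I \<inter> F n" for x
      using that filt_zero[of "int n - 1"] unfolding set_add_def' by force
    moreover have "cls n x \<in> cls n ` (I \<inter> F n)" if x: "x \<in> ?D n" for x
    proof -
      obtain a b where ab: "a \<in> I \<inter> F n" "b \<in> filt U F (int n - 1)" "x = a \<oplus> b"
        using x unfolding set_add_def' by blast
      have "a \<in> carrier U" "b \<in> carrier U"
        using ab F_closed filt_closed by blast+
      moreover from this have "x \<ominus> a = b"
        unfolding ab(3) by algebra
      ultimately have "cls n x = cls n a"
        using cls_eq_iff[of x a n] ab(2,3) by simp
      then show ?thesis
        using ab(1) by blast
    qed
    ultimately show ?thesis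
      by blast
  qed
  moreover have "additive_subgroup (?D n) U" for n
  proof -
    have "subgroup ((I \<inter> F n) <#>\<^bsub>add_monoid U\<^esub> filt U F (int n - 1)) (add_monoid U)"
      using IF[of n] filt_subgroup[of "int n - 1"] unfolding additive_subgroup_def
      by (intro comm_group.mult_subgroups[OF a_comm_group])
    then show ?thesis
      unfolding additive_subgroup_def set_add_def .
  qed
  moreover have "\<zero> \<in> I \<inter> F n" for n
    by (rule additive_subgroup.zero_closed[OF IF])
  ultimately have "carrier (sum_group UNIV (\<lambda>n. cosets n (?D n))) = hcls ` fseq (\<lambda>n. I \<inter> F n)"
    by (intro carrier_sum_cosets)
  then show ?thesis
    by (simp add: gr_ideal_def cosets_def)
qed

end

section \<open>Koszul complexes\<close>

lemma koszul_index_simps: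
  "koszul_index t 0 = {{}}" "koszul_index t (-1) = {}" "koszul_index t 1 = (\<lambda>j. {j}) ` {1..t}"
proof -
  have "J = {}" if "J \<subseteq> {1..t}" "card J = 0" for J
    using that finite_subset[OF that(1)] by simp
  then show "koszul_index t 0 = {{}}"
    by (auto simp: koszul_index_def)
  show "koszul_index t (-1) = {}"
    by (auto simp: koszul_index_def)
  show "koszul_index t 1 = (\<lambda>j. {j}) ` {1..t}"
    by (auto simp: koszul_index_def card_1_singleton_iff)
qed

text \<open>All signs are trivial, as no index of the empty set precedes \<open>j\<close>. The
  setting, an abelian group with right multiplications by the \<open>g j\<close>, is the structure
  that is established on \<open>gr U F\<close>.\<close>

lemma (in abelian_group) koszul_diff_1:
  assumes "\<And>x j. x \<in> carrier G \<Longrightarrow> j \<in> {1..t} \<Longrightarrow> x \<otimes> g j \<in> carrier G"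
    and "c \<in> carrier (koszul G t 1)"
  shows "koszul_diff G g t 1 c = (\<lambda>J\<in>{{}}. \<Oplus>j\<in>{1..t}. c {j} \<otimes> g j)"
proof -
  have "c {j} \<in> carrier G" if "j \<in> {1..t}" for j
    using assms(2) that by (auto simp: koszul_def koszul_index_simps)
  then have "add_pow G (1::int) (c {j} \<otimes> g j) = c {j} \<otimes> g j" "c {j} \<otimes> g j \<in> carrier G"
    if "j \<in> {1..t}" for j
    using assms(1) that add.int_pow_1 by auto
  then have "(\<Oplus>j\<in>{1..t}. add_pow G (1::int) (c {j} \<otimes> g j)) = (\<Oplus>j\<in>{1..t}. c {j} \<otimes> g j)"
    by (intro finsum_cong') auto
  then show ?thesis
    by (auto simp: koszul_diff_def koszul_index_simps)
qed

lemma (in abelian_group) koszul_group: "group (koszul G t i)"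
  unfolding koszul_def by (rule product_group) (rule a_group)

text \<open>Vanishing homology makes the cycle with coefficients \<open>a j\<close> a boundary, read
  here on the index sets \<open>{i}\<close>. The sign is -1 exactly for \<open>i < j\<close>, so
  \<open>b {i, j}\<close> enters \<open>a i\<close> and \<open>a j\<close> with opposite signs: this
  is the antisymmetric matrix.\<close>

lemma (in abelian_group) koszul_H1_trivial:
  assumes mult: "\<And>x j. x \<in> carrier G \<Longrightarrow> j \<in> {1..t} \<Longrightarrow> x \<otimes> g j \<in> carrier G"
    and zero_mult: "\<And>j. j \<in> {1..t} \<Longrightarrow> \<zero> \<otimes> g j = \<zero>"
    and H1: "trivial_group (koszul_homology G g t 1)"
    and a: "\<And>j. j \<in> {1..t} \<Longrightarrow> a j \<in> carrier G" "(\<Oplus>j\<in>{1..t}. a j \<otimes> g j) = \<zero>"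
  shows "\<exists>b. (\<forall>J\<in>koszul_index t 2. b J \<in> carrier G) \<and>
    (\<forall>i\<in>{1..t}. a i = (\<Oplus>j\<in>{1..t} - {i}. add_pow G ((-1::int) ^ card {l \<in> {i}. l < j}) (b {i, j} \<otimes> g j)))"
proof -
  let ?K = "koszul G t" and ?d = "koszul_diff G g t"
  define c where "c = (\<lambda>J\<in>koszul_index t 1. a (the_elem J))"
  have c_sing: "c {j} = a j" if "j \<in> {1..t}" for j
    using that by (simp add: c_def koszul_index_simps)
  have c: "c \<in> carrier (?K 1)"
    using a(1) by (auto simp: c_def koszul_def koszul_index_simps)
  have d1: "?d 1 c = (\<lambda>J\<in>{{}}. \<Oplus>j\<in>{1..t}. c {j} \<otimes> g j)" if "c \<in> carrier (?K 1)" for c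
    by (rule koszul_diff_1) (use mult that in auto)
  have "(\<Oplus>j\<in>{1..t}. c {j} \<otimes> g j) = (\<Oplus>j\<in>{1..t}. a j \<otimes> g j)"
    using c_sing mult a(1) by (intro finsum_cong') auto
  then have "?d 1 c = \<one>\<^bsub>?K 0\<^esub>"
    unfolding d1[OF c] a(2) by (simp add: koszul_def koszul_index_simps)
  then have c_ker: "c \<in> kernel (?K 1) (?K (1 - 1)) (?d 1)"
    using c by (simp add: kernel_def)
  let ?B = "?d (1 + 1) ` carrier (?K (1 + 1))"
  have "?B #>\<^bsub>?K 1\<^esub> c \<in> carrier (koszul_homology G g t 1)"
    using c_ker by (auto simp: koszul_homology_def FactGroup_def RCOSETS_def r_coset_def)
  then have coset: "?B #>\<^bsub>?K 1\<^esub> c = ?B"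
    using H1 by (simp add: trivial_group_def koszul_homology_def FactGroup_def)
  \<comment> \<open>Triviality of the quotient says that the coset of \<open>c\<close> equals the
    image \<open>?B\<close>. As zero is a boundary, \<open>c\<close> itself lies in that coset and
    hence in \<open>?B\<close>.\<close>
  have "?d (1 + 1) \<one>\<^bsub>?K (1 + 1)\<^esub> = \<one>\<^bsub>?K 1\<^esub>"
  proof
    fix J
    show "?d (1 + 1) \<one>\<^bsub>?K (1 + 1)\<^esub> J = \<one>\<^bsub>?K 1\<^esub> J"
    proof (cases "J \<in> koszul_index t 1")
      case True
      have "(\<Oplus>j\<in>{1..t} - J. add_pow G ((-1::int) ^ card {l \<in> J. l < j})
          (\<one>\<^bsub>?K (1 + 1)\<^esub> (insert j J) \<otimes> g j)) = (\<Oplus>j\<in>{1..t} - J. \<zero>)"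
      proof (rule finsum_cong')
        fix j assume j: "j \<in> {1..t} - J"
        then have "insert j J \<in> koszul_index t (1 + 1)"
          using True by (auto simp: koszul_index_def finite_subset[of J "{1..t}"])
        then show "add_pow G ((-1::int) ^ card {l \<in> J. l < j}) (\<one>\<^bsub>?K (1 + 1)\<^esub> (insert j J) \<otimes> g j) = \<zero>"
          using zero_mult j add.int_pow_one by (simp add: koszul_def)
      qed auto
      then show ?thesis
        using True by (simp add: koszul_diff_def koszul_def)
    next
      case False
      then show ?thesis
        by (simp add: koszul_diff_def koszul_def)
    qed
  qed
  then have "\<one>\<^bsub>?K 1\<^esub> \<in> ?B"
    using monoid.one_closed[OF group.is_monoid[OF koszul_group, of t "1 + 1"]] by force
  moreover have "\<one>\<^bsub>?K 1\<^esub> \<otimes>\<^bsub>?K 1\<^esub> c = c"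
    using c by (rule monoid.l_one[OF group.is_monoid[OF koszul_group]])
  ultimately have "c \<in> ?B"
    using coset unfolding r_coset_def by blast
  then obtain b where b: "b \<in> carrier (?K 2)" "c = ?d 2 b"
    by auto
  have "b J \<in> carrier G" if "J \<in> koszul_index t 2" for J
    using b(1) that by (auto simp: koszul_def)
  moreover have "a i = (\<Oplus>j\<in>{1..t} - {i}. add_pow G ((-1::int) ^ card {l \<in> {i}. l < j}) (b {i, j} \<otimes> g j))"
    if i: "i \<in> {1..t}" for i
  proof -
    have "a i = ?d 2 b {i}"
      using c_sing[OF i] b(2) by simp
    then show ?thesis
      using i by (simp add: koszul_diff_def koszul_index_simps insert_commute)
  qed
  ultimately show ?thesis
    by blast
qed

text \<open>In degree 0 the complex is one copy of \<open>G\<close> consisting of cycles, and the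
  boundaries are the elements of \<open>left_sum\<close>. The contrapositive turns nonvanishing of
  the homology in degree 0 into properness.\<close>

lemma (in abelian_group) left_sum_eq_carrier_imp_koszul_H0_trivial:
  assumes mult: "\<And>x j. x \<in> carrier G \<Longrightarrow> j \<in> {1..t} \<Longrightarrow> x \<otimes> g j \<in> carrier G"
    and eq: "left_sum G (\<lambda>_. carrier G) g t = carrier G"
  shows "trivial_group (koszul_homology G g t 0)"
proof -
  let ?K = "koszul G t" and ?d = "koszul_diff G g t"
  interpret K0: group "?K 0"
    by (rule koszul_group)
  have carrier_K0: "carrier (?K 0) = (\<lambda>x. \<lambda>J\<in>{{}}. x) ` carrier G"
  proof (intro equalityI subsetI)
    fix c assume c: "c \<in> carrier (?K 0)"
    then have "c = (\<lambda>J\<in>{{}}. c {})" "c {} \<in> carrier G"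
      by (auto simp: koszul_def koszul_index_simps PiE_def extensional_def fun_eq_iff)
    then show "c \<in> (\<lambda>x. \<lambda>J\<in>{{}}. x) ` carrier G"
      by blast
  qed (auto simp: koszul_def koszul_index_simps split: if_splits)
  have d1: "?d 1 c = (\<lambda>J\<in>{{}}. \<Oplus>j\<in>{1..t}. c {j} \<otimes> g j)" if "c \<in> carrier (?K 1)" for c
    by (rule koszul_diff_1) (use mult that in auto)
  have "?d 0 c = \<one>\<^bsub>?K (-1)\<^esub>" for c
    by (simp add: koszul_diff_def koszul_def koszul_index_simps restrict_def)
  then have ker: "kernel (?K 0) (?K (0 - 1)) (?d 0) = carrier (?K 0)"
    by (simp add: kernel_def)
  have im: "?d (0 + 1) ` carrier (?K (0 + 1)) = carrier (?K 0)"
  proof (intro equalityI subsetI)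
    fix y assume "y \<in> ?d (0 + 1) ` carrier (?K (0 + 1))"
    then obtain c where c: "c \<in> carrier (?K 1)" "y = ?d 1 c"
      by auto
    have "c {j} \<in> carrier G" if "j \<in> {1..t}" for j
      using c(1) that by (auto simp: koszul_def koszul_index_simps)
    then have "(\<Oplus>j\<in>{1..t}. c {j} \<otimes> g j) \<in> carrier G"
      using mult by (intro finsum_closed) auto
    then show "y \<in> carrier (?K 0)"
      unfolding carrier_K0 c(2) d1[OF c(1)] by blast
  next
    fix y assume "y \<in> carrier (?K 0)"
    then obtain x where x: "x \<in> carrier G" "y = (\<lambda>J\<in>{{}}. x)"
      unfolding carrier_K0 by blast
    then obtain a where a: "a \<in> {1..t} \<rightarrow> carrier G" "x = (\<Oplus>i\<in>{1..t}. a i \<otimes> g i)"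
      using eq unfolding left_sum_def by blast
    define c where "c = (\<lambda>J\<in>koszul_index t 1. a (the_elem J))"
    have c: "c \<in> carrier (?K 1)"
      using a(1) by (auto simp: c_def koszul_def koszul_index_simps)
    have "(\<Oplus>j\<in>{1..t}. c {j} \<otimes> g j) = x"
      unfolding a(2) using mult a(1)
      by (intro finsum_cong') (auto simp: c_def koszul_index_simps Pi_def)
    then have "y = ?d 1 c"
      unfolding d1[OF c] x(2) by simp
    then show "y \<in> ?d (0 + 1) ` carrier (?K (0 + 1))"
      using c by simp
  qed
  have H0: "koszul_homology G g t 0 = ?K 0 Mod carrier (?K 0)"
    unfolding koszul_homology_def ker im by simp
  have "carrier (?K 0 Mod carrier (?K 0)) \<subseteq> {carrier (?K 0)}"
    using K0.coset_join2[OF _ K0.subgroup_self] by (auto simp: FactGroup_def RCOSETS_def)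
  moreover have "comm_group (?K 0)"
    by (rule K0.group_comm_groupI)
      (auto simp: koszul_def koszul_index_simps fun_eq_iff restrict_def intro: a_comm)
  then have "group (?K 0 Mod carrier (?K 0))"
    using comm_group.abelian_FactGroup[OF _ K0.subgroup_self] by (simp add: comm_group_def)
  ultimately show ?thesis
    unfolding H0 by (simp add: group.trivial_group_subset FactGroup_def)
qed

text \<open>A new index adds a row and a column that cancel termwise. The diagonal has its own
  hypothesis because \<open>f i i \<oplus> f i i = \<zero>\<close> does not force
  \<open>f i i = \<zero>\<close> in the presence of 2-torsion.\<close>

lemma (in abelian_group) finsum_antisymmetric:
  assumes "finite A" "\<And>i j. i \<in> A \<Longrightarrow> j \<in> A \<Longrightarrow> f i j \<in> carrier G"
    and "\<And>i j. i \<in> A \<Longrightarrow> j \<in> A \<Longrightarrow> f i j \<oplus> f j i = \<zero>" and "\<And>i. i \<in> A \<Longrightarrow> f i i = \<zero>"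
  shows "(\<Oplus>i\<in>A. \<Oplus>j\<in>A. f i j) = \<zero>"
  using assms
proof (induction A rule: finite_induct)
  case empty
  then show ?case
    by simp
next
  case (insert k A)
  have cl: "f i j \<in> carrier G" if "i \<in> insert k A" "j \<in> insert k A" for i j
    using insert.prems(1) that by blast
  have inner: "(\<Oplus>j\<in>insert k A. f i j) = f i k \<oplus> (\<Oplus>j\<in>A. f i j)" if "i \<in> insert k A" for i
    using insert.hyps cl that by (intro finsum_insert) auto
  have cl': "(\<Oplus>j\<in>A. f i j) \<in> carrier G" if "i \<in> insert k A" for i
    using cl that by (intro finsum_closed) auto
  have "(\<Oplus>i\<in>insert k A. \<Oplus>j\<in>insert k A. f i j) =
      (\<Oplus>j\<in>insert k A. f k j) \<oplus> (\<Oplus>i\<in>A. \<Oplus>j\<in>insert k A. f i j)"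
    using insert.hyps cl cl' inner by (intro finsum_insert) auto
  also have "(\<Oplus>i\<in>A. \<Oplus>j\<in>insert k A. f i j) = (\<Oplus>i\<in>A. f i k \<oplus> (\<Oplus>j\<in>A. f i j))"
    using cl cl' inner by (intro finsum_cong') auto
  also have "\<dots> = (\<Oplus>i\<in>A. f i k) \<oplus> (\<Oplus>i\<in>A. \<Oplus>j\<in>A. f i j)"
    using cl cl' by (intro finsum_addf) auto
  also have "(\<Oplus>i\<in>A. \<Oplus>j\<in>A. f i j) = \<zero>"
    using insert by simp
  also have "(\<Oplus>j\<in>insert k A. f k j) = (\<Oplus>j\<in>A. f k j)"
    using inner[of k] insert.prems(3)[of k] cl'[of k] by simp
  also have "(\<Oplus>j\<in>A. f k j) \<oplus> ((\<Oplus>i\<in>A. f i k) \<oplus> \<zero>) = (\<Oplus>j\<in>A. f k j \<oplus> f j k)"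
  proof -
    have "(\<Oplus>i\<in>A. f i k) \<in> carrier G"
      using cl by (intro finsum_closed) auto
    moreover have "(\<Oplus>j\<in>A. f k j \<oplus> f j k) = (\<Oplus>j\<in>A. f k j) \<oplus> (\<Oplus>j\<in>A. f j k)"
      using cl by (intro finsum_addf) auto
    ultimately show ?thesis
      by simp
  qed
  also have "\<dots> = (\<Oplus>j\<in>A. \<zero>)"
    using insert.prems(2) by (intro finsum_cong') auto
  also have "\<dots> = \<zero>"
    by simp
  finally show ?case .
qed

section \<open>Deformations of complete intersections\<close>

lemma (in ring) left_ideal_left_sum:
  assumes x: "x \<in> {1..t} \<rightarrow> carrier R"
  shows "left_ideal R (left_sum R (\<lambda>_. carrier R) x t)"
proof (rule left_idealI)
  let ?S = "left_sum R (\<lambda>_. carrier R) x t"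
  have xj: "x j \<in> carrier R" if "j \<in> {1..t}" for j
    using x that by blast
  have SI: "(\<Oplus>i\<in>{1..t}. a i \<otimes> x i) \<in> ?S" if "\<And>i. i \<in> {1..t} \<Longrightarrow> a i \<in> carrier R" for a
    unfolding left_sum_def using that by blast
  have "(\<Oplus>i\<in>{1..t}. \<zero> \<otimes> x i) = (\<Oplus>i\<in>{1..t}. \<zero>)"
    using xj by (intro finsum_cong') auto
  then show "\<zero> \<in> ?S"
    using SI[of "\<lambda>_. \<zero>"] by simp
  fix y assume "y \<in> ?S"
  then obtain a where a: "\<And>i. i \<in> {1..t} \<Longrightarrow> a i \<in> carrier R" "y = (\<Oplus>i\<in>{1..t}. a i \<otimes> x i)"
    unfolding left_sum_def by blast
  show "c \<otimes> y \<in> ?S" if c: "c \<in> carrier R" for c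
  proof -
    have "c \<otimes> y = (\<Oplus>i\<in>{1..t}. c \<otimes> (a i \<otimes> x i))"
      unfolding a(2) using a(1) c xj by (intro finsum_rdistr) auto
    also have "\<dots> = (\<Oplus>i\<in>{1..t}. (c \<otimes> a i) \<otimes> x i)"
      using a(1) c xj by (intro finsum_cong') (auto simp: m_assoc)
    finally show ?thesis
      using SI[of "\<lambda>i. c \<otimes> a i"] a(1) c by simp
  qed
  fix z assume "z \<in> ?S"
  then obtain b where b: "\<And>i. i \<in> {1..t} \<Longrightarrow> b i \<in> carrier R" "z = (\<Oplus>i\<in>{1..t}. b i \<otimes> x i)"
    unfolding left_sum_def by blast
  have "y \<oplus> z = (\<Oplus>i\<in>{1..t}. a i \<otimes> x i \<oplus> b i \<otimes> x i)"
    unfolding a(2) b(2) using a(1) b(1) xj by (intro finsum_addf[symmetric]) auto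
  also have "\<dots> = (\<Oplus>i\<in>{1..t}. (a i \<oplus> b i) \<otimes> x i)"
    using a(1) b(1) xj by (intro finsum_cong') (auto simp: l_distr)
  finally show "y \<oplus> z \<in> ?S"
    using SI[of "\<lambda>i. a i \<oplus> b i"] a(1) b(1) by simp
next
  show "left_sum R (\<lambda>_. carrier R) x t \<subseteq> carrier R"
  proof
    fix y assume "y \<in> left_sum R (\<lambda>_. carrier R) x t"
    then obtain a where a: "a \<in> {1..t} \<rightarrow> carrier R" "y = (\<Oplus>i\<in>{1..t}. a i \<otimes> x i)"
      unfolding left_sum_def by blast
    show "y \<in> carrier R"
      unfolding a(2) using a(1) x by (intro finsum_closed) (auto simp: Pi_def)
  qed
qed

text \<open>\<open>h j\<close> stands for \<open>g j\<close> minus a term of lower degree. That term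
  is left open because three choices occur: the given \<open>\<mu> j\<close>, zero, and the scalars
  prescribed by a character.\<close>

locale koszul_deformation = filtered_ring U F for U :: "('k, 'u, 'm) module_scheme" (structure) and F +
  fixes t :: nat and d :: "nat \<Rightarrow> nat" and g h :: "nat \<Rightarrow> 'u"
  assumes g_closed: "j \<in> {1..t} \<Longrightarrow> g j \<in> carrier U"
    and g_deg: "j \<in> {1..t} \<Longrightarrow> filt_deg U F (g j) = Fin (d j)"
    and ci: "complete_intersection (gr U F) (\<lambda>j. gr_symbol U F (g j)) t"
    and h_closed: "j \<in> {1..t} \<Longrightarrow> h j \<in> carrier U"
    and g_diff_h: "j \<in> {1..t} \<Longrightarrow> g j \<ominus> h j \<in> filt U F (int (d j) - 1)"
    and h_comm: "i \<in> {1..t} \<Longrightarrow> j \<in> {1..t} \<Longrightarrow> h i \<otimes> h j = h j \<otimes> h i"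
begin

lemma g_F: "j \<in> {1..t} \<Longrightarrow> g j \<in> F (d j)"
  using filt_deg_mem g_closed g_deg by blast

lemma h_filt:
  assumes j: "j \<in> {1..t}"
  shows "h j \<in> filt U F (int (d j))"
proof -
  have "g j \<ominus> h j \<in> filt U F (int (d j))"
    using g_diff_h[OF j] filt_mono[of "int (d j) - 1" "int (d j)"] by auto
  then have "g j \<ominus> (g j \<ominus> h j) \<in> filt U F (int (d j))"
    using filt_diff[of "g j" "int (d j)" "g j \<ominus> h j"] g_F[OF j] by (simp add: filt_nat)
  moreover have "g j \<ominus> (g j \<ominus> h j) = h j"
    using g_closed[OF j] h_closed[OF j] by algebra
  ultimately show ?thesis
    by (simp only:)
qed

lemma gr_mult_g:
  assumes "u \<in> fseq F" "j \<in> {1..t}"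
  shows "hcls u \<otimes>\<^bsub>gr U F\<^esub> gr_symbol U F (g j) = hcls (shift_mult (d j) (g j) u)"
  using gr_mult_symbol assms g_closed g_deg by blast

lemma shift_mult_g_fseq: "u \<in> fseq F \<Longrightarrow> j \<in> {1..t} \<Longrightarrow> shift_mult (d j) (g j) u \<in> fseq F"
  using shift_mult_fseq g_F by blast

lemma gr_mult_g_closed:
  assumes "x \<in> carrier (gr U F)" "j \<in> {1..t}"
  shows "x \<otimes>\<^bsub>gr U F\<^esub> gr_symbol U F (g j) \<in> carrier (gr U F)"
  using assms gr_mult_g shift_mult_g_fseq unfolding carrier_gr by auto

lemma gr_zero_mult_g:
  assumes "j \<in> {1..t}"
  shows "\<zero>\<^bsub>gr U F\<^esub> \<otimes>\<^bsub>gr U F\<^esub> gr_symbol U F (g j) = \<zero>\<^bsub>gr U F\<^esub>"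
proof -
  have "shift_mult (d j) (g j) (\<lambda>n. \<zero>) = (\<lambda>n. \<zero>)"
    using g_closed[OF assms] by (auto simp: shift_mult_def)
  then show ?thesis
    using gr_mult_g[OF fseq_zero assms] by (simp add: gr_zero)
qed

text \<open>If the top-degree part of \<open>\<Sum>a\<^sub>j h\<^sub>j\<close> cancels, the symbols of the \<open>a\<^sub>j\<close> form a relation between
  the symbols of the \<open>g\<^sub>j\<close>. It comes from an antisymmetric matrix \<open>B\<close>, and replacing \<open>a\<^sub>i\<close> by
  \<open>a\<^sub>i - \<Sum>B\<^sub>i\<^sub>j h\<^sub>j\<close> lowers its degree without changing the sum, as the \<open>h\<^sub>j\<close> commute.\<close>

lemma lower_coefficients:
  assumes a: "\<And>j. j \<in> {1..t} \<Longrightarrow> a j \<in> filt U F (int N - int (d j))"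
    and sum: "(\<Oplus>j\<in>{1..t}. a j \<otimes> h j) \<in> filt U F (int N - 1)"
  shows "\<exists>a'. (\<forall>j\<in>{1..t}. a' j \<in> filt U F (int N - int (d j) - 1)) \<and>
    (\<Oplus>j\<in>{1..t}. a' j \<otimes> h j) = (\<Oplus>j\<in>{1..t}. a j \<otimes> h j)"
proof -
  interpret G: abelian_group "gr U F"
    by (rule gr_abelian_group)
  let ?T = "{1..t}"
  let ?gs = "\<lambda>j. gr_symbol U F (g j)"
  have ac: "a j \<in> carrier U" if "j \<in> ?T" for j
    using a[OF that] by (rule filt_closed)
  \<comment> \<open>The class of \<open>a j\<close> in degree \<open>N - d j\<close>, which is zero
    if \<open>a j\<close> has smaller degree. The equation \<open>n + d j = N\<close> avoids
    truncated subtraction.\<close>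
  define \<alpha> where "\<alpha> j n = (if n + d j = N then a j else \<zero>)" for j n
  have \<alpha>: "\<alpha> j \<in> fseq F" if j: "j \<in> ?T" for j
  proof (rule fseqI[where A = "{n. n + d j = N}"])
    show "\<alpha> j n \<in> F n" for n
    proof (cases "n + d j = N")
      case True
      then have "int N - int (d j) = int n"
        by simp
      then have "a j \<in> F n"
        using a[OF j] by (simp only: filt_nat)
      with True show ?thesis
        by (simp add: \<alpha>_def)
    next
      case False
      then show ?thesis
        using filt_zero[of "int n"] by (simp add: \<alpha>_def filt_nat)
    qed
    show "finite {n. n + d j = N}"
      by (rule finite_subset[of _ "{..N}"]) auto
  qed (simp add: \<alpha>_def)
  have shift_\<alpha>: "shift_mult (d j) (g j) (\<alpha> j) n = (if n = N then a j \<otimes> g j else \<zero>)" if j: "j \<in> ?T" for j n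
  proof (cases "d j \<le> n")
    case True
    then show ?thesis
      using g_closed[OF j] by (auto simp: shift_mult_def \<alpha>_def)
  next
    case False
    moreover from this have "a j = \<zero>" if "n = N"
      using a[OF j] that by (simp add: filt_def)
    ultimately show ?thesis
      using g_closed[OF j] by (auto simp: shift_mult_def)
  qed
  \<comment> \<open>Replacing \<open>h j\<close> by \<open>g j\<close> changes the sum only by
    elements of the filtration step \<open>N - 1\<close>.\<close>
  have "(\<Oplus>j\<in>?T. a j \<otimes> g j) = (\<Oplus>j\<in>?T. a j \<otimes> h j \<oplus> a j \<otimes> (g j \<ominus> h j))"
  proof (rule finsum_cong')
    fix j assume j: "j \<in> ?T"
    show "a j \<otimes> g j = a j \<otimes> h j \<oplus> a j \<otimes> (g j \<ominus> h j)"
      using ac[OF j] g_closed[OF j] h_closed[OF j] by algebra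
  qed (use ac g_closed h_closed in auto)
  also have "\<dots> = (\<Oplus>j\<in>?T. a j \<otimes> h j) \<oplus> (\<Oplus>j\<in>?T. a j \<otimes> (g j \<ominus> h j))"
    using ac g_closed h_closed by (intro finsum_addf) auto
  also have "\<dots> \<in> filt U F (int N - 1)"
  proof (intro filt_add sum filt_finsum)
    fix j assume j: "j \<in> ?T"
    show "a j \<otimes> (g j \<ominus> h j) \<in> filt U F (int N - 1)"
      using filt_mult[OF a[OF j] g_diff_h[OF j]] by simp
  qed
  finally have sum_g: "(\<Oplus>j\<in>?T. a j \<otimes> g j) \<in> filt U F (int N - 1)" .
  have "(\<Oplus>\<^bsub>gr U F\<^esub>j\<in>?T. hcls (\<alpha> j) \<otimes>\<^bsub>gr U F\<^esub> ?gs j) = (\<Oplus>\<^bsub>gr U F\<^esub>j\<in>?T. hcls (shift_mult (d j) (g j) (\<alpha> j)))"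
    using \<alpha> gr_mult_g shift_mult_g_fseq by (intro G.finsum_cong') (auto simp: carrier_gr)
  also have "\<dots> = hcls (\<lambda>n. \<Oplus>j\<in>?T. shift_mult (d j) (g j) (\<alpha> j) n)"
    using \<alpha> shift_mult_g_fseq by (intro gr_finsum(2)) auto
  also have "\<dots> = hcls (\<lambda>n. \<zero>)"
  proof -
    have "(\<Oplus>j\<in>?T. shift_mult (d j) (g j) (\<alpha> j) n) \<ominus> \<zero> \<in> filt U F (int n - 1)" for n
    proof -
      have "(\<Oplus>j\<in>?T. shift_mult (d j) (g j) (\<alpha> j) n) = (\<Oplus>j\<in>?T. if n = N then a j \<otimes> g j else \<zero>)"
        using shift_\<alpha> ac g_closed by (intro finsum_cong') auto
      then have "(\<Oplus>j\<in>?T. shift_mult (d j) (g j) (\<alpha> j) n) \<in> filt U F (int n - 1)"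
        using sum_g filt_zero by (cases "n = N") simp_all
      then show ?thesis
        using filt_diff filt_zero by blast
    qed
    moreover have "(\<lambda>n. \<Oplus>j\<in>?T. shift_mult (d j) (g j) (\<alpha> j) n) \<in> fseq F"
      using \<alpha> shift_mult_g_fseq by (intro gr_finsum(1)) auto
    ultimately show ?thesis
      by (subst hcls_eq_iff) (auto simp: fseq_zero)
  qed
  finally have rel: "(\<Oplus>\<^bsub>gr U F\<^esub>j\<in>?T. hcls (\<alpha> j) \<otimes>\<^bsub>gr U F\<^esub> ?gs j) = \<zero>\<^bsub>gr U F\<^esub>"
    by (simp add: gr_zero)
  have "trivial_group (koszul_homology (gr U F) ?gs t 1)"
    using ci by (simp add: complete_intersection_def)
  then obtain b where b: "\<And>J. J \<in> koszul_index t 2 \<Longrightarrow> b J \<in> carrier (gr U F)"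
    and \<alpha>_b: "\<And>i. i \<in> ?T \<Longrightarrow> hcls (\<alpha> i) = (\<Oplus>\<^bsub>gr U F\<^esub>j\<in>?T - {i}.
      add_pow (gr U F) ((-1::int) ^ card {l \<in> {i}. l < j}) (b {i, j} \<otimes>\<^bsub>gr U F\<^esub> ?gs j))"
    using G.koszul_H1_trivial[of t ?gs "\<lambda>j. hcls (\<alpha> j)"] gr_mult_g_closed gr_zero_mult_g rel \<alpha>
    unfolding carrier_gr by blast
  have pair: "{i, j} \<in> koszul_index t 2" if "i \<in> ?T" "j \<in> ?T" "i \<noteq> j" for i j
    using that by (simp add: koszul_index_def)
  have "\<forall>J. \<exists>u. J \<in> koszul_index t 2 \<longrightarrow> u \<in> fseq F \<and> b J = hcls u"
    using b unfolding carrier_gr by blast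
  then obtain \<beta> where \<beta>: "\<And>J. J \<in> koszul_index t 2 \<Longrightarrow> \<beta> J \<in> fseq F"
    "\<And>J. J \<in> koszul_index t 2 \<Longrightarrow> b J = hcls (\<beta> J)"
    by metis
  \<comment> \<open>The sign of the Koszul differential at \<open>{i}\<close>: the number of
    elements of \<open>{i}\<close> below \<open>j\<close> is 1 for \<open>i < j\<close> and 0
    otherwise.\<close>
  define sgn where "sgn i j x = (if i < j then \<ominus> x else x)" for i j :: nat and x
  have sgn_gr: "add_pow (gr U F) ((-1::int) ^ card {l \<in> {i}. l < j}) (hcls u) = hcls (\<lambda>n. sgn i j (u n))"
    and sgn_fseq: "(\<lambda>n. sgn i j (u n)) \<in> fseq F" if u: "u \<in> fseq F" for u i j
  proof -
    have u_cl: "hcls u \<in> carrier (gr U F)"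
      using u unfolding carrier_gr by blast
    have card: "card {l \<in> {i}. l < j} = (if i < j then 1 else 0)"
    proof -
      have "{l \<in> {i}. l < j} = (if i < j then {i} else {})"
        by auto
      then show ?thesis
        by simp
    qed
    have "add_pow (gr U F) (-1::int) (hcls u) = \<ominus>\<^bsub>gr U F\<^esub> hcls u"
      using G.add.int_pow_neg[OF u_cl, of 1] G.add.int_pow_1[OF u_cl] by (simp add: a_inv_def)
    then show "add_pow (gr U F) ((-1::int) ^ card {l \<in> {i}. l < j}) (hcls u) = hcls (\<lambda>n. sgn i j (u n))"
      unfolding card using G.add.int_pow_1[OF u_cl] gr_neg[OF u] by (simp add: sgn_def)
    show "(\<lambda>n. sgn i j (u n)) \<in> fseq F"
      using u fseq_neg[OF u] by (cases "i < j") (simp_all add: sgn_def)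
  qed
  \<comment> \<open>A lift of the component of the Koszul coefficient in degree
    \<open>N - d i - d j\<close>, the one that contributes to \<open>a i\<close> in degree
    \<open>N - d i\<close> after multiplication by \<open>g j\<close>; zero if that degree would be
    negative. With the sign included, \<open>B\<close> is antisymmetric.\<close>
  define B where "B i j = (if i \<noteq> j \<and> d i + d j \<le> N then sgn i j (\<beta> {i, j} (N - d i - d j)) else \<zero>)" for i j
  have B: "B i j \<in> filt U F (int N - int (d i) - int (d j))" if "i \<in> ?T" "j \<in> ?T" for i j
  proof (cases "i \<noteq> j \<and> d i + d j \<le> N")
    case True
    then have "int (N - d i - d j) = int N - int (d i) - int (d j)"
      by simp
    moreover have "sgn i j (\<beta> {i, j} (N - d i - d j)) \<in> filt U F (int (N - d i - d j))"
      using fseq_F_filt[OF sgn_fseq[OF \<beta>(1)[OF pair]]] True that by blast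
    ultimately show ?thesis
      using True by (simp only: B_def if_True simp_thms)
  next
    case False
    then show ?thesis
      by (auto simp: B_def filt_zero)
  qed
  then have Bc: "B i j \<in> carrier U" if "i \<in> ?T" "j \<in> ?T" for i j
    using that filt_closed by blast
  have B_anti: "B i j \<oplus> B j i = \<zero>" if ij: "i \<in> ?T" "j \<in> ?T" for i j
  proof (cases "i \<noteq> j \<and> d i + d j \<le> N")
    case True
    have swap: "{j, i} = {i, j}" "N - d j - d i = N - d i - d j"
      by auto
    have "\<beta> {i, j} (N - d i - d j) \<in> carrier U"
      using fseq_F_closed[OF \<beta>(1)[OF pair[OF ij]]] True by blast
    then show ?thesis
      using True unfolding B_def swap by (auto simp: sgn_def l_neg r_neg)
  next
    case False
    then show ?thesis
      by (auto simp: B_def)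
  qed
  \<comment> \<open>The boundary relation says this with \<open>g j\<close> in place of
    \<open>h j\<close>, and the exchange costs only elements of the same lower filtration step. For
    \<open>d i > N\<close> both \<open>a i\<close> and the \<open>B i j\<close> vanish.\<close>
  have rest: "a i \<ominus> (\<Oplus>j\<in>?T. B i j \<otimes> h j) \<in> filt U F (int N - int (d i) - 1)" if i: "i \<in> ?T" for i
  proof (cases "d i \<le> N")
    case False
    have "(\<Oplus>j\<in>?T. B i j \<otimes> h j) = (\<Oplus>j\<in>?T. \<zero>)"
      using False h_closed by (intro finsum_cong') (auto simp: B_def)
    moreover have "a i = \<zero>"
      using a[OF i] False by (simp add: filt_def)
    ultimately show ?thesis
      by (simp add: a_minus_def filt_zero)
  next
    case True
    \<comment> \<open>The relation for \<open>a i\<close> is read off in degree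
      \<open>N - d i\<close>, where the representatives on its right-hand side are the
      \<open>B i j \<otimes> g j\<close>.\<close>
    let ?n = "N - d i"
    let ?v = "\<lambda>j n. sgn i j (shift_mult (d j) (g j) (\<beta> {i, j}) n)"
    have \<beta>i: "\<beta> {i, j} \<in> fseq F" "b {i, j} = hcls (\<beta> {i, j})" if "j \<in> ?T - {i}" for j
      using \<beta> pair[OF i, of j] that by auto
    have v: "?v j \<in> fseq F" if "j \<in> ?T - {i}" for j
      using sgn_fseq[OF shift_mult_g_fseq[OF \<beta>i(1)[OF that]], of j i j] that by simp
    have "hcls (\<alpha> i) = (\<Oplus>\<^bsub>gr U F\<^esub>j\<in>?T - {i}. hcls (?v j))"
      unfolding \<alpha>_b[OF i]
    proof (rule G.finsum_cong')
      fix j assume j: "j \<in> ?T - {i}"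
      then have jT: "j \<in> ?T"
        by blast
      show "add_pow (gr U F) ((-1::int) ^ card {l \<in> {i}. l < j}) (b {i, j} \<otimes>\<^bsub>gr U F\<^esub> ?gs j) = hcls (?v j)"
        unfolding \<beta>i(2)[OF j] gr_mult_g[OF \<beta>i(1)[OF j] jT]
        by (rule sgn_gr[OF shift_mult_g_fseq[OF \<beta>i(1)[OF j] jT]])
    qed (use v in \<open>auto simp: carrier_gr\<close>)
    also have "\<dots> = hcls (\<lambda>n. \<Oplus>j\<in>?T - {i}. ?v j n)"
      using v by (intro gr_finsum(2)) auto
    finally have "\<alpha> i ?n \<ominus> (\<Oplus>j\<in>?T - {i}. ?v j ?n) \<in> filt U F (int ?n - 1)"
      using hcls_eq_iff[OF \<alpha>[OF i] gr_finsum(1)[of "?T - {i}" ?v]] v by auto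
    moreover have "\<alpha> i ?n = a i"
      using True by (simp add: \<alpha>_def)
    moreover have vc: "?v j ?n \<in> carrier U" if "j \<in> ?T - {i}" for j
      by (rule fseq_F_closed[OF v[OF that]])
    then have sum_v: "(\<Oplus>j\<in>?T - {i}. ?v j ?n) \<in> carrier U"
      by (intro finsum_closed) blast
    moreover have "(\<Oplus>j\<in>?T - {i}. ?v j ?n) = (\<Oplus>j\<in>?T. B i j \<otimes> g j)"
    proof -
      have "(\<Oplus>j\<in>?T. B i j \<otimes> g j) = B i i \<otimes> g i \<oplus> (\<Oplus>j\<in>?T - {i}. B i j \<otimes> g j)"
        using finsum_insert[of "?T - {i}" i "\<lambda>j. B i j \<otimes> g j"] i Bc[OF i] g_closed
        by (simp add: insert_absorb)
      also have "B i i \<otimes> g i = \<zero>"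
        using g_closed[OF i] by (simp add: B_def)
      also have "(\<Oplus>j\<in>?T - {i}. B i j \<otimes> g j) = (\<Oplus>j\<in>?T - {i}. ?v j ?n)"
      proof (rule finsum_cong')
        fix j assume j: "j \<in> ?T - {i}"
        then have jT: "j \<in> ?T" "i \<noteq> j"
          by blast+
        have le: "d j \<le> ?n \<longleftrightarrow> d i + d j \<le> N"
          using True by auto
        show "B i j \<otimes> g j = ?v j ?n"
          using jT(2) g_closed[OF jT(1)] fseq_F_closed[OF \<beta>i(1)[OF j]]
          by (simp add: B_def shift_mult_def le sgn_def l_minus)
      qed (use vc in auto)
      finally show ?thesis
        using sum_v by simp
    qed
    ultimately have 1: "a i \<ominus> (\<Oplus>j\<in>?T. B i j \<otimes> g j) \<in> filt U F (int N - int (d i) - 1)"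
      using True by simp
    have index: "int N - int (d i) - int (d j) + (int (d j) - 1) = int N - int (d i) - 1" for j
      by simp
    have 2: "(\<Oplus>j\<in>?T. B i j \<otimes> (g j \<ominus> h j)) \<in> filt U F (int N - int (d i) - 1)"
    proof (rule filt_finsum)
      fix j assume j: "j \<in> ?T"
      show "B i j \<otimes> (g j \<ominus> h j) \<in> filt U F (int N - int (d i) - 1)"
        using filt_mult[OF B[OF i j] g_diff_h[OF j]]
        by (simp only: index)
    qed
    have cl: "(\<Oplus>j\<in>?T. B i j \<otimes> h j) \<in> carrier U" "(\<Oplus>j\<in>?T. B i j \<otimes> (g j \<ominus> h j)) \<in> carrier U"
      using Bc[OF i] g_closed h_closed by (auto intro!: finsum_closed)
    have "(\<Oplus>j\<in>?T. B i j \<otimes> g j) = (\<Oplus>j\<in>?T. B i j \<otimes> h j \<oplus> B i j \<otimes> (g j \<ominus> h j))"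
    proof (rule finsum_cong')
      fix j assume j: "j \<in> ?T"
      show "B i j \<otimes> g j = B i j \<otimes> h j \<oplus> B i j \<otimes> (g j \<ominus> h j)"
        using Bc[OF i j] g_closed[OF j] h_closed[OF j] by algebra
    qed (use Bc[OF i] g_closed h_closed in auto)
    also have "\<dots> = (\<Oplus>j\<in>?T. B i j \<otimes> h j) \<oplus> (\<Oplus>j\<in>?T. B i j \<otimes> (g j \<ominus> h j))"
      using Bc[OF i] g_closed h_closed by (intro finsum_addf) auto
    finally have split: "(\<Oplus>j\<in>?T. B i j \<otimes> g j) =
        (\<Oplus>j\<in>?T. B i j \<otimes> h j) \<oplus> (\<Oplus>j\<in>?T. B i j \<otimes> (g j \<ominus> h j))" .
    have telescope: "x \<ominus> y = (x \<ominus> (y \<oplus> z)) \<oplus> z"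
      if "x \<in> carrier U" "y \<in> carrier U" "z \<in> carrier U" for x y z
      using that by algebra
    have "a i \<ominus> (\<Oplus>j\<in>?T. B i j \<otimes> h j) =
        (a i \<ominus> (\<Oplus>j\<in>?T. B i j \<otimes> g j)) \<oplus> (\<Oplus>j\<in>?T. B i j \<otimes> (g j \<ominus> h j))"
      unfolding split by (rule telescope[OF ac[OF i] cl])
    then show ?thesis
      using filt_add[OF 1 2] by simp
  qed
  let ?a' = "\<lambda>i. a i \<ominus> (\<Oplus>j\<in>?T. B i j \<otimes> h j)"
  let ?f = "\<lambda>i j. (B i j \<otimes> h j) \<otimes> h i"
  have fc: "?f i j \<in> carrier U" if "i \<in> ?T" "j \<in> ?T" for i j
    using that Bc h_closed by simp
  have inner: "(\<Oplus>j\<in>?T. B i j \<otimes> h j) \<in> carrier U" "(\<Oplus>j\<in>?T. ?f i j) \<in> carrier U" if "i \<in> ?T" for i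
    using that Bc h_closed by (auto intro!: finsum_closed)
  have "(\<Oplus>i\<in>?T. \<Oplus>j\<in>?T. ?f i j) = \<zero>"
  proof (rule finsum_antisymmetric)
    fix i j assume ij: "i \<in> ?T" "j \<in> ?T"
    have "?f i j \<oplus> ?f j i = (B i j \<oplus> B j i) \<otimes> (h i \<otimes> h j)"
      using Bc ij h_closed h_comm[OF ij] by (simp add: m_assoc l_distr)
    then show "?f i j \<oplus> ?f j i = \<zero>"
      using B_anti[OF ij] h_closed ij by simp
  next
    fix i assume i: "i \<in> ?T"
    show "?f i i = \<zero>"
      using h_closed[OF i] by (simp add: B_def)
  qed (use fc in auto)
  moreover have "(\<Oplus>i\<in>?T. ?a' i \<otimes> h i) \<oplus> (\<Oplus>i\<in>?T. \<Oplus>j\<in>?T. ?f i j) = (\<Oplus>i\<in>?T. a i \<otimes> h i)"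
  proof -
    have "(\<Oplus>i\<in>?T. ?a' i \<otimes> h i) \<oplus> (\<Oplus>i\<in>?T. \<Oplus>j\<in>?T. ?f i j) =
        (\<Oplus>i\<in>?T. ?a' i \<otimes> h i \<oplus> (\<Oplus>j\<in>?T. ?f i j))"
      using ac h_closed inner by (intro finsum_addf[symmetric]) auto
    also have "\<dots> = (\<Oplus>i\<in>?T. a i \<otimes> h i)"
    proof (rule finsum_cong')
      have telescope: "(x \<ominus> y) \<otimes> z \<oplus> y \<otimes> z = x \<otimes> z"
        if "x \<in> carrier U" "y \<in> carrier U" "z \<in> carrier U" for x y z
        using that by algebra
      fix i assume i: "i \<in> ?T"
      have "(\<Oplus>j\<in>?T. ?f i j) = (\<Oplus>j\<in>?T. B i j \<otimes> h j) \<otimes> h i"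
        using Bc[OF i] h_closed i by (intro finsum_ldistr[symmetric]) auto
      then show "?a' i \<otimes> h i \<oplus> (\<Oplus>j\<in>?T. ?f i j) = a i \<otimes> h i"
        using ac[OF i] h_closed[OF i] inner(1)[OF i] telescope by simp
    qed (use ac h_closed in auto)
    finally show ?thesis .
  qed
  moreover have "(\<Oplus>i\<in>?T. ?a' i \<otimes> h i) \<in> carrier U"
    using ac h_closed inner by (intro finsum_closed) auto
  ultimately have "(\<Oplus>i\<in>?T. ?a' i \<otimes> h i) = (\<Oplus>i\<in>?T. a i \<otimes> h i)"
    by simp
  then show ?thesis
    using rest by (intro exI[of _ ?a']) blast
qed

end

lemma (in ring) left_sum_incl:
  assumes x: "x \<in> {1..t} \<rightarrow> carrier R" and i: "i \<in> {1..t}"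
  shows "x i \<in> left_sum R (\<lambda>_. carrier R) x t"
proof -
  have xj: "x j \<in> carrier R" if "j \<in> {1..t}" for j
    using x that by blast
  have "(\<Oplus>j\<in>{1..t}. (if i = j then \<one> else \<zero>) \<otimes> x j) = (\<Oplus>j\<in>{1..t}. if i = j then x j else \<zero>)"
    using xj by (intro finsum_cong') auto
  also have "\<dots> = x i"
    using x i by (intro add.finprod_singleton) auto
  finally show ?thesis
    unfolding left_sum_def by (intro CollectI exI[of _ "\<lambda>j. if i = j then \<one> else \<zero>"]) auto
qed

section \<open>Coefficients of optimal degree, and the graded ideal\<close>

context koszul_deformation
begin

text \<open>The excess \<open>k\<close> drops by one at each step. As long as it is positive,
  \<open>F m\<close> lies in the filtration step \<open>m + k - 1\<close>, so the sum satisfies the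
  cancellation condition of \<open>lower_coefficients\<close>.\<close>

lemma lower_coefficients_to:
  assumes "\<And>j. j \<in> {1..t} \<Longrightarrow> a j \<in> filt U F (int (m + k) - int (d j))"
    and "(\<Oplus>j\<in>{1..t}. a j \<otimes> h j) \<in> F m"
  shows "\<exists>a'. (\<forall>j\<in>{1..t}. a' j \<in> filt U F (int m - int (d j))) \<and>
    (\<Oplus>j\<in>{1..t}. a' j \<otimes> h j) = (\<Oplus>j\<in>{1..t}. a j \<otimes> h j)"
  using assms
proof (induction k arbitrary: a)
  case 0
  then show ?case
    by (intro exI[of _ a]) simp
next
  case (Suc k)
  have "(\<Oplus>j\<in>{1..t}. a j \<otimes> h j) \<in> filt U F (int (m + Suc k) - 1)"
    using Suc.prems(2) filt_mono[of "int m" "int (m + Suc k) - 1"] by (auto simp: filt_nat)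
  then obtain a' where a': "\<And>j. j \<in> {1..t} \<Longrightarrow> a' j \<in> filt U F (int (m + Suc k) - int (d j) - 1)"
    "(\<Oplus>j\<in>{1..t}. a' j \<otimes> h j) = (\<Oplus>j\<in>{1..t}. a j \<otimes> h j)"
    using lower_coefficients[OF Suc.prems(1)] by blast
  have index: "int (m + Suc k) - int (d j) - 1 = int (m + k) - int (d j)" for j
    by simp
  show ?case
    using Suc.IH[of a'] a' Suc.prems(2) unfolding index by simp
qed

text \<open>The descent needs only some common bound for the coefficients to start from. Conversely
  each \<open>h j\<close> lies in \<open>F (d j)\<close>, which bounds the terms.\<close>

lemma left_sum_Int_F:
  "left_sum U (\<lambda>_. carrier U) h t \<inter> F m = left_sum U (\<lambda>j. filt U F (int m - int (d j))) h t"
proof (intro equalityI subsetI)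
  fix u assume u: "u \<in> left_sum U (\<lambda>_. carrier U) h t \<inter> F m"
  then obtain a where a: "\<And>j. j \<in> {1..t} \<Longrightarrow> a j \<in> carrier U" "u = (\<Oplus>j\<in>{1..t}. a j \<otimes> h j)"
    unfolding left_sum_def by blast
  have "\<exists>i. a j \<in> F i" if "j \<in> {1..t}" for j
    using a(1)[OF that] F_exhaustive by blast
  then obtain e where e: "\<And>j. j \<in> {1..t} \<Longrightarrow> a j \<in> F (e j)"
    by metis
  \<comment> \<open>A crude bound that dominates every \<open>e j + d j\<close>, so that each
    \<open>a j\<close> satisfies the starting condition of the descent.\<close>
  define k where "k = (\<Sum>j\<in>{1..t}. e j + d j)"
  have a_filt: "a j \<in> filt U F (int (m + k) - int (d j))" if j: "j \<in> {1..t}" for j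
  proof -
    have "e j + d j \<le> k"
      unfolding k_def using j by (intro member_le_sum) auto
    then show ?thesis
      using e[OF j] filt_mono[of "int (e j)" "int (m + k) - int (d j)"] by (auto simp: filt_nat)
  qed
  have "(\<Oplus>j\<in>{1..t}. a j \<otimes> h j) \<in> F m"
    using u unfolding a(2) by blast
  then obtain a' where a': "\<forall>j\<in>{1..t}. a' j \<in> filt U F (int m - int (d j))" "u = (\<Oplus>j\<in>{1..t}. a' j \<otimes> h j)"
    using lower_coefficients_to[OF a_filt] unfolding a(2) by metis
  then show "u \<in> left_sum U (\<lambda>j. filt U F (int m - int (d j))) h t"
    unfolding left_sum_def by (intro CollectI exI[of _ a']) auto
next
  fix u assume "u \<in> left_sum U (\<lambda>j. filt U F (int m - int (d j))) h t"
  then obtain a where a: "\<And>j. j \<in> {1..t} \<Longrightarrow> a j \<in> filt U F (int m - int (d j))"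
    "u = (\<Oplus>j\<in>{1..t}. a j \<otimes> h j)"
    unfolding left_sum_def by blast
  have "u \<in> filt U F (int m)"
    unfolding a(2)
  proof (rule filt_finsum)
    fix j assume j: "j \<in> {1..t}"
    show "a j \<otimes> h j \<in> filt U F (int m)"
      using filt_mult[OF a(1)[OF j] h_filt[OF j]] by simp
  qed
  moreover have "a j \<in> carrier U" if "j \<in> {1..t}" for j
    using a(1)[OF that] by (rule filt_closed)
  ultimately show "u \<in> left_sum U (\<lambda>_. carrier U) h t \<inter> F m"
    using a(2) unfolding left_sum_def by (auto simp: filt_nat)
qed

text \<open>In each degree \<open>n\<close> the products with \<open>g j\<close> and with
  \<open>h j\<close> differ by an element of the filtration step \<open>n - 1\<close>. So a left
  combination of symbols is represented by a sequence built from the \<open>h j\<close>, which lies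
  in the left ideal they generate.\<close>

lemma gr_finsum_mult_g:
  assumes a: "\<And>j. j \<in> {1..t} \<Longrightarrow> a j \<in> fseq F"
  shows "(\<Oplus>\<^bsub>gr U F\<^esub>j\<in>{1..t}. hcls (a j) \<otimes>\<^bsub>gr U F\<^esub> gr_symbol U F (g j)) =
      hcls (\<lambda>n. \<Oplus>j\<in>{1..t}. shift_mult (d j) (h j) (a j) n)"
    and "(\<lambda>n. \<Oplus>j\<in>{1..t}. shift_mult (d j) (h j) (a j) n) \<in> fseq F"
proof -
  interpret G: abelian_group "gr U F"
    by (rule gr_abelian_group)
  have sg: "shift_mult (d j) (g j) (a j) \<in> fseq F" "shift_mult (d j) (h j) (a j) \<in> fseq F"
    if j: "j \<in> {1..t}" for j
    using shift_mult_fseq[OF a[OF j]] g_F[OF j] h_filt[OF j] by (simp_all add: filt_nat)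
  show fs: "(\<lambda>n. \<Oplus>j\<in>{1..t}. shift_mult (d j) (h j) (a j) n) \<in> fseq F"
    using sg by (intro gr_finsum(1)) auto
  have gm: "hcls (a j) \<otimes>\<^bsub>gr U F\<^esub> gr_symbol U F (g j) = hcls (shift_mult (d j) (h j) (a j))" if j: "j \<in> {1..t}" for j
  proof -
    have "shift_mult (d j) (g j) (a j) n \<ominus> shift_mult (d j) (h j) (a j) n \<in> filt U F (int n - 1)" for n
    proof (cases "d j \<le> n")
      case True
      have "a j (n - d j) \<otimes> (g j \<ominus> h j) \<in> filt U F (int (n - d j) + (int (d j) - 1))"
        by (rule filt_mult[OF fseq_F_filt[OF a[OF j]] g_diff_h[OF j]])
      moreover have "int (n - d j) + (int (d j) - 1) = int n - 1"
        using True by simp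
      moreover have "a j (n - d j) \<otimes> (g j \<ominus> h j) = a j (n - d j) \<otimes> g j \<ominus> a j (n - d j) \<otimes> h j"
        using fseq_F_closed[OF a[OF j]] g_closed[OF j] h_closed[OF j] by (simp add: a_minus_def r_distr r_minus)
      ultimately show ?thesis
        using True by (simp add: shift_mult_def)
    next
      case False
      then show ?thesis
        by (simp add: shift_mult_def a_minus_def filt_zero)
    qed
    then show ?thesis
      using gr_mult_g[OF a[OF j] j] hcls_eq_iff[OF sg[OF j]] by simp
  qed
  have "(\<Oplus>\<^bsub>gr U F\<^esub>j\<in>{1..t}. hcls (a j) \<otimes>\<^bsub>gr U F\<^esub> gr_symbol U F (g j)) =
      (\<Oplus>\<^bsub>gr U F\<^esub>j\<in>{1..t}. hcls (shift_mult (d j) (h j) (a j)))"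
    using gm sg by (intro G.finsum_cong') (auto simp: carrier_gr)
  also have "\<dots> = hcls (\<lambda>n. \<Oplus>j\<in>{1..t}. shift_mult (d j) (h j) (a j) n)"
    using sg by (intro gr_finsum(2)) auto
  finally show "(\<Oplus>\<^bsub>gr U F\<^esub>j\<in>{1..t}. hcls (a j) \<otimes>\<^bsub>gr U F\<^esub> gr_symbol U F (g j)) =
      hcls (\<lambda>n. \<Oplus>j\<in>{1..t}. shift_mult (d j) (h j) (a j) n)" .
qed

lemma h_Pi: "h \<in> {1..t} \<rightarrow> carrier U"
  using h_closed by blast

text \<open>For one inclusion, each component lies in \<open>?I \<inter> F n\<close> and is written
  with coefficients of optimal degree; these are collected, for each \<open>j\<close>, into one
  element of the graded algebra. The other inclusion is \<open>gr_finsum_mult_g\<close>.\<close>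

lemma gr_ideal_left_sum:
  "gr_ideal U F (left_sum U (\<lambda>_. carrier U) h t) =
    left_sum (gr U F) (\<lambda>_. carrier (gr U F)) (\<lambda>j. gr_symbol U F (g j)) t"
proof -
  interpret G: abelian_group "gr U F"
    by (rule gr_abelian_group)
  let ?I = "left_sum U (\<lambda>_. carrier U) h t"
  have I: "left_ideal U ?I"
    by (rule left_ideal_left_sum[OF h_Pi])
  then have "additive_subgroup ?I U"
    by (simp add: left_ideal_def additive_subgroup_def)
  then have eq: "gr_ideal U F ?I = hcls ` fseq (\<lambda>n. ?I \<inter> F n)"
    by (rule gr_ideal_eq)
  show ?thesis
    unfolding eq
  proof (intro equalityI subsetI)
    fix x assume "x \<in> hcls ` fseq (\<lambda>n. ?I \<inter> F n)"
    then obtain u where u: "\<And>n. u n \<in> ?I \<inter> F n" "finite {n. u n \<noteq> \<zero>}" "x = hcls u"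
      by (auto simp: fseq_def)
    \<comment> \<open>A zero component is required to have zero coefficients, so that the collected
      sequences have finite support.\<close>
    have "\<forall>n. \<exists>a. (\<forall>j\<in>{1..t}. a j \<in> filt U F (int n - int (d j))) \<and> u n = (\<Oplus>j\<in>{1..t}. a j \<otimes> h j) \<and>
        (u n = \<zero> \<longrightarrow> a = (\<lambda>_. \<zero>))" (is "\<forall>n. \<exists>a. ?P n a")
    proof
      show "\<exists>a. ?P n a" for n
      proof (cases "u n = \<zero>")
        case True
        have "(\<Oplus>j\<in>{1..t}. \<zero> \<otimes> h j) = (\<Oplus>j\<in>{1..t}. \<zero>)"
          using h_closed by (intro finsum_cong') auto
        then show ?thesis
          using True filt_zero by (intro exI[of _ "\<lambda>_. \<zero>"]) simp
      next
        case False
        have "u n \<in> left_sum U (\<lambda>j. filt U F (int n - int (d j))) h t"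
          using u(1)[of n] unfolding left_sum_Int_F .
        then show ?thesis
          using False unfolding left_sum_def by blast
      qed
    qed
    from choice[OF this] obtain \<alpha> where "\<forall>n. ?P n (\<alpha> n)"
      by blast
    then have \<alpha>: "\<And>n j. j \<in> {1..t} \<Longrightarrow> \<alpha> n j \<in> filt U F (int n - int (d j))"
      "\<And>n. u n = (\<Oplus>j\<in>{1..t}. \<alpha> n j \<otimes> h j)" "\<And>n. u n = \<zero> \<Longrightarrow> \<alpha> n = (\<lambda>_. \<zero>)"
      by blast+
    \<comment> \<open>The coefficient of degree \<open>n\<close> at \<open>h j\<close> comes from
      the component of degree \<open>n + d j\<close>.\<close>
    define a where "a j n = \<alpha> (n + d j) j" for j n
    have a: "a j \<in> fseq F" if j: "j \<in> {1..t}" for j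
    proof (rule fseqI[where A = "{n. n + d j \<in> {n. u n \<noteq> \<zero>}}"])
      have "int (n + d j) - int (d j) = int n" for n
        by simp
      then show "a j n \<in> F n" for n
        using \<alpha>(1)[OF j, of "n + d j"] unfolding a_def by (simp only: filt_nat)
      show "finite {n. n + d j \<in> {n. u n \<noteq> \<zero>}}"
        using finite_vimageI[OF u(2), of "\<lambda>n. n + d j"] by (simp add: inj_def vimage_def)
      show "a j n = \<zero>" if "n \<notin> {n. n + d j \<in> {n. u n \<noteq> \<zero>}}" for n
        using that \<alpha>(3)[of "n + d j"] by (simp add: a_def)
    qed
    have u_eq: "u n = (\<Oplus>j\<in>{1..t}. shift_mult (d j) (h j) (a j) n)" for n
      unfolding \<alpha>(2)[of n]
    proof (rule finsum_cong')
      fix j assume j: "j \<in> {1..t}"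
      show "\<alpha> n j \<otimes> h j = shift_mult (d j) (h j) (a j) n"
      proof (cases "d j \<le> n")
        case False
        then have "\<alpha> n j = \<zero>"
          using \<alpha>(1)[OF j, of n] by (simp add: filt_def)
        with False show ?thesis
          using h_closed[OF j] by (simp add: shift_mult_def)
      qed (simp add: shift_mult_def a_def)
    next
      show "(\<lambda>j. shift_mult (d j) (h j) (a j) n) \<in> {1..t} \<rightarrow> carrier U"
        using fseq_F_closed[OF a] h_closed by (auto simp: shift_mult_def)
    qed simp
    have "x = (\<Oplus>\<^bsub>gr U F\<^esub>j\<in>{1..t}. hcls (a j) \<otimes>\<^bsub>gr U F\<^esub> gr_symbol U F (g j))"
    proof -
      have "u = (\<lambda>n. \<Oplus>j\<in>{1..t}. shift_mult (d j) (h j) (a j) n)"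
        by (rule ext) (rule u_eq)
      then show ?thesis
        using gr_finsum_mult_g(1)[of a] a u(3) by simp
    qed
    then show "x \<in> left_sum (gr U F) (\<lambda>_. carrier (gr U F)) (\<lambda>j. gr_symbol U F (g j)) t"
      unfolding left_sum_def using a by (intro CollectI exI[of _ "\<lambda>j. hcls (a j)"]) (auto simp: carrier_gr)
  next
    fix x assume "x \<in> left_sum (gr U F) (\<lambda>_. carrier (gr U F)) (\<lambda>j. gr_symbol U F (g j)) t"
    then obtain y where y: "\<And>j. j \<in> {1..t} \<Longrightarrow> y j \<in> carrier (gr U F)"
      "x = (\<Oplus>\<^bsub>gr U F\<^esub>j\<in>{1..t}. y j \<otimes>\<^bsub>gr U F\<^esub> gr_symbol U F (g j))"
      unfolding left_sum_def by blast
    have "\<forall>j. \<exists>u. j \<in> {1..t} \<longrightarrow> u \<in> fseq F \<and> y j = hcls u"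
      using y(1) unfolding carrier_gr by blast
    then obtain a where a: "\<And>j. j \<in> {1..t} \<Longrightarrow> a j \<in> fseq F" "\<And>j. j \<in> {1..t} \<Longrightarrow> y j = hcls (a j)"
      by metis
    let ?u = "\<lambda>n. \<Oplus>j\<in>{1..t}. shift_mult (d j) (h j) (a j) n"
    have "x = (\<Oplus>\<^bsub>gr U F\<^esub>j\<in>{1..t}. hcls (a j) \<otimes>\<^bsub>gr U F\<^esub> gr_symbol U F (g j))"
      unfolding y(2) using a y(1) gr_mult_g_closed by (intro G.finsum_cong') auto
    then have "x = hcls ?u"
      using gr_finsum_mult_g(1)[OF a(1)] by simp
    moreover have "?u n \<in> ?I" for n
    proof -
      have "?u n = (\<Oplus>j\<in>{1..t}. (if d j \<le> n then a j (n - d j) else \<zero>) \<otimes> h j)"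
        using fseq_F_closed[OF a(1)] h_closed by (intro finsum_cong') (auto simp: shift_mult_def)
      then show ?thesis
        unfolding left_sum_def using fseq_F_closed[OF a(1)]
        by (intro CollectI exI[of _ "\<lambda>j. if d j \<le> n then a j (n - d j) else \<zero>"]) auto
    qed
    then have "?u \<in> fseq (\<lambda>n. ?I \<inter> F n)"
      using gr_finsum_mult_g(2)[OF a(1)] by (simp add: fseq_def)
    ultimately show "x \<in> hcls ` fseq (\<lambda>n. ?I \<inter> F n)"
      by blast
  qed
qed

text \<open>If the \<open>h j\<close> generated \<open>U\<close>, its graded ideal would be all of
  \<open>gr U F\<close>, so the symbols of the \<open>g j\<close> would generate and the Koszul
  homology in degree 0 would be trivial.\<close>

lemma left_sum_proper: "left_sum U (\<lambda>_. carrier U) h t \<noteq> carrier U"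
proof
  interpret G: abelian_group "gr U F"
    by (rule gr_abelian_group)
  assume eq: "left_sum U (\<lambda>_. carrier U) h t = carrier U"
  have "additive_subgroup (carrier U) U"
    by (simp add: additive_subgroup_def add.subgroup_self)
  then have "gr_ideal U F (carrier U) = hcls ` fseq (\<lambda>n. carrier U \<inter> F n)"
    by (rule gr_ideal_eq)
  also have "(\<lambda>n. carrier U \<inter> F n) = F"
    using F_closed by (intro ext) blast
  finally have "left_sum (gr U F) (\<lambda>_. carrier (gr U F)) (\<lambda>j. gr_symbol U F (g j)) t = carrier (gr U F)"
    using gr_ideal_left_sum unfolding eq carrier_gr by simp
  then have "trivial_group (koszul_homology (gr U F) (\<lambda>j. gr_symbol U F (g j)) t 0)"
    by (intro G.left_sum_eq_carrier_imp_koszul_H0_trivial gr_mult_g_closed)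
  then show False
    using ci by (simp add: complete_intersection_def)
qed

lemma one_notin_left_sum: "\<one> \<notin> left_sum U (\<lambda>_. carrier U) h t"
proof
  note I = left_ideal_left_sum[OF h_Pi]
  assume 1: "\<one> \<in> left_sum U (\<lambda>_. carrier U) h t"
  then have "x \<in> left_sum U (\<lambda>_. carrier U) h t" if "x \<in> carrier U" for x
    using left_idealE(4)[OF I that 1] that by simp
  then show False
    using left_sum_proper left_idealE(1)[OF I] by blast
qed

lemma exists_simple_left_module_over:
  "\<exists>J. left_ideal U J \<and> simple_left_module U (left_quotient U J) \<and>
    module_generated_by U (left_quotient U J) (J +> \<one>) \<and> (\<forall>j\<in>{1..t}. h j \<in> J)"
  using exists_simple_left_module[OF left_ideal_left_sum[OF h_Pi] one_notin_left_sum] left_sum_incl[OF h_Pi]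
  by blast

end

section \<open>Eigenvectors in quotients by left ideals\<close>

lemma (in ring) left_quotient_smult_one_eq_iff:
  assumes J: "left_ideal R J" and "x \<in> carrier R" "y \<in> carrier R"
  shows "x \<odot>\<^bsub>left_quotient R J\<^esub> (J +> \<one>) = y \<odot>\<^bsub>left_quotient R J\<^esub> (J +> \<one>) \<longleftrightarrow> x \<ominus> y \<in> J"
  using abelian_subgroup.a_rcos_eq_iff[OF abelian_subgroup_left_ideal[OF J]] assms
  by (simp add: left_quotient_smult)

text \<open>Congruence modulo a left ideal is not multiplicative in general. Here
  \<open>x y - s x s y = x (y - s y) + s y (x - s x)\<close>, because the scalar \<open>s y\<close>
  is central, and both terms are left multiples of elements of \<open>J\<close>.\<close>

lemma (in assoc_algebra) gen_subalgebra_minus_Specm_val_mem: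
  assumes hyps: "algebraically_closed K" "finite S" "S \<subseteq> carrier U"
      "\<And>x y. x \<in> S \<Longrightarrow> y \<in> S \<Longrightarrow> x \<otimes>\<^bsub>U\<^esub> y = y \<otimes>\<^bsub>U\<^esub> x" "\<nu> \<in> Specm U (gen_subalgebra K U S)"
    and J: "left_ideal U J"
    and S_J: "\<And>x. x \<in> S \<Longrightarrow> x \<ominus>\<^bsub>U\<^esub> (Specm_val K U \<nu> x \<odot>\<^bsub>U\<^esub> \<one>\<^bsub>U\<^esub>) \<in> J"
    and x: "x \<in> gen_subalgebra K U S"
  shows "x \<ominus>\<^bsub>U\<^esub> (Specm_val K U \<nu> x \<odot>\<^bsub>U\<^esub> \<one>\<^bsub>U\<^esub>) \<in> J"
proof -
  let ?G = "(\<lambda>c. c \<odot>\<^bsub>U\<^esub> \<one>\<^bsub>U\<^esub>) ` carrier K \<union> S"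
  let ?\<Gamma> = "generate_ring U ?G"
  define s where "s x = Specm_val K U \<nu> x \<odot>\<^bsub>U\<^esub> \<one>\<^bsub>U\<^esub>" for x
  have \<Gamma>: "gen_subalgebra K U S = ?\<Gamma>"
    by (simp add: gen_subalgebra_def)
  have hom: "Specm_val K U \<nu> \<in> ring_hom (U\<lparr>carrier := ?\<Gamma>\<rparr>) K"
    and scalar: "\<And>c. c \<in> carrier K \<Longrightarrow> Specm_val K U \<nu> (c \<odot>\<^bsub>U\<^esub> \<one>\<^bsub>U\<^esub>) = c"
    using Specm_val_hom[OF hyps] by (simp_all add: \<Gamma>)
  have \<Gamma>_sub: "x \<in> carrier U" if "x \<in> ?\<Gamma>" for x
    using that hyps(3) by (intro U.generate_ring_in_carrier[of ?G]) auto
  have val: "Specm_val K U \<nu> x \<in> carrier K" if "x \<in> ?\<Gamma>" for x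
    using ring_hom_closed[OF hom] that by simp
  have s: "s x \<in> carrier U" if "x \<in> ?\<Gamma>" for x
    using val[OF that] by (simp add: s_def)
  have s_mult: "s (x \<otimes>\<^bsub>U\<^esub> y) = s x \<otimes>\<^bsub>U\<^esub> s y" if "x \<in> ?\<Gamma>" "y \<in> ?\<Gamma>" for x y
    using ring_hom_mult[OF hom, of x y] ring_hom_mult[OF one_hom val val] that by (simp add: s_def)
  have s_add: "s (x \<oplus>\<^bsub>U\<^esub> y) = s x \<oplus>\<^bsub>U\<^esub> s y" if "x \<in> ?\<Gamma>" "y \<in> ?\<Gamma>" for x y
    using ring_hom_add[OF hom, of x y] ring_hom_add[OF one_hom val val] that by (simp add: s_def)
  have s_comm: "x \<otimes>\<^bsub>U\<^esub> s y = s y \<otimes>\<^bsub>U\<^esub> x" if "x \<in> carrier U" "y \<in> ?\<Gamma>" for x y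
    using scalar_commutes[OF val that(1)] that(2) by (simp add: s_def)
  have s_scalar: "s (c \<odot>\<^bsub>U\<^esub> \<one>\<^bsub>U\<^esub>) = c \<odot>\<^bsub>U\<^esub> \<one>\<^bsub>U\<^esub>" if "c \<in> carrier K" for c
    using scalar[OF that] by (simp add: s_def)
  note JE = U.left_idealE[OF J]
  have minus_self: "z \<ominus>\<^bsub>U\<^esub> z \<in> J" if "z \<in> carrier U" for z
    using that JE(2) by (simp add: a_minus_def r_neg)
  have mult: "x \<otimes>\<^bsub>U\<^esub> y \<ominus>\<^bsub>U\<^esub> s (x \<otimes>\<^bsub>U\<^esub> y) \<in> J"
    if xy: "x \<in> ?\<Gamma>" "y \<in> ?\<Gamma>" and "x \<ominus>\<^bsub>U\<^esub> s x \<in> J" "y \<ominus>\<^bsub>U\<^esub> s y \<in> J" for x y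
  proof -
    note cl = \<Gamma>_sub[OF xy(1)] \<Gamma>_sub[OF xy(2)] s[OF xy(1)] s[OF xy(2)]
    have "x \<otimes>\<^bsub>U\<^esub> (y \<ominus>\<^bsub>U\<^esub> s y) \<oplus>\<^bsub>U\<^esub> s y \<otimes>\<^bsub>U\<^esub> (x \<ominus>\<^bsub>U\<^esub> s x) =
        (x \<otimes>\<^bsub>U\<^esub> y \<ominus>\<^bsub>U\<^esub> s y \<otimes>\<^bsub>U\<^esub> s x) \<oplus>\<^bsub>U\<^esub> (s y \<otimes>\<^bsub>U\<^esub> x \<ominus>\<^bsub>U\<^esub> x \<otimes>\<^bsub>U\<^esub> s y)"
      using cl by algebra
    also have "\<dots> = x \<otimes>\<^bsub>U\<^esub> y \<ominus>\<^bsub>U\<^esub> s (x \<otimes>\<^bsub>U\<^esub> y)"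
      unfolding s_comm[OF cl(1) xy(2)] s_mult[OF xy] s_comm[OF cl(3) xy(2)] using cl by algebra
    finally show ?thesis
      using JE(3)[OF JE(4)[OF cl(1) that(4)] JE(4)[OF cl(4) that(3)]] by (simp only:)
  qed
  have "x \<ominus>\<^bsub>U\<^esub> s x \<in> J" if "x \<in> ?\<Gamma>"
    using that
  proof (induction rule: generate_ring.induct)
    case one
    then show ?case
      using s_scalar[OF R.one_closed] minus_self by simp
  next
    case (incl x)
    then show ?case
      using S_J s_scalar minus_self by (auto simp: s_def[symmetric])
  next
    case (a_inv x)
    \<comment> \<open>Negation is treated as multiplication by the scalar -1, which reduces it to
      the product case.\<close>
    let ?c = "(\<ominus>\<^bsub>K\<^esub> \<one>\<^bsub>K\<^esub>) \<odot>\<^bsub>U\<^esub> \<one>\<^bsub>U\<^esub>"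
    have "?c \<in> ?\<Gamma>" "?c \<ominus>\<^bsub>U\<^esub> s ?c \<in> J"
      using s_scalar[of "\<ominus>\<^bsub>K\<^esub> \<one>\<^bsub>K\<^esub>"] minus_self by (auto intro: generate_ring.incl)
    then have "?c \<otimes>\<^bsub>U\<^esub> x \<ominus>\<^bsub>U\<^esub> s (?c \<otimes>\<^bsub>U\<^esub> x) \<in> J"
      using mult a_inv by blast
    moreover have "?c \<otimes>\<^bsub>U\<^esub> x = \<ominus>\<^bsub>U\<^esub> x"
      using \<Gamma>_sub[OF a_inv.hyps] by (simp add: smult_mult_left smult_l_minus U.l_minus)
    ultimately show ?case
      by simp
  next
    case (eng_add x y)
    note cl = \<Gamma>_sub[OF eng_add.hyps(1)] \<Gamma>_sub[OF eng_add.hyps(2)] s[OF eng_add.hyps(1)] s[OF eng_add.hyps(2)]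
    have "(x \<ominus>\<^bsub>U\<^esub> s x) \<oplus>\<^bsub>U\<^esub> (y \<ominus>\<^bsub>U\<^esub> s y) = x \<oplus>\<^bsub>U\<^esub> y \<ominus>\<^bsub>U\<^esub> s (x \<oplus>\<^bsub>U\<^esub> y)"
      unfolding s_add[OF eng_add.hyps] using cl by algebra
    then show ?case
      using JE(3)[OF eng_add.IH] by simp
  next
    case (eng_mult x y)
    then show ?case
      using mult by blast
  qed
  then show ?thesis
    using x by (simp add: \<Gamma> s_def)
qed

lemma (in ring) diff_commute:
  assumes "x \<in> carrier R" "y \<in> carrier R" "a \<in> carrier R" "b \<in> carrier R"
    and "x \<otimes> y = y \<otimes> x" "x \<otimes> b = b \<otimes> x" "a \<otimes> y = y \<otimes> a" "a \<otimes> b = b \<otimes> a"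
  shows "(x \<ominus> a) \<otimes> (y \<ominus> b) = (y \<ominus> b) \<otimes> (x \<ominus> a)"
proof -
  have "(x \<ominus> a) \<otimes> (y \<ominus> b) = x \<otimes> y \<ominus> x \<otimes> b \<ominus> (a \<otimes> y \<ominus> a \<otimes> b)"
    using assms(1-4) by algebra
  also have "\<dots> = y \<otimes> x \<ominus> b \<otimes> x \<ominus> (y \<otimes> a \<ominus> b \<otimes> a)"
    by (simp only: assms(5-8))
  also have "\<dots> = (y \<ominus> b) \<otimes> (x \<ominus> a)"
    using assms(1-4) by algebra
  finally show ?thesis .
qed

lemma (in filtered_algebra) filtered_ring: "filtered_ring U F"
proof (intro filtered_ring.intro filtered_ring_axioms.intro)
  show "additive_subgroup (F i) U" for i
    using F_submodule[of i] by (simp add: submodule_def additive_subgroup_def)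
  show "F i \<subseteq> F j" if "i \<le> j" for i j
    using F_mono that by (rule monoD)
qed (use U.ring_axioms F_mult F_exhaustive in auto)

theorem proposition2:
  fixes K :: "'k ring" and U :: "('k, 'u) module" and F :: "nat \<Rightarrow> 'u set"
    and t :: nat and g \<mu> :: "nat \<Rightarrow> 'u" and d :: "nat \<Rightarrow> nat"
  defines "\<Gamma> \<equiv> gen_subalgebra K U (g ` {1..t})"
    and "I \<equiv> left_sum U (\<lambda>_. carrier U) (\<lambda>i. g i \<ominus>\<^bsub>U\<^esub> \<mu> i) t"
  assumes "algebraically_closed K"
    and char_0: "\<forall>n::nat. n > 0 \<longrightarrow> add_pow K n \<one>\<^bsub>K\<^esub> \<noteq> \<zero>\<^bsub>K\<^esub>"
    and "filtered_algebra K U F"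
    and "g \<in> {1..t} \<rightarrow> carrier U"
    and "mutually_commuting U g t"
    and "complete_intersection (gr U F) (\<lambda>i. gr_symbol U F (g i)) t"
    and "\<mu> \<in> {1..t} \<rightarrow> carrier U"
    and d: "\<forall>i\<in>{1..t}. filt_deg U F (g i) = Fin (d i)"
    and "\<forall>i\<in>{1..t}. filt_deg U F (g i) > filt_deg U F (\<mu> i)"
    and "mutually_commuting U (\<lambda>i. g i \<ominus>\<^bsub>U\<^esub> \<mu> i) t"
  shows "(\<forall>m::nat. I \<inter> F m =
            left_sum U (\<lambda>i. filt U F (int m - int (d i))) (\<lambda>i. g i \<ominus>\<^bsub>U\<^esub> \<mu> i) t) \<and>
         (gr_ideal U F I =
            left_sum (gr U F) (\<lambda>_. carrier (gr U F)) (\<lambda>i. gr_symbol U F (g i)) t \<and>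
          I \<noteq> carrier U) \<and>
         (\<exists>(M :: ('u, 'u set) module) v. simple_left_module U M \<and> module_generated_by U M v \<and>
            (\<forall>i\<in>{1..t}. g i \<odot>\<^bsub>M\<^esub> v = \<mu> i \<odot>\<^bsub>M\<^esub> v)) \<and>
         (\<forall>\<nu>\<in>Specm U \<Gamma>. \<exists>(M :: ('u, 'u set) module) v. simple_left_module U M \<and>
            module_generated_by U M v \<and>
            (\<forall>\<gamma>\<in>\<Gamma>. \<gamma> \<odot>\<^bsub>M\<^esub> v = (Specm_val K U \<nu> \<gamma> \<odot>\<^bsub>U\<^esub> \<one>\<^bsub>U\<^esub>) \<odot>\<^bsub>M\<^esub> v))"
proof -
  interpret A: filtered_algebra K U F by fact
  interpret FR: filtered_ring U F
    by (rule A.filtered_ring)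
  let ?T = "{1..t}"
  have gc: "g j \<in> carrier U" and \<mu>c: "\<mu> j \<in> carrier U" if "j \<in> ?T" for j
    using assms(6,9) that by blast+
  have g_comm: "g i \<otimes>\<^bsub>U\<^esub> g j = g j \<otimes>\<^bsub>U\<^esub> g i" if "i \<in> ?T" "j \<in> ?T" for i j
    using assms(7) that unfolding mutually_commuting_def by blast
  \<comment> \<open>Used three times: with \<open>\<mu>\<close>, with zero in order to prove
    \<open>d j > 0\<close>, and with the scalars given by a point of the spectrum.\<close>
  have deform: "koszul_deformation U F t d g (\<lambda>j. g j \<ominus>\<^bsub>U\<^esub> m j)"
    if m: "\<And>j. j \<in> ?T \<Longrightarrow> m j \<in> filt U F (int (d j) - 1)"
      and comm: "mutually_commuting U (\<lambda>j. g j \<ominus>\<^bsub>U\<^esub> m j) t" for m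
  proof (intro koszul_deformation.intro koszul_deformation_axioms.intro)
    fix j assume j: "j \<in> ?T"
    have mc: "m j \<in> carrier U"
      by (rule FR.filt_closed[OF m[OF j]])
    show "g j \<ominus>\<^bsub>U\<^esub> m j \<in> carrier U"
      using gc[OF j] mc by simp
    have "g j \<ominus>\<^bsub>U\<^esub> (g j \<ominus>\<^bsub>U\<^esub> m j) = m j"
      using gc[OF j] mc by algebra
    then show "g j \<ominus>\<^bsub>U\<^esub> (g j \<ominus>\<^bsub>U\<^esub> m j) \<in> filt U F (int (d j) - 1)"
      using m[OF j] by (simp only:)
  qed (use FR.filtered_ring_axioms gc d assms(8) comm in \<open>auto simp: mutually_commuting_def\<close>)
  have \<mu>_filt: "\<mu> j \<in> filt U F (int (d j) - 1)" if j: "j \<in> ?T" for j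
    using FR.filt_deg_less_mem[OF \<mu>c[OF j]] assms(11) d j by auto
  interpret D: koszul_deformation U F t d g "\<lambda>j. g j \<ominus>\<^bsub>U\<^esub> \<mu> j"
    by (rule deform[OF \<mu>_filt assms(12)])
  have part3: "\<exists>(M :: ('u, 'u set) module) v. simple_left_module U M \<and> module_generated_by U M v \<and>
      (\<forall>i\<in>?T. g i \<odot>\<^bsub>M\<^esub> v = \<mu> i \<odot>\<^bsub>M\<^esub> v)"
  proof -
    obtain J where J: "left_ideal U J" "simple_left_module U (left_quotient U J)"
      "module_generated_by U (left_quotient U J) (J +>\<^bsub>U\<^esub> \<one>\<^bsub>U\<^esub>)" "\<forall>j\<in>?T. g j \<ominus>\<^bsub>U\<^esub> \<mu> j \<in> J"
      using D.exists_simple_left_module_over by blast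
    then show ?thesis
      using A.U.left_quotient_smult_one_eq_iff[OF J(1) gc \<mu>c] by blast
  qed
  \<comment> \<open>Scalars must have lower degree than \<open>g j\<close> in the fourth claim. A
    \<open>g j\<close> of degree 0 would be a nonzero scalar, hence invertible, and would put
    \<open>\<one>\<close> into the left ideal generated by the \<open>g j\<close>, which is
    proper.\<close>
  have d_pos: "d j > 0" if j: "j \<in> ?T" for j
  proof (rule ccontr)
    assume "\<not> d j > 0"
    then have "g j \<in> F 0"
      using FR.filt_deg_mem[OF gc[OF j]] d j by auto
    then obtain c where c: "c \<in> carrier K" "g j = c \<odot>\<^bsub>U\<^esub> \<one>\<^bsub>U\<^esub>"
      using A.F_zero unfolding bij_betw_def by blast
    have "g j \<noteq> \<zero>\<^bsub>U\<^esub>"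
      using bspec[OF d j] by (auto simp: filt_deg_def)
    then have "c \<noteq> \<zero>\<^bsub>K\<^esub>"
      using c(2) A.smult_l_null by auto
    then obtain c' where c': "c' \<in> carrier K" "c' \<otimes>\<^bsub>K\<^esub> c = \<one>\<^bsub>K\<^esub>"
      using c(1) A.field_Units unfolding Units_def by blast
    have "c' \<odot>\<^bsub>U\<^esub> \<one>\<^bsub>U\<^esub> \<otimes>\<^bsub>U\<^esub> g j = (c' \<otimes>\<^bsub>K\<^esub> c) \<odot>\<^bsub>U\<^esub> \<one>\<^bsub>U\<^esub>"
      using c c' ring_hom_mult[OF A.one_hom c'(1) c(1)] by simp
    then have one: "c' \<odot>\<^bsub>U\<^esub> \<one>\<^bsub>U\<^esub> \<otimes>\<^bsub>U\<^esub> g j = \<one>\<^bsub>U\<^esub>"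
      unfolding c'(2) by simp
    \<comment> \<open>Zero lies in every filtration step, including the one of index -1 that occurs
      for \<open>d j = 0\<close>; so this choice is available before \<open>d j > 0\<close> is
      known.\<close>
    interpret D0: koszul_deformation U F t d g "\<lambda>j. g j \<ominus>\<^bsub>U\<^esub> \<zero>\<^bsub>U\<^esub>"
      by (rule deform) (use assms(7) gc FR.filt_zero in \<open>auto simp: mutually_commuting_def a_minus_def\<close>)
    have "g j \<ominus>\<^bsub>U\<^esub> \<zero>\<^bsub>U\<^esub> \<in> left_sum U (\<lambda>_. carrier U) (\<lambda>j. g j \<ominus>\<^bsub>U\<^esub> \<zero>\<^bsub>U\<^esub>) t"
      by (rule A.U.left_sum_incl[OF D0.h_Pi j])
    then have "g j \<in> left_sum U (\<lambda>_. carrier U) (\<lambda>j. g j \<ominus>\<^bsub>U\<^esub> \<zero>\<^bsub>U\<^esub>) t"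
      using gc[OF j] by (simp add: a_minus_def)
    then have "\<one>\<^bsub>U\<^esub> \<in> left_sum U (\<lambda>_. carrier U) (\<lambda>j. g j \<ominus>\<^bsub>U\<^esub> \<zero>\<^bsub>U\<^esub>) t"
      using A.U.left_idealE(4)[OF A.U.left_ideal_left_sum[OF D0.h_Pi], of "c' \<odot>\<^bsub>U\<^esub> \<one>\<^bsub>U\<^esub>" "g j"] c'(1) one
      by simp
    then show False
      using D0.one_notin_left_sum by blast
  qed
  have part4: "\<exists>(M :: ('u, 'u set) module) v. simple_left_module U M \<and> module_generated_by U M v \<and>
      (\<forall>\<gamma>\<in>\<Gamma>. \<gamma> \<odot>\<^bsub>M\<^esub> v = (Specm_val K U \<nu> \<gamma> \<odot>\<^bsub>U\<^esub> \<one>\<^bsub>U\<^esub>) \<odot>\<^bsub>M\<^esub> v)" if \<nu>: "\<nu> \<in> Specm U \<Gamma>" for \<nu>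
  proof -
    have gT: "finite (g ` ?T)" "g ` ?T \<subseteq> carrier U"
      "\<And>x y. x \<in> g ` ?T \<Longrightarrow> y \<in> g ` ?T \<Longrightarrow> x \<otimes>\<^bsub>U\<^esub> y = y \<otimes>\<^bsub>U\<^esub> x"
      using gc g_comm by auto
    note val_hyps = assms(3) gT \<nu>[unfolded \<Gamma>_def]
    let ?s = "\<lambda>x. Specm_val K U \<nu> x \<odot>\<^bsub>U\<^esub> \<one>\<^bsub>U\<^esub>"
    have \<Gamma>: "\<Gamma> = generate_ring U ((\<lambda>c. c \<odot>\<^bsub>U\<^esub> \<one>\<^bsub>U\<^esub>) ` carrier K \<union> g ` ?T)"
      by (simp add: \<Gamma>_def gen_subalgebra_def)
    have \<Gamma>_sub: "\<gamma> \<in> carrier U" if "\<gamma> \<in> \<Gamma>" for \<gamma>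
      using that gT(2) unfolding \<Gamma> by (intro A.U.generate_ring_in_carrier) auto
    have val: "Specm_val K U \<nu> \<gamma> \<in> carrier K" if "\<gamma> \<in> \<Gamma>" for \<gamma>
      using ring_hom_closed[OF A.Specm_val_hom(1)[OF val_hyps]] that by (simp add: \<Gamma>_def)
    have g\<Gamma>: "g j \<in> \<Gamma>" if "j \<in> ?T" for j
      using that unfolding \<Gamma> by (intro generate_ring.incl) blast
    have sc: "?s (g j) \<in> carrier U" if "j \<in> ?T" for j
      using val[OF g\<Gamma>[OF that]] by simp
    have s_comm: "x \<otimes>\<^bsub>U\<^esub> ?s (g j) = ?s (g j) \<otimes>\<^bsub>U\<^esub> x" if "j \<in> ?T" "x \<in> carrier U" for j x
      by (rule A.scalar_commutes[OF val[OF g\<Gamma>[OF that(1)]] that(2)])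
    \<comment> \<open>The scalars lie in \<open>F 0\<close>, which is contained in
      \<open>F (d j - 1)\<close> as \<open>d j > 0\<close>; being central, they leave the
      differences commuting.\<close>
    interpret D': koszul_deformation U F t d g "\<lambda>j. g j \<ominus>\<^bsub>U\<^esub> ?s (g j)"
    proof (rule deform)
      fix j assume j: "j \<in> ?T"
      have "?s (g j) \<in> F 0"
        using A.F_zero val[OF g\<Gamma>[OF j]] unfolding bij_betw_def by blast
      then show "?s (g j) \<in> filt U F (int (d j) - 1)"
        using FR.filt_mono[of 0 "int (d j) - 1"] d_pos[OF j] by (auto simp: filt_def)
    next
      show "mutually_commuting U (\<lambda>j. g j \<ominus>\<^bsub>U\<^esub> ?s (g j)) t"
        unfolding mutually_commuting_def
      proof (intro ballI)
        fix i j assume ij: "i \<in> ?T" "j \<in> ?T"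
        show "(g i \<ominus>\<^bsub>U\<^esub> ?s (g i)) \<otimes>\<^bsub>U\<^esub> (g j \<ominus>\<^bsub>U\<^esub> ?s (g j)) = (g j \<ominus>\<^bsub>U\<^esub> ?s (g j)) \<otimes>\<^bsub>U\<^esub> (g i \<ominus>\<^bsub>U\<^esub> ?s (g i))"
          using s_comm[OF ij(1) gc[OF ij(2)]] s_comm[OF ij(2) gc[OF ij(1)]] s_comm[OF ij(2) sc[OF ij(1)]]
          by (intro A.U.diff_commute gc sc ij g_comm) (simp_all only:)
      qed
    qed
    obtain J where J: "left_ideal U J" "simple_left_module U (left_quotient U J)"
      "module_generated_by U (left_quotient U J) (J +>\<^bsub>U\<^esub> \<one>\<^bsub>U\<^esub>)" "\<forall>j\<in>?T. g j \<ominus>\<^bsub>U\<^esub> ?s (g j) \<in> J"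
      using D'.exists_simple_left_module_over by blast
    have "\<gamma> \<ominus>\<^bsub>U\<^esub> ?s \<gamma> \<in> J" if "\<gamma> \<in> \<Gamma>" for \<gamma>
      using A.gen_subalgebra_minus_Specm_val_mem[OF val_hyps J(1)] J(4) that unfolding \<Gamma>_def by blast
    then have "\<gamma> \<odot>\<^bsub>left_quotient U J\<^esub> (J +>\<^bsub>U\<^esub> \<one>\<^bsub>U\<^esub>) = ?s \<gamma> \<odot>\<^bsub>left_quotient U J\<^esub> (J +>\<^bsub>U\<^esub> \<one>\<^bsub>U\<^esub>)"
      if "\<gamma> \<in> \<Gamma>" for \<gamma>
      using A.U.left_quotient_smult_one_eq_iff[OF J(1) \<Gamma>_sub[OF that]] val[OF that] that by simp
    then show ?thesis
      using J(2,3) by blast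
  qed
  show ?thesis
    using D.left_sum_Int_F D.gr_ideal_left_sum D.left_sum_proper part3 part4 unfolding I_def by blast
qed

end
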